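(* Sending a display map category $(\mathcal C,\mathcal D)$ to the comprehension category $(\mathcal C,\mathcal D,\mathrm{cod}\circ\iota,\iota)$, where $\iota:\mathcal D\hookrightarrow\mathcal C^{\to}$ is the inclusion of $\mathcal D$ viewed as a full subcategory of the arrow category, extends to an isomorphism of 2-categories, which composed with the inclusion of strict maps into pseudo maps gives an equivalence of 2-categories: $$\mathbf{DMC}\;\cong\;\mathbf{CompCat}^{\mathrm{str2}}_{\mathrm{repl}}\;\simeq\;\mathbf{CompCat}_{\mathrm{repl}}.$$ Here $\mathbf{CompCat}^{\mathrm{str2}}_{\mathrm{repl}}$ and $\mathbf{CompCat}_{\mathrm{repl}}$ are the 2-categories of comprehension categories whose comprehension is a replete (full) subcategory inclusion, with strict maps and pseudo maps respectively, and with all transformations as 2-cells in both cases.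
   Context: **Comprehension categories.** A comprehension category $(\mathcal C,\mathcal T,p,\chi)$ is a category $\mathcal C$, a fibration $p:\mathcal T\to\mathcal C$, and a functor $\chi:\mathcal T\to\mathcal C^{\to}$ (comprehension) to the arrow category with $\mathrm{cod}\circ\chi=p$ strictly, sending $p$-cartesian maps to pullback squares. Write $\mathcal T_\Gamma=p^{-1}(\Gamma)$; for $A\in\mathcal T_\Gamma$ the domain of $\chi(A)$ is written $\Gamma.A$. A *pseudo map* $(F,\bar F,\varphi):(\mathcal C,\mathcal T,p,\chi)\to(\mathcal C',\mathcal T',p',\chi')$ is a functor $F:\mathcal C\to\mathcal C'$, a functor $\bar F:\mathcal T\to\mathcal T'$ strictly over $F$ sending $p$-cartesian maps to $p'$-cartesian maps, and a natural isomorphism $\varphi:\chi'\bar F\cong F^{\to}\chi$ lying strictly over the identity of $F$. It is *strict* if $\chi'\bar F=F^{\to}\chi$ and $\varphi$ is the identity. A *transformation* $(F,\bar F,\varphi)\Rightarrow(G,\bar G,\gamma)$ is a natural transformation $\alpha:F\Rightarrow G$ and another $\bar\alpha:\bar F\Rightarrow\bar G$ strictly over $\alpha$, with $\gamma_A\circ\chi'(\bar\alpha_A)=\alpha_{\Gamma.A}\circ\varphi_A$ for each $A\in\mathcal T_\Gamma$. $\mathbf{CompCat}$ (resp. $\mathbf{CompCat}^{\mathrm{str2}}$) is the 2-category of comprehension categories, pseudo (resp. strict) maps, and transformations. A comprehension category is *subcategorical* if $\chi$ is a full subcategory inclusion (full, faithful, injective on objects; $\mathcal T$ is identified with its image, a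 full subcategory of $\mathcal C^{\to}$); it is *replete* if moreover $\mathcal T$ is a replete (isomorphism-closed) subcategory of $\mathcal C^{\to}$. The subscript $\mathrm{repl}$ denotes the full sub-2-category on replete ones. **Display map categories.** A display map category is a category $\mathcal C$ with a replete (isomorphism-invariant) class $\mathcal D$ of morphisms, the display maps, such that for any display map $d$ and any map $f$ into its target there is a display map $f^*d$ that is a pullback of $d$ along $f$. A map of these is a functor preserving display maps and pullbacks thereof; a transformation is a natural transformation of functors. $\mathbf{DMC}$ is the resulting 2-category. **Conventions.** 2-categories and 2-functors are strict; $\cong$ is isomorphism of 2-categories; $\simeq$ is equivalence of 2-categories (connected by a 2-functor inducing equivalences on hom-categories and surjective on objects up to internal equivalence). *)

theory Defs
  imports "HOL-Library.FuncSet"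
begin

section \<open>Categories and functors\<close>

text \<open>
  All structure maps are required to be undefined outside their carriers. Hence equality of records
  is equality of categories, functors, transformations, and so on; strict notions (strict
  2-categories, isomorphism of 2-categories, equality of functors) can be stated with \<open>=\<close>.
\<close>

record ('o, 'a) cat =
  Obj :: "'o set"
  Arr :: "'a set"
  Dom :: "'a \<Rightarrow> 'o"
  Cod :: "'a \<Rightarrow> 'o"
  Ide :: "'o \<Rightarrow> 'a"
  Comp :: "'a \<Rightarrow> 'a \<Rightarrow> 'a"  (infixr "\<cdot>\<index>" 70)

definition homset :: "('o, 'a) cat \<Rightarrow> 'o \<Rightarrow> 'o \<Rightarrow> 'a set" where
  "homset C X Y = {f \<in> Arr C. Dom C f = X \<and> Cod C f = Y}"

locale category =
  fixes C :: "('o, 'a) cat"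
  assumes dom_obj: "f \<in> Arr C \<Longrightarrow> Dom C f \<in> Obj C"
    and cod_obj: "f \<in> Arr C \<Longrightarrow> Cod C f \<in> Obj C"
    and ide_hom: "X \<in> Obj C \<Longrightarrow> Ide C X \<in> homset C X X"
    and comp_hom: "\<lbrakk>f \<in> homset C X Y; g \<in> homset C Y Z\<rbrakk> \<Longrightarrow> g \<cdot>\<^bsub>C\<^esub> f \<in> homset C X Z"
    and ide_left: "f \<in> homset C X Y \<Longrightarrow> Ide C Y \<cdot>\<^bsub>C\<^esub> f = f"
    and ide_right: "f \<in> homset C X Y \<Longrightarrow> f \<cdot>\<^bsub>C\<^esub> Ide C X = f"
    and comp_assoc: "\<lbrakk>f \<in> homset C W X; g \<in> homset C X Y; h \<in> homset C Y Z\<rbrakk>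
      \<Longrightarrow> (h \<cdot>\<^bsub>C\<^esub> g) \<cdot>\<^bsub>C\<^esub> f = h \<cdot>\<^bsub>C\<^esub> (g \<cdot>\<^bsub>C\<^esub> f)"
    and dom_ext: "Dom C \<in> extensional (Arr C)"
    and cod_ext: "Cod C \<in> extensional (Arr C)"
    and ide_ext: "Ide C \<in> extensional (Obj C)"
    and comp_ext: "\<not> (g \<in> Arr C \<and> f \<in> Arr C \<and> Dom C g = Cod C f) \<Longrightarrow> g \<cdot>\<^bsub>C\<^esub> f = undefined"

definition inverse_arrs :: "('o, 'a) cat \<Rightarrow> 'a \<Rightarrow> 'a \<Rightarrow> bool" where
  "inverse_arrs C f g \<longleftrightarrow> f \<in> Arr C \<and> g \<in> homset C (Cod C f) (Dom C f)
     \<and> g \<cdot>\<^bsub>C\<^esub> f = Ide C (Dom C f) \<and> f \<cdot>\<^bsub>C\<^esub> g = Ide C (Cod C f)"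

definition iso_arr :: "('o, 'a) cat \<Rightarrow> 'a \<Rightarrow> bool" where
  "iso_arr C f \<longleftrightarrow> (\<exists>g. inverse_arrs C f g)"

definition isomorphic :: "('o, 'a) cat \<Rightarrow> 'o \<Rightarrow> 'o \<Rightarrow> bool" where
  "isomorphic C X Y \<longleftrightarrow> (\<exists>f \<in> homset C X Y. iso_arr C f)"

definition subcategory :: "('o, 'a) cat \<Rightarrow> ('o, 'a) cat \<Rightarrow> bool" where
  "subcategory S C \<longleftrightarrow> category S \<and> category C \<and> Obj S \<subseteq> Obj C \<and> Arr S \<subseteq> Arr C
     \<and> (\<forall>f \<in> Arr S. Dom S f = Dom C f \<and> Cod S f = Cod C f)
     \<and> (\<forall>X \<in> Obj S. Ide S X = Ide C X)
     \<and> (\<forall>f \<in> Arr S. \<forall>g \<in> Arr S. Dom S g = Cod S f \<longrightarrow> g \<cdot>\<^bsub>S\<^esub> f = g \<cdot>\<^bsub>C\<^esub> f)"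

definition replete_subcategory :: "('o, 'a) cat \<Rightarrow> ('o, 'a) cat \<Rightarrow> bool" where
  "replete_subcategory S C \<longleftrightarrow> subcategory S C
     \<and> (\<forall>f \<in> Arr C. iso_arr C f \<longrightarrow> Dom C f \<in> Obj S \<longrightarrow> f \<in> Arr S)"

definition full_subcat :: "('o, 'a) cat \<Rightarrow> 'o set \<Rightarrow> ('o, 'a) cat" where
  "full_subcat C S =
    (let A = {f \<in> Arr C. Dom C f \<in> S \<and> Cod C f \<in> S} in
     \<lparr> Obj = Obj C \<inter> S, Arr = A, Dom = restrict (Dom C) A, Cod = restrict (Cod C) A,
       Ide = restrict (Ide C) (Obj C \<inter> S),
       Comp = (\<lambda>g f. if g \<in> A \<and> f \<in> A \<and> Dom C g = Cod C f then g \<cdot>\<^bsub>C\<^esub> f else undefined) \<rparr>)"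

definition prod_cat :: "('o, 'a) cat \<Rightarrow> ('p, 'b) cat \<Rightarrow> ('o \<times> 'p, 'a \<times> 'b) cat" where
  "prod_cat C D =
    \<lparr> Obj = Obj C \<times> Obj D, Arr = Arr C \<times> Arr D,
      Dom = (\<lambda>f \<in> Arr C \<times> Arr D. (Dom C (fst f), Dom D (snd f))),
      Cod = (\<lambda>f \<in> Arr C \<times> Arr D. (Cod C (fst f), Cod D (snd f))),
      Ide = (\<lambda>X \<in> Obj C \<times> Obj D. (Ide C (fst X), Ide D (snd X))),
      Comp = (\<lambda>g f. if g \<in> Arr C \<times> Arr D \<and> f \<in> Arr C \<times> Arr D
                      \<and> Dom C (fst g) = Cod C (fst f) \<and> Dom D (snd g) = Cod D (snd f)
                    then (fst g \<cdot>\<^bsub>C\<^esub> fst f, snd g \<cdot>\<^bsub>D\<^esub> snd f) else undefined) \<rparr>"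

record ('o, 'a, 'p, 'b) fnctr =
  on_obj :: "'o \<Rightarrow> 'p"
  on_arr :: "'a \<Rightarrow> 'b"

locale cat_functor = source: category C + target: category D
  for C :: "('o, 'a) cat" and D :: "('p, 'b) cat" +
  fixes F :: "('o, 'a, 'p, 'b) fnctr"
  assumes on_obj_in: "X \<in> Obj C \<Longrightarrow> on_obj F X \<in> Obj D"
    and on_arr_in: "f \<in> homset C X Y \<Longrightarrow> on_arr F f \<in> homset D (on_obj F X) (on_obj F Y)"
    and on_arr_ide: "X \<in> Obj C \<Longrightarrow> on_arr F (Ide C X) = Ide D (on_obj F X)"
    and on_arr_comp: "\<lbrakk>f \<in> homset C X Y; g \<in> homset C Y Z\<rbrakk>
      \<Longrightarrow> on_arr F (g \<cdot>\<^bsub>C\<^esub> f) = on_arr F g \<cdot>\<^bsub>D\<^esub> on_arr F f"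
    and on_obj_ext: "on_obj F \<in> extensional (Obj C)"
    and on_arr_ext: "on_arr F \<in> extensional (Arr C)"

definition id_fnctr :: "('o, 'a) cat \<Rightarrow> ('o, 'a, 'o, 'a) fnctr" where
  "id_fnctr C = \<lparr> on_obj = (\<lambda>X \<in> Obj C. X), on_arr = (\<lambda>f \<in> Arr C. f) \<rparr>"

text \<open>The inclusion functor of a subcategory has the same underlying maps as its identity functor.\<close>

abbreviation incl_fnctr :: "('o, 'a) cat \<Rightarrow> ('o, 'a, 'o, 'a) fnctr" where
  "incl_fnctr S \<equiv> id_fnctr S"

definition comp_fnctr :: "('o, 'a) cat \<Rightarrow> ('p, 'b, 'q, 'c) fnctr \<Rightarrow> ('o, 'a, 'p, 'b) fnctr
    \<Rightarrow> ('o, 'a, 'q, 'c) fnctr" where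
  "comp_fnctr C G F =
    \<lparr> on_obj = compose (Obj C) (on_obj G) (on_obj F),
      on_arr = compose (Arr C) (on_arr G) (on_arr F) \<rparr>"

definition full_functor where
  "full_functor C D F \<longleftrightarrow> (\<forall>X \<in> Obj C. \<forall>Y \<in> Obj C.
     on_arr F ` homset C X Y = homset D (on_obj F X) (on_obj F Y))"

definition faithful_functor where
  "faithful_functor C F \<longleftrightarrow> (\<forall>X \<in> Obj C. \<forall>Y \<in> Obj C. inj_on (on_arr F) (homset C X Y))"

locale nat_trans = source: cat_functor C D F + target: cat_functor C D G
  for C :: "('o, 'a) cat" and D :: "('p, 'b) cat" and F G +
  fixes t :: "'o \<Rightarrow> 'b"
  assumes component: "X \<in> Obj C \<Longrightarrow> t X \<in> homset D (on_obj F X) (on_obj G X)"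
    and naturality: "f \<in> homset C X Y \<Longrightarrow> t Y \<cdot>\<^bsub>D\<^esub> on_arr F f = on_arr G f \<cdot>\<^bsub>D\<^esub> t X"
    and component_ext: "t \<in> extensional (Obj C)"

definition nat_iso where
  "nat_iso C D F G t \<longleftrightarrow> nat_trans C D F G t \<and> (\<forall>X \<in> Obj C. iso_arr D (t X))"

definition equivalence_functor where
  "equivalence_functor C D F \<longleftrightarrow> cat_functor C D F \<and>
    (\<exists>G \<eta> \<epsilon>. cat_functor D C G
      \<and> nat_iso C C (id_fnctr C) (comp_fnctr C G F) \<eta>
      \<and> nat_iso D D (comp_fnctr D F G) (id_fnctr D) \<epsilon>)"

definition vcomp_nt :: "('o, 'a) cat \<Rightarrow> ('p, 'b) cat \<Rightarrow> ('o \<Rightarrow> 'b) \<Rightarrow> ('o \<Rightarrow> 'b) \<Rightarrow> 'o \<Rightarrow> 'b" where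
  "vcomp_nt C D s t = (\<lambda>X \<in> Obj C. s X \<cdot>\<^bsub>D\<^esub> t X)"

text \<open>Horizontal composite of \<open>t : F \<Rightarrow> F'\<close> followed by \<open>s : G \<Rightarrow> G'\<close>, where \<open>F, F'\<close> have source \<open>C\<close>
  and \<open>G, G'\<close> have target \<open>E\<close>.\<close>

definition hcomp_nt :: "('o, 'a) cat \<Rightarrow> ('q, 'c) cat \<Rightarrow> ('p, 'b, 'q, 'c) fnctr
    \<Rightarrow> ('o, 'a, 'p, 'b) fnctr \<Rightarrow> ('p \<Rightarrow> 'c) \<Rightarrow> ('o \<Rightarrow> 'b) \<Rightarrow> 'o \<Rightarrow> 'c" where
  "hcomp_nt C E G F' s t = (\<lambda>X \<in> Obj C. s (on_obj F' X) \<cdot>\<^bsub>E\<^esub> on_arr G (t X))"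


section \<open>Strict 2-categories\<close>

text \<open>
  A strict 2-category is a category enriched in categories: it has hom-categories, whose objects
  and arrows are the 1-cells and 2-cells, and composition functors on products of these.
  \<open>HComp X Y Z\<close> takes a pair (second factor, first factor).
\<close>

record ('x, 'f, 't) twocat =
  Ob :: "'x set"
  HomCat :: "'x \<Rightarrow> 'x \<Rightarrow> ('f, 't) cat"
  Id1 :: "'x \<Rightarrow> 'f"
  HComp :: "'x \<Rightarrow> 'x \<Rightarrow> 'x \<Rightarrow> ('f \<times> 'f, 't \<times> 't, 'f, 't) fnctr"

locale two_category =
  fixes A :: "('x, 'f, 't) twocat"
  assumes hom_category: "\<lbrakk>X \<in> Ob A; Y \<in> Ob A\<rbrakk> \<Longrightarrow> category (HomCat A X Y)"
    and id1_in: "X \<in> Ob A \<Longrightarrow> Id1 A X \<in> Obj (HomCat A X X)"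
    and hcomp_functor: "\<lbrakk>X \<in> Ob A; Y \<in> Ob A; Z \<in> Ob A\<rbrakk>
      \<Longrightarrow> cat_functor (prod_cat (HomCat A Y Z) (HomCat A X Y)) (HomCat A X Z) (HComp A X Y Z)"
    and hcomp_assoc_1:
      "\<lbrakk>W \<in> Ob A; X \<in> Ob A; Y \<in> Ob A; Z \<in> Ob A;
        f \<in> Obj (HomCat A W X); g \<in> Obj (HomCat A X Y); h \<in> Obj (HomCat A Y Z)\<rbrakk>
      \<Longrightarrow> on_obj (HComp A W X Z) (on_obj (HComp A X Y Z) (h, g), f)
        = on_obj (HComp A W Y Z) (h, on_obj (HComp A W X Y) (g, f))"
    and hcomp_assoc_2:
      "\<lbrakk>W \<in> Ob A; X \<in> Ob A; Y \<in> Ob A; Z \<in> Ob A;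
        r \<in> Arr (HomCat A W X); s \<in> Arr (HomCat A X Y); t \<in> Arr (HomCat A Y Z)\<rbrakk>
      \<Longrightarrow> on_arr (HComp A W X Z) (on_arr (HComp A X Y Z) (t, s), r)
        = on_arr (HComp A W Y Z) (t, on_arr (HComp A W X Y) (s, r))"
    and hcomp_unit_1:
      "\<lbrakk>X \<in> Ob A; Y \<in> Ob A; f \<in> Obj (HomCat A X Y)\<rbrakk>
      \<Longrightarrow> on_obj (HComp A X Y Y) (Id1 A Y, f) = f \<and> on_obj (HComp A X X Y) (f, Id1 A X) = f"
    and hcomp_unit_2:
      "\<lbrakk>X \<in> Ob A; Y \<in> Ob A; t \<in> Arr (HomCat A X Y)\<rbrakk>
      \<Longrightarrow> on_arr (HComp A X Y Y) (Ide (HomCat A Y Y) (Id1 A Y), t) = t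
        \<and> on_arr (HComp A X X Y) (t, Ide (HomCat A X X) (Id1 A X)) = t"

record ('x, 'f, 't, 'y, 'g, 'u) twofnctr =
  tf_ob :: "'x \<Rightarrow> 'y"
  tf_hom :: "'x \<Rightarrow> 'x \<Rightarrow> ('f, 't, 'g, 'u) fnctr"

locale two_functor = source: two_category A + target: two_category B
  for A :: "('x, 'f, 't) twocat" and B :: "('y, 'g, 'u) twocat" +
  fixes P :: "('x, 'f, 't, 'y, 'g, 'u) twofnctr"
  assumes tf_ob_in: "X \<in> Ob A \<Longrightarrow> tf_ob P X \<in> Ob B"
    and tf_hom_functor: "\<lbrakk>X \<in> Ob A; Y \<in> Ob A\<rbrakk>
      \<Longrightarrow> cat_functor (HomCat A X Y) (HomCat B (tf_ob P X) (tf_ob P Y)) (tf_hom P X Y)"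
    and tf_id1: "X \<in> Ob A \<Longrightarrow> on_obj (tf_hom P X X) (Id1 A X) = Id1 B (tf_ob P X)"
    and tf_hcomp_1:
      "\<lbrakk>X \<in> Ob A; Y \<in> Ob A; Z \<in> Ob A; f \<in> Obj (HomCat A X Y); g \<in> Obj (HomCat A Y Z)\<rbrakk>
      \<Longrightarrow> on_obj (tf_hom P X Z) (on_obj (HComp A X Y Z) (g, f))
        = on_obj (HComp B (tf_ob P X) (tf_ob P Y) (tf_ob P Z))
            (on_obj (tf_hom P Y Z) g, on_obj (tf_hom P X Y) f)"
    and tf_hcomp_2:
      "\<lbrakk>X \<in> Ob A; Y \<in> Ob A; Z \<in> Ob A; s \<in> Arr (HomCat A X Y); t \<in> Arr (HomCat A Y Z)\<rbrakk>
      \<Longrightarrow> on_arr (tf_hom P X Z) (on_arr (HComp A X Y Z) (t, s))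
        = on_arr (HComp B (tf_ob P X) (tf_ob P Y) (tf_ob P Z))
            (on_arr (tf_hom P Y Z) t, on_arr (tf_hom P X Y) s)"
    and tf_ob_ext: "tf_ob P \<in> extensional (Ob A)"
    and tf_hom_ext: "\<not> (X \<in> Ob A \<and> Y \<in> Ob A) \<Longrightarrow> tf_hom P X Y = undefined"

definition id_twofnctr :: "('x, 'f, 't) twocat \<Rightarrow> ('x, 'f, 't, 'x, 'f, 't) twofnctr" where
  "id_twofnctr A =
    \<lparr> tf_ob = (\<lambda>X \<in> Ob A. X),
      tf_hom = (\<lambda>X Y. if X \<in> Ob A \<and> Y \<in> Ob A then id_fnctr (HomCat A X Y) else undefined) \<rparr>"

text \<open>As for categories: the inclusion of a sub-2-category.\<close>

abbreviation incl_twofnctr :: "('x, 'f, 't) twocat \<Rightarrow> ('x, 'f, 't, 'x, 'f, 't) twofnctr" where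
  "incl_twofnctr A \<equiv> id_twofnctr A"

definition comp_twofnctr :: "('x, 'f, 't) twocat \<Rightarrow> ('y, 'g, 'u, 'z, 'h, 'v) twofnctr
    \<Rightarrow> ('x, 'f, 't, 'y, 'g, 'u) twofnctr \<Rightarrow> ('x, 'f, 't, 'z, 'h, 'v) twofnctr" where
  "comp_twofnctr A Q P =
    \<lparr> tf_ob = compose (Ob A) (tf_ob Q) (tf_ob P),
      tf_hom = (\<lambda>X Y. if X \<in> Ob A \<and> Y \<in> Ob A
         then comp_fnctr (HomCat A X Y) (tf_hom Q (tf_ob P X) (tf_ob P Y)) (tf_hom P X Y)
         else undefined) \<rparr>"

definition two_isomorphism where
  "two_isomorphism A B P \<longleftrightarrow> two_functor A B P \<and>
    (\<exists>Q. two_functor B A Q \<and> comp_twofnctr A Q P = id_twofnctr A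
       \<and> comp_twofnctr B P Q = id_twofnctr B)"

definition internally_equivalent :: "('x, 'f, 't) twocat \<Rightarrow> 'x \<Rightarrow> 'x \<Rightarrow> bool" where
  "internally_equivalent A X Y \<longleftrightarrow>
    (\<exists>f \<in> Obj (HomCat A X Y). \<exists>g \<in> Obj (HomCat A Y X).
       isomorphic (HomCat A X X) (on_obj (HComp A X Y X) (g, f)) (Id1 A X)
     \<and> isomorphic (HomCat A Y Y) (on_obj (HComp A Y X Y) (f, g)) (Id1 A Y))"

definition two_equivalence where
  "two_equivalence A B P \<longleftrightarrow> two_functor A B P
    \<and> (\<forall>X \<in> Ob A. \<forall>Y \<in> Ob A.
        equivalence_functor (HomCat A X Y) (HomCat B (tf_ob P X) (tf_ob P Y)) (tf_hom P X Y))
    \<and> (\<forall>Y \<in> Ob B. \<exists>X \<in> Ob A. internally_equivalent B (tf_ob P X) Y)"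

definition full_sub_twocat :: "('x, 'f, 't) twocat \<Rightarrow> ('x \<Rightarrow> bool) \<Rightarrow> ('x, 'f, 't) twocat" where
  "full_sub_twocat A P = A \<lparr> Ob := {X \<in> Ob A. P X} \<rparr>"

definition locally_full_sub_twocat ::
    "('x, 'f, 't) twocat \<Rightarrow> ('x \<Rightarrow> 'x \<Rightarrow> 'f \<Rightarrow> bool) \<Rightarrow> ('x, 'f, 't) twocat" where
  "locally_full_sub_twocat A P =
    (let H = (\<lambda>X Y. full_subcat (HomCat A X Y) {f. P X Y f}) in
     A \<lparr> HomCat := H,
         HComp := (\<lambda>X Y Z. comp_fnctr (prod_cat (H Y Z) (H X Y)) (HComp A X Y Z)
                              (incl_fnctr (prod_cat (H Y Z) (H X Y)))) \<rparr>)"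


section \<open>Arrow categories and pullback squares\<close>

text \<open>
  \<open>Square f g u v\<close> is the arrow \<open>f \<rightarrow> g\<close> of the arrow category whose domain and codomain
  components are \<open>u\<close> and \<open>v\<close>, i.e. \<open>v \<cdot> f = g \<cdot> u\<close>.
\<close>

datatype 'a square = Square (sq_src: 'a) (sq_tgt: 'a) (sq_dom: 'a) (sq_cod: 'a)

definition squares :: "('o, 'a) cat \<Rightarrow> 'a square set" where
  "squares C = {Square f g u v | f g u v.
     f \<in> Arr C \<and> g \<in> Arr C \<and> u \<in> homset C (Dom C f) (Dom C g) \<and> v \<in> homset C (Cod C f) (Cod C g)
     \<and> v \<cdot>\<^bsub>C\<^esub> f = g \<cdot>\<^bsub>C\<^esub> u}"

definition arrow_cat :: "('o, 'a) cat \<Rightarrow> ('a, 'a square) cat" where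
  "arrow_cat C =
    \<lparr> Obj = Arr C, Arr = squares C,
      Dom = restrict sq_src (squares C), Cod = restrict sq_tgt (squares C),
      Ide = (\<lambda>f \<in> Arr C. Square f f (Ide C (Dom C f)) (Ide C (Cod C f))),
      Comp = (\<lambda>t s. if t \<in> squares C \<and> s \<in> squares C \<and> sq_src t = sq_tgt s
                    then Square (sq_src s) (sq_tgt t)
                           (sq_dom t \<cdot>\<^bsub>C\<^esub> sq_dom s) (sq_cod t \<cdot>\<^bsub>C\<^esub> sq_cod s)
                    else undefined) \<rparr>"

definition cod_functor :: "('o, 'a) cat \<Rightarrow> ('a, 'a square, 'o, 'a) fnctr" where
  "cod_functor C = \<lparr> on_obj = restrict (Cod C) (Arr C), on_arr = restrict sq_cod (squares C) \<rparr>"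

text \<open>The functor \<open>F\<^sup>\<rightarrow>\<close> on arrow categories; \<open>C\<close> is the source of \<open>F\<close>.\<close>

definition arrow_functor ::
    "('o, 'a) cat \<Rightarrow> ('o, 'a, 'p, 'b) fnctr \<Rightarrow> ('a, 'a square, 'b, 'b square) fnctr" where
  "arrow_functor C F =
    \<lparr> on_obj = restrict (on_arr F) (Arr C),
      on_arr = restrict (map_square (on_arr F)) (squares C) \<rparr>"

text \<open>\<open>Square f g u v\<close> is a pullback square when it exhibits \<open>f\<close> as a pullback of \<open>g\<close> along \<open>v\<close>.\<close>

definition pullback_square :: "('o, 'a) cat \<Rightarrow> 'a square \<Rightarrow> bool" where
  "pullback_square C s \<longleftrightarrow> s \<in> squares C \<and>
    (\<forall>x \<in> Arr C. \<forall>y \<in> Arr C.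
       Dom C x = Dom C y \<and> Cod C x = Dom C (sq_tgt s) \<and> Cod C y = Cod C (sq_src s)
       \<and> sq_tgt s \<cdot>\<^bsub>C\<^esub> x = sq_cod s \<cdot>\<^bsub>C\<^esub> y
     \<longrightarrow> (\<exists>!z. z \<in> homset C (Dom C x) (Dom C (sq_src s))
              \<and> sq_dom s \<cdot>\<^bsub>C\<^esub> z = x \<and> sq_src s \<cdot>\<^bsub>C\<^esub> z = y))"


section \<open>Comprehension categories\<close>

definition cartesian ::
    "('to, 'ta) cat \<Rightarrow> ('o, 'a) cat \<Rightarrow> ('to, 'ta, 'o, 'a) fnctr \<Rightarrow> 'ta \<Rightarrow> bool" where
  "cartesian T C p g \<longleftrightarrow> g \<in> Arr T \<and>
    (\<forall>h \<in> Arr T. \<forall>w \<in> homset C (on_obj p (Dom T h)) (on_obj p (Dom T g)).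
       Cod T h = Cod T g \<and> on_arr p g \<cdot>\<^bsub>C\<^esub> w = on_arr p h
     \<longrightarrow> (\<exists>!k. k \<in> homset T (Dom T h) (Dom T g) \<and> on_arr p k = w \<and> g \<cdot>\<^bsub>T\<^esub> k = h))"

locale fibration = cat_functor T C p
  for T :: "('to, 'ta) cat" and C :: "('o, 'a) cat" and p +
  assumes cartesian_lift: "\<lbrakk>A \<in> Obj T; f \<in> Arr C; Cod C f = on_obj p A\<rbrakk>
    \<Longrightarrow> \<exists>g. cartesian T C p g \<and> Cod T g = A \<and> on_arr p g = f"

record ('o, 'a, 'to, 'ta) compcat =
  Base :: "('o, 'a) cat"
  Total :: "('to, 'ta) cat"
  Proj :: "('to, 'ta, 'o, 'a) fnctr"
  Compr :: "('to, 'ta, 'a, 'a square) fnctr"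

locale comprehension_category =
  fixes K :: "('o, 'a, 'to, 'ta) compcat"
  assumes base_category: "category (Base K)"
    and proj_fibration: "fibration (Total K) (Base K) (Proj K)"
    and compr_functor: "cat_functor (Total K) (arrow_cat (Base K)) (Compr K)"
    and cod_compr: "comp_fnctr (Total K) (cod_functor (Base K)) (Compr K) = Proj K"
    and compr_cartesian: "cartesian (Total K) (Base K) (Proj K) g
      \<Longrightarrow> pullback_square (Base K) (on_arr (Compr K) g)"

text \<open>The extended context \<open>\<Gamma>.A\<close>; the context \<open>\<Gamma>\<close> is determined by \<open>A\<close>.\<close>

definition ext_ctx :: "('o, 'a, 'to, 'ta) compcat \<Rightarrow> 'to \<Rightarrow> 'o" where
  "ext_ctx K A = Dom (Base K) (on_obj (Compr K) A)"

record ('o, 'a, 'to, 'ta) pmap =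
  pm_base :: "('o, 'a, 'o, 'a) fnctr"
  pm_total :: "('to, 'ta, 'to, 'ta) fnctr"
  pm_iso :: "'to \<Rightarrow> 'a square"

locale pseudo_map = source: comprehension_category K + target: comprehension_category L
  for K L :: "('o, 'a, 'to, 'ta) compcat" +
  fixes m :: "('o, 'a, 'to, 'ta) pmap"
  assumes pm_base_functor: "cat_functor (Base K) (Base L) (pm_base m)"
    and pm_total_functor: "cat_functor (Total K) (Total L) (pm_total m)"
    and pm_over: "comp_fnctr (Total K) (Proj L) (pm_total m)
      = comp_fnctr (Total K) (pm_base m) (Proj K)"
    and pm_cartesian: "cartesian (Total K) (Base K) (Proj K) g
      \<Longrightarrow> cartesian (Total L) (Base L) (Proj L) (on_arr (pm_total m) g)"
    and pm_nat_iso: "nat_iso (Total K) (arrow_cat (Base L))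
      (comp_fnctr (Total K) (Compr L) (pm_total m))
      (comp_fnctr (Total K) (arrow_functor (Base K) (pm_base m)) (Compr K)) (pm_iso m)"
    and pm_iso_over: "A \<in> Obj (Total K)
      \<Longrightarrow> sq_cod (pm_iso m A) = Ide (Base L) (on_obj (pm_base m) (on_obj (Proj K) A))"

definition strict_map where
  "strict_map K L m \<longleftrightarrow> pseudo_map K L m
    \<and> comp_fnctr (Total K) (Compr L) (pm_total m)
      = comp_fnctr (Total K) (arrow_functor (Base K) (pm_base m)) (Compr K)
    \<and> pm_iso m = (\<lambda>A \<in> Obj (Total K).
        Ide (arrow_cat (Base L)) (on_obj (Compr L) (on_obj (pm_total m) A)))"

definition pm_id :: "('o, 'a, 'to, 'ta) compcat \<Rightarrow> ('o, 'a, 'to, 'ta) pmap" where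
  "pm_id K =
    \<lparr> pm_base = id_fnctr (Base K), pm_total = id_fnctr (Total K),
      pm_iso = (\<lambda>A \<in> Obj (Total K). Ide (arrow_cat (Base K)) (on_obj (Compr K) A)) \<rparr>"

text \<open>Composite of \<open>m : K \<rightarrow> L\<close> and \<open>n : L \<rightarrow> M\<close>; the isomorphism is the pasting of the two given ones.\<close>

definition pm_comp where
  "pm_comp K L M n m =
    \<lparr> pm_base = comp_fnctr (Base K) (pm_base n) (pm_base m),
      pm_total = comp_fnctr (Total K) (pm_total n) (pm_total m),
      pm_iso = (\<lambda>A \<in> Obj (Total K).
        on_arr (arrow_functor (Base L) (pm_base n)) (pm_iso m A)
          \<cdot>\<^bsub>arrow_cat (Base M)\<^esub> pm_iso n (on_obj (pm_total m) A)) \<rparr>"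

record ('o, 'a, 'to, 'ta) cctrans =
  ct_src :: "('o, 'a, 'to, 'ta) pmap"
  ct_tgt :: "('o, 'a, 'to, 'ta) pmap"
  ct_base :: "'o \<Rightarrow> 'a"
  ct_total :: "'to \<Rightarrow> 'ta"

text \<open>
  The components of \<open>\<phi>\<close>, \<open>\<gamma>\<close> and \<open>\<chi>'(\<alpha>\<^sub>A)\<close> are squares; the compatibility condition concerns
  their domain components.
\<close>

locale cc_transformation =
  source: pseudo_map K L "ct_src t" + target: pseudo_map K L "ct_tgt t"
  for K L :: "('o, 'a, 'to, 'ta) compcat" and t :: "('o, 'a, 'to, 'ta) cctrans" +
  assumes ct_base_nt:
      "nat_trans (Base K) (Base L) (pm_base (ct_src t)) (pm_base (ct_tgt t)) (ct_base t)"
    and ct_total_nt: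
      "nat_trans (Total K) (Total L) (pm_total (ct_src t)) (pm_total (ct_tgt t)) (ct_total t)"
    and ct_over: "A \<in> Obj (Total K)
      \<Longrightarrow> on_arr (Proj L) (ct_total t A) = ct_base t (on_obj (Proj K) A)"
    and ct_compat: "A \<in> Obj (Total K)
      \<Longrightarrow> sq_dom (pm_iso (ct_tgt t) A) \<cdot>\<^bsub>Base L\<^esub> sq_dom (on_arr (Compr L) (ct_total t A))
        = ct_base t (ext_ctx K A) \<cdot>\<^bsub>Base L\<^esub> sq_dom (pm_iso (ct_src t) A)"

definition compcat_hom ::
    "('o, 'a, 'to, 'ta) compcat \<Rightarrow> ('o, 'a, 'to, 'ta) compcat
      \<Rightarrow> (('o, 'a, 'to, 'ta) pmap, ('o, 'a, 'to, 'ta) cctrans) cat" where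
  "compcat_hom K L =
    \<lparr> Obj = {m. pseudo_map K L m}, Arr = {t. cc_transformation K L t},
      Dom = restrict ct_src {t. cc_transformation K L t},
      Cod = restrict ct_tgt {t. cc_transformation K L t},
      Ide = (\<lambda>m \<in> {m. pseudo_map K L m}.
        \<lparr> ct_src = m, ct_tgt = m,
          ct_base = (\<lambda>X \<in> Obj (Base K). Ide (Base L) (on_obj (pm_base m) X)),
          ct_total = (\<lambda>A \<in> Obj (Total K). Ide (Total L) (on_obj (pm_total m) A)) \<rparr>),
      Comp = (\<lambda>s t. if cc_transformation K L s \<and> cc_transformation K L t \<and> ct_src s = ct_tgt t
        then \<lparr> ct_src = ct_src t, ct_tgt = ct_tgt s,
               ct_base = vcomp_nt (Base K) (Base L) (ct_base s) (ct_base t),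
               ct_total = vcomp_nt (Total K) (Total L) (ct_total s) (ct_total t) \<rparr>
        else undefined) \<rparr>"

definition CompCat ::
    "(('o, 'a, 'to, 'ta) compcat, ('o, 'a, 'to, 'ta) pmap, ('o, 'a, 'to, 'ta) cctrans) twocat" where
  "CompCat =
    \<lparr> Ob = {K. comprehension_category K},
      HomCat = compcat_hom,
      Id1 = pm_id,
      HComp = (\<lambda>K L M.
        \<lparr> on_obj = (\<lambda>nm \<in> Obj (prod_cat (compcat_hom L M) (compcat_hom K L)).
            pm_comp K L M (fst nm) (snd nm)),
          on_arr = (\<lambda>st \<in> Arr (prod_cat (compcat_hom L M) (compcat_hom K L)).
            let s = fst st; t = snd st in
            \<lparr> ct_src = pm_comp K L M (ct_src s) (ct_src t),
              ct_tgt = pm_comp K L M (ct_tgt s) (ct_tgt t),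
              ct_base = hcomp_nt (Base K) (Base M) (pm_base (ct_src s)) (pm_base (ct_tgt t))
                          (ct_base s) (ct_base t),
              ct_total = hcomp_nt (Total K) (Total M) (pm_total (ct_src s)) (pm_total (ct_tgt t))
                           (ct_total s) (ct_total t) \<rparr>) \<rparr>) \<rparr>"

definition CompCat_str2 ::
    "(('o, 'a, 'to, 'ta) compcat, ('o, 'a, 'to, 'ta) pmap, ('o, 'a, 'to, 'ta) cctrans) twocat" where
  "CompCat_str2 = locally_full_sub_twocat CompCat strict_map"

text \<open>
  In a subcategorical comprehension category, \<open>\<T>\<close> is identified with its image under \<open>\<chi>\<close>: the total
  category is literally a subcategory of the arrow category, and \<open>\<chi>\<close> is the inclusion. (Faithfulness
  and injectivity on objects then hold automatically.) Without this identification different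
  objects of \<open>CompCat\<close> would correspond to the same display map category.
\<close>

definition subcategorical :: "('o, 'a, 'a, 'a square) compcat \<Rightarrow> bool" where
  "subcategorical K \<longleftrightarrow> comprehension_category K
    \<and> full_functor (Total K) (arrow_cat (Base K)) (Compr K)
    \<and> faithful_functor (Total K) (Compr K)
    \<and> inj_on (on_obj (Compr K)) (Obj (Total K))
    \<and> subcategory (Total K) (arrow_cat (Base K)) \<and> Compr K = incl_fnctr (Total K)"

definition replete_compcat :: "('o, 'a, 'a, 'a square) compcat \<Rightarrow> bool" where
  "replete_compcat K \<longleftrightarrow> subcategorical K \<and> replete_subcategory (Total K) (arrow_cat (Base K))"

type_synonym ('o, 'a) repl_compcat = "('o, 'a, 'a, 'a square) compcat"
type_synonym ('o, 'a) repl_pmap = "('o, 'a, 'a, 'a square) pmap"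
type_synonym ('o, 'a) repl_cctrans = "('o, 'a, 'a, 'a square) cctrans"

type_synonym ('o, 'a) repl_twocat =
  "(('o, 'a) repl_compcat, ('o, 'a) repl_pmap, ('o, 'a) repl_cctrans) twocat"

definition CompCat_repl :: "('o, 'a) repl_twocat" where
  "CompCat_repl = full_sub_twocat CompCat replete_compcat"

definition CompCat_str2_repl :: "('o, 'a) repl_twocat" where
  "CompCat_str2_repl = full_sub_twocat CompCat_str2 replete_compcat"


section \<open>Display map categories\<close>

type_synonym ('o, 'a) dmcat = "('o, 'a) cat \<times> 'a set"

locale display_map_category = category C
  for C :: "('o, 'a) cat" +
  fixes D :: "'a set"
  assumes display_arr: "D \<subseteq> Arr C"
    and display_replete: "\<lbrakk>d \<in> D; isomorphic (arrow_cat C) d e\<rbrakk> \<Longrightarrow> e \<in> D"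
    and display_pullback: "\<lbrakk>d \<in> D; f \<in> Arr C; Cod C f = Cod C d\<rbrakk>
      \<Longrightarrow> \<exists>s. pullback_square C s \<and> sq_tgt s = d \<and> sq_cod s = f \<and> sq_src s \<in> D"

locale dmc_map =
  source: display_map_category "fst X" "snd X" + target: display_map_category "fst Y" "snd Y" +
  cat_functor "fst X" "fst Y" F
  for X Y :: "('o, 'a) dmcat" and F +
  assumes display_preserved: "d \<in> snd X \<Longrightarrow> on_arr F d \<in> snd Y"
    and pullback_preserved: "\<lbrakk>pullback_square (fst X) s; sq_tgt s \<in> snd X\<rbrakk>
      \<Longrightarrow> pullback_square (fst Y) (on_arr (arrow_functor (fst X) F) s)"

record ('o, 'a) dmctrans =
  dt_src :: "('o, 'a, 'o, 'a) fnctr"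
  dt_tgt :: "('o, 'a, 'o, 'a) fnctr"
  dt_comp :: "'o \<Rightarrow> 'a"

definition dmc_transformation :: "('o, 'a) dmcat \<Rightarrow> ('o, 'a) dmcat \<Rightarrow> ('o, 'a) dmctrans \<Rightarrow> bool" where
  "dmc_transformation X Y t \<longleftrightarrow> dmc_map X Y (dt_src t) \<and> dmc_map X Y (dt_tgt t)
    \<and> nat_trans (fst X) (fst Y) (dt_src t) (dt_tgt t) (dt_comp t)"

definition dmc_hom :: "('o, 'a) dmcat \<Rightarrow> ('o, 'a) dmcat
    \<Rightarrow> (('o, 'a, 'o, 'a) fnctr, ('o, 'a) dmctrans) cat" where
  "dmc_hom X Y =
    \<lparr> Obj = {F. dmc_map X Y F}, Arr = {t. dmc_transformation X Y t},
      Dom = restrict dt_src {t. dmc_transformation X Y t},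
      Cod = restrict dt_tgt {t. dmc_transformation X Y t},
      Ide = (\<lambda>F \<in> {F. dmc_map X Y F}.
        \<lparr> dt_src = F, dt_tgt = F,
          dt_comp = (\<lambda>\<Gamma> \<in> Obj (fst X). Ide (fst Y) (on_obj F \<Gamma>)) \<rparr>),
      Comp = (\<lambda>s t. if dmc_transformation X Y s \<and> dmc_transformation X Y t \<and> dt_src s = dt_tgt t
        then \<lparr> dt_src = dt_src t, dt_tgt = dt_tgt s,
               dt_comp = vcomp_nt (fst X) (fst Y) (dt_comp s) (dt_comp t) \<rparr>
        else undefined) \<rparr>"

type_synonym ('o, 'a) dmc_twocat =
  "(('o, 'a) dmcat, ('o, 'a, 'o, 'a) fnctr, ('o, 'a) dmctrans) twocat"

definition DMC :: "('o, 'a) dmc_twocat" where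
  "DMC =
    \<lparr> Ob = {X. display_map_category (fst X) (snd X)},
      HomCat = dmc_hom,
      Id1 = (\<lambda>X. id_fnctr (fst X)),
      HComp = (\<lambda>X Y Z.
        \<lparr> on_obj = (\<lambda>GF \<in> Obj (prod_cat (dmc_hom Y Z) (dmc_hom X Y)).
            comp_fnctr (fst X) (fst GF) (snd GF)),
          on_arr = (\<lambda>st \<in> Arr (prod_cat (dmc_hom Y Z) (dmc_hom X Y)).
            let s = fst st; t = snd st in
            \<lparr> dt_src = comp_fnctr (fst X) (dt_src s) (dt_src t),
              dt_tgt = comp_fnctr (fst X) (dt_tgt s) (dt_tgt t),
              dt_comp = hcomp_nt (fst X) (fst Z) (dt_src s) (dt_tgt t)
                          (dt_comp s) (dt_comp t) \<rparr>) \<rparr>) \<rparr>"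

text \<open>The comprehension category \<open>(\<C>, \<D>, cod \<circ> \<iota>, \<iota>)\<close> of a display map category.\<close>

definition dmc_compcat :: "('o, 'a) dmcat \<Rightarrow> ('o, 'a) repl_compcat" where
  "dmc_compcat X =
    (let T = full_subcat (arrow_cat (fst X)) (snd X) in
     \<lparr> Base = fst X, Total = T,
       Proj = comp_fnctr T (cod_functor (fst X)) (incl_fnctr T),
       Compr = incl_fnctr T \<rparr>)"

end

theory Submission
  imports Defs
begin

text \<open>
  A replete comprehension category is determined by its base \<open>C\<close> and the class \<open>D\<close> of objects of its
  total category, its cartesian arrows are exactly the pullback squares with target in \<open>D\<close>, and
  strict maps and their transformations are determined by their base components. So
  \<open>K \<mapsto> (C, D)\<close> is a 2-functor that is bijective on objects, 1-cells and 2-cells; its inverse is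
  the required isomorphism. For the equivalence, the comparison isomorphism \<open>\<phi>\<close> of a pseudo map is
  itself an invertible 2-cell, with identity base component, to the strict map on the same base
  functor.
\<close>

section \<open>Categories, functors and natural transformations\<close>

text \<open>Two obstacles shape the proof. One is the comparison of cartesian arrows with pullback
  squares: cartesianness tests a square only against squares between display maps, whereas a
  pullback must answer arbitrary cones. A cartesian arrow is therefore compared with a pullback that
  has display source, which the stability axiom provides, and inherits the universal property from
  it along an isomorphism. The other is strictness: all laws of 2-functors are equations of records.
  They are proved for the 2-functor that forgets the total parts, where they are read off from base
  components; its inverse then satisfies them because every equation between 1-cells or 2-cells can
  be checked after applying an injective map. Since the definition of equivalence asks for a
  quasi-inverse on each hom-category, one is constructed by choice from full faithfulness and
  essential surjectivity.\<close>

lemma homset_iff: "f \<in> homset C X Y \<longleftrightarrow> f \<in> Arr C \<and> Dom C f = X \<and> Cod C f = Y"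
  by (simp add: homset_def)

context category
begin

lemmas [simp] = dom_obj cod_obj

lemma ide_arr [simp]:
  assumes "X \<in> Obj C"
  shows "Ide C X \<in> Arr C" "Dom C (Ide C X) = X" "Cod C (Ide C X) = X"
  using ide_hom[OF assms] by (auto simp: homset_iff)

lemma comp_arr [simp]:
  assumes "f \<in> Arr C" "g \<in> Arr C" "Dom C g = Cod C f"
  shows "g \<cdot>\<^bsub>C\<^esub> f \<in> Arr C" "Dom C (g \<cdot>\<^bsub>C\<^esub> f) = Dom C f" "Cod C (g \<cdot>\<^bsub>C\<^esub> f) = Cod C g"
  using comp_hom[of f "Dom C f" "Cod C f" g "Cod C g"] assms by (auto simp: homset_iff)

lemma ide_comp [simp]: "\<lbrakk>f \<in> Arr C; Cod C f = Y\<rbrakk> \<Longrightarrow> Ide C Y \<cdot>\<^bsub>C\<^esub> f = f"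
  using ide_left[of f] by (auto simp: homset_iff)

lemma comp_ide [simp]: "\<lbrakk>f \<in> Arr C; Dom C f = X\<rbrakk> \<Longrightarrow> f \<cdot>\<^bsub>C\<^esub> Ide C X = f"
  using ide_right[of f] by (auto simp: homset_iff)

lemma assoc:
  "\<lbrakk>f \<in> Arr C; g \<in> Arr C; h \<in> Arr C; Dom C g = Cod C f; Dom C h = Cod C g\<rbrakk>
   \<Longrightarrow> (h \<cdot>\<^bsub>C\<^esub> g) \<cdot>\<^bsub>C\<^esub> f = h \<cdot>\<^bsub>C\<^esub> (g \<cdot>\<^bsub>C\<^esub> f)"
  using comp_assoc[of f _ _ g _ h] by (auto simp: homset_iff)

end

text \<open>The axioms of \<open>category\<close> speak of homsets with free endpoints, which
  simplification cannot guess. Here every endpoint is the \<open>Dom\<close> or \<open>Cod\<close>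
  of a given arrow, so the conditions become goals for the simplifier; \<open>cat_functorI\<close>
  and \<open>nat_transI\<close> follow the same pattern.\<close>

lemma categoryI:
  assumes "\<And>f. f \<in> Arr C \<Longrightarrow> Dom C f \<in> Obj C"
    and "\<And>f. f \<in> Arr C \<Longrightarrow> Cod C f \<in> Obj C"
    and "\<And>X. X \<in> Obj C \<Longrightarrow> Ide C X \<in> Arr C \<and> Dom C (Ide C X) = X \<and> Cod C (Ide C X) = X"
    and "\<And>f g. \<lbrakk>f \<in> Arr C; g \<in> Arr C; Dom C g = Cod C f\<rbrakk>
      \<Longrightarrow> g \<cdot>\<^bsub>C\<^esub> f \<in> Arr C \<and> Dom C (g \<cdot>\<^bsub>C\<^esub> f) = Dom C f \<and> Cod C (g \<cdot>\<^bsub>C\<^esub> f) = Cod C g"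
    and "\<And>f. f \<in> Arr C \<Longrightarrow> Ide C (Cod C f) \<cdot>\<^bsub>C\<^esub> f = f"
    and "\<And>f. f \<in> Arr C \<Longrightarrow> f \<cdot>\<^bsub>C\<^esub> Ide C (Dom C f) = f"
    and "\<And>f g h. \<lbrakk>f \<in> Arr C; g \<in> Arr C; h \<in> Arr C; Dom C g = Cod C f; Dom C h = Cod C g\<rbrakk>
      \<Longrightarrow> (h \<cdot>\<^bsub>C\<^esub> g) \<cdot>\<^bsub>C\<^esub> f = h \<cdot>\<^bsub>C\<^esub> (g \<cdot>\<^bsub>C\<^esub> f)"
    and "Dom C \<in> extensional (Arr C)" "Cod C \<in> extensional (Arr C)" "Ide C \<in> extensional (Obj C)"
    and "\<And>f g. \<not> (g \<in> Arr C \<and> f \<in> Arr C \<and> Dom C g = Cod C f) \<Longrightarrow> g \<cdot>\<^bsub>C\<^esub> f = undefined"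
  shows "category C"
  by unfold_locales (use assms in \<open>auto simp: homset_iff\<close>)

context cat_functor
begin

lemmas [simp] = on_obj_in on_arr_ide

lemma on_arr_arr [simp]:
  assumes "f \<in> Arr C"
  shows "on_arr F f \<in> Arr D" "Dom D (on_arr F f) = on_obj F (Dom C f)"
    "Cod D (on_arr F f) = on_obj F (Cod C f)"
  using on_arr_in[of f "Dom C f" "Cod C f"] assms by (auto simp: homset_iff)

lemma on_arr_comp_arr [simp]:
  "\<lbrakk>f \<in> Arr C; g \<in> Arr C; Dom C g = Cod C f\<rbrakk>
   \<Longrightarrow> on_arr F (g \<cdot>\<^bsub>C\<^esub> f) = on_arr F g \<cdot>\<^bsub>D\<^esub> on_arr F f"
  using on_arr_comp[of f _ _ g] by (auto simp: homset_iff)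

end

lemma cat_functorI:
  assumes "category C" "category D"
    and "\<And>X. X \<in> Obj C \<Longrightarrow> on_obj F X \<in> Obj D"
    and "\<And>f. f \<in> Arr C \<Longrightarrow> on_arr F f \<in> Arr D \<and> Dom D (on_arr F f) = on_obj F (Dom C f)
      \<and> Cod D (on_arr F f) = on_obj F (Cod C f)"
    and "\<And>X. X \<in> Obj C \<Longrightarrow> on_arr F (Ide C X) = Ide D (on_obj F X)"
    and "\<And>f g. \<lbrakk>f \<in> Arr C; g \<in> Arr C; Dom C g = Cod C f\<rbrakk>
      \<Longrightarrow> on_arr F (g \<cdot>\<^bsub>C\<^esub> f) = on_arr F g \<cdot>\<^bsub>D\<^esub> on_arr F f"
    and "on_obj F \<in> extensional (Obj C)" "on_arr F \<in> extensional (Arr C)"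
  shows "cat_functor C D F"
proof -
  interpret C: category C by fact
  interpret D: category D by fact
  show ?thesis by unfold_locales (use assms in \<open>auto simp: homset_iff\<close>)
qed

text \<open>Functor records are extensional outside the carriers, so agreement on objects and arrows
  of \<open>C\<close> is equality. The targets \<open>D\<close> and \<open>D'\<close> may differ,
  because a record does not store them.\<close>

lemma fnctr_eqI:
  assumes "cat_functor C D F" "cat_functor C D' G"
    and "\<And>X. X \<in> Obj C \<Longrightarrow> on_obj F X = on_obj G X"
    and "\<And>f. f \<in> Arr C \<Longrightarrow> on_arr F f = on_arr G f"
  shows "F = G"
proof (rule fnctr.equality)
  show "on_obj F = on_obj G"
    using assms by (auto intro: extensionalityI[of _ "Obj C"] simp: cat_functor.on_obj_ext)
  show "on_arr F = on_arr G"
    using assms by (auto intro: extensionalityI[of _ "Arr C"] simp: cat_functor.on_arr_ext)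
qed simp

context nat_trans
begin

lemma component_arr [simp]:
  assumes "X \<in> Obj C"
  shows "t X \<in> Arr D" "Dom D (t X) = on_obj F X" "Cod D (t X) = on_obj G X"
  using component[OF assms] by (auto simp: homset_iff)

lemma natural: "f \<in> Arr C \<Longrightarrow> t (Cod C f) \<cdot>\<^bsub>D\<^esub> on_arr F f = on_arr G f \<cdot>\<^bsub>D\<^esub> t (Dom C f)"
  using naturality[of f] by (auto simp: homset_iff)

end

lemma nat_transI:
  assumes "cat_functor C D F" "cat_functor C D G"
    and "\<And>X. X \<in> Obj C \<Longrightarrow> t X \<in> Arr D \<and> Dom D (t X) = on_obj F X \<and> Cod D (t X) = on_obj G X"
    and "\<And>f. f \<in> Arr C \<Longrightarrow> t (Cod C f) \<cdot>\<^bsub>D\<^esub> on_arr F f = on_arr G f \<cdot>\<^bsub>D\<^esub> t (Dom C f)"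
    and "t \<in> extensional (Obj C)"
  shows "nat_trans C D F G t"
proof -
  interpret F: cat_functor C D F by fact
  interpret G: cat_functor C D G by fact
  show ?thesis by unfold_locales (use assms in \<open>auto simp: homset_iff\<close>)
qed

lemma id_fnctr_simps [simp]:
  "X \<in> Obj C \<Longrightarrow> on_obj (id_fnctr C) X = X"
  "f \<in> Arr C \<Longrightarrow> on_arr (id_fnctr C) f = f"
  by (auto simp: id_fnctr_def)

lemma comp_fnctr_simps [simp]:
  "X \<in> Obj C \<Longrightarrow> on_obj (comp_fnctr C G F) X = on_obj G (on_obj F X)"
  "f \<in> Arr C \<Longrightarrow> on_arr (comp_fnctr C G F) f = on_arr G (on_arr F f)"
  by (auto simp: comp_fnctr_def compose_def)

lemma comp_fnctr_ext [simp]: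
  "on_obj (comp_fnctr C G F) \<in> extensional (Obj C)"
  "on_arr (comp_fnctr C G F) \<in> extensional (Arr C)"
  by (auto simp: comp_fnctr_def compose_extensional)

lemma cat_functor_comp [intro]:
  assumes "cat_functor C D F" "cat_functor D E G"
  shows "cat_functor C E (comp_fnctr C G F)"
proof -
  interpret F: cat_functor C D F by fact
  interpret G: cat_functor D E G by fact
  show ?thesis by (rule cat_functorI) (auto simp: F.source.category_axioms G.target.category_axioms)
qed

lemma subcategory_incl_functor:
  assumes "subcategory S C"
  shows "cat_functor S C (incl_fnctr S)"
proof -
  interpret S: category S using assms by (simp add: subcategory_def)
  have "Ide C X = Ide S X" if "X \<in> Obj S" for X
    using assms that by (auto simp: subcategory_def)
  moreover have "Dom C f = Dom S f" "Cod C f = Cod S f" if "f \<in> Arr S" for f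
    using assms that by (auto simp: subcategory_def)
  moreover have "g \<cdot>\<^bsub>C\<^esub> f = g \<cdot>\<^bsub>S\<^esub> f" if "f \<in> Arr S" "g \<in> Arr S" "Dom S g = Cod S f" for f g
    using assms that by (auto simp: subcategory_def)
  moreover have "category C" "Obj S \<subseteq> Obj C" "Arr S \<subseteq> Arr C"
    using assms by (auto simp: subcategory_def)
  ultimately show ?thesis
    by (intro cat_functorI) (auto simp: S.category_axioms, auto simp: id_fnctr_def)
qed

lemma id_functor [intro]:
  assumes "category C"
  shows "cat_functor C C (id_fnctr C)"
  by (rule subcategory_incl_functor) (use assms in \<open>auto simp: subcategory_def\<close>)

lemma comp_fnctr_assoc:
  assumes "cat_functor C D F" 
  shows "comp_fnctr C (comp_fnctr D H G) F = comp_fnctr C H (comp_fnctr C G F)"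
proof -
  interpret F: cat_functor C D F by fact
  show ?thesis
    by (rule fnctr.equality) (auto intro!: extensionalityI[of _ "Obj C"] extensionalityI[of _ "Arr C"])
qed

lemma comp_fnctr_id:
  assumes "cat_functor C D F" 
  shows "comp_fnctr C (id_fnctr D) F = F" "comp_fnctr C F (id_fnctr C) = F"
proof -
  interpret F: cat_functor C D F by fact
  show "comp_fnctr C (id_fnctr D) F = F" "comp_fnctr C F (id_fnctr C) = F"
    by (rule fnctr.equality;
        auto intro!: extensionalityI[of _ "Obj C"] extensionalityI[of _ "Arr C"]
          simp: F.on_obj_ext F.on_arr_ext)+
qed


subsection \<open>Composition of natural transformations\<close>

abbreviation id_nt :: "('o, 'a) cat \<Rightarrow> ('p, 'b) cat \<Rightarrow> ('o, 'a, 'p, 'b) fnctr \<Rightarrow> 'o \<Rightarrow> 'b" where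
  "id_nt C D F \<equiv> (\<lambda>X \<in> Obj C. Ide D (on_obj F X))"

lemma nat_trans_id:
  assumes "cat_functor C D F"
  shows "nat_trans C D F F (id_nt C D F)"
proof -
  interpret F: cat_functor C D F by fact
  show ?thesis by (rule nat_transI) (auto simp: assms)
qed

text \<open>Two naturality squares at \<open>f\<close> are pasted: associativity exposes the square
  of \<open>t\<close>, then that of \<open>s\<close>.\<close>

lemma nat_trans_vcomp:
  assumes "nat_trans C D F G t" "nat_trans C D G H s"
  shows "nat_trans C D F H (vcomp_nt C D s t)"
proof -
  interpret t: nat_trans C D F G t by fact
  interpret s: nat_trans C D G H s by fact
  show ?thesis
  proof (rule nat_transI)
    fix f assume f: "f \<in> Arr C"
    have "(s (Cod C f) \<cdot>\<^bsub>D\<^esub> t (Cod C f)) \<cdot>\<^bsub>D\<^esub> on_arr F f = s (Cod C f) \<cdot>\<^bsub>D\<^esub> (on_arr G f \<cdot>\<^bsub>D\<^esub> t (Dom C f))"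
      using f by (simp add: t.source.target.assoc t.natural)
    also have "\<dots> = (on_arr H f \<cdot>\<^bsub>D\<^esub> s (Dom C f)) \<cdot>\<^bsub>D\<^esub> t (Dom C f)"
      using f by (simp flip: t.source.target.assoc add: s.natural)
    also have "\<dots> = on_arr H f \<cdot>\<^bsub>D\<^esub> (s (Dom C f) \<cdot>\<^bsub>D\<^esub> t (Dom C f))"
      using f by (simp add: t.source.target.assoc)
    finally show "vcomp_nt C D s t (Cod C f) \<cdot>\<^bsub>D\<^esub> on_arr F f = on_arr H f \<cdot>\<^bsub>D\<^esub> vcomp_nt C D s t (Dom C f)"
      using f by (simp add: vcomp_nt_def)
  qed (auto simp: vcomp_nt_def t.source.cat_functor_axioms s.target.cat_functor_axioms)
qed

lemma vcomp_id:
  assumes "nat_trans C D F G t"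
  shows "vcomp_nt C D (id_nt C D G) t = t" "vcomp_nt C D t (id_nt C D F) = t"
proof -
  interpret t: nat_trans C D F G t by fact
  show "vcomp_nt C D (id_nt C D G) t = t" "vcomp_nt C D t (id_nt C D F) = t"
    by (rule extensionalityI[of _ "Obj C"]; auto simp: vcomp_nt_def t.component_ext)+
qed

lemma vcomp_assoc:
  assumes "nat_trans C D E F r" "nat_trans C D F G s" "nat_trans C D G H t"
  shows "vcomp_nt C D (vcomp_nt C D t s) r = vcomp_nt C D t (vcomp_nt C D s r)"
proof -
  interpret r: nat_trans C D E F r by fact
  interpret s: nat_trans C D F G s by fact
  interpret t: nat_trans C D G H t by fact
  show ?thesis by (auto simp: vcomp_nt_def r.source.target.assoc)
qed

text \<open>Naturality of \<open>t\<close> at \<open>f\<close>, carried through the functor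
  \<open>G\<close>, is followed by naturality of \<open>s\<close> at the arrow
  \<open>F' f\<close>.\<close>

lemma nat_trans_hcomp:
  assumes "nat_trans C D F F' t" "nat_trans D E G G' s"
  shows "nat_trans C E (comp_fnctr C G F) (comp_fnctr C G' F') (hcomp_nt C E G F' s t)"
proof -
  interpret t: nat_trans C D F F' t by fact
  interpret s: nat_trans D E G G' s by fact
  show ?thesis
  proof (rule nat_transI)
    fix f assume f: "f \<in> Arr C"
    let ?X = "Dom C f" and ?Y = "Cod C f"
    have "(s (on_obj F' ?Y) \<cdot>\<^bsub>E\<^esub> on_arr G (t ?Y)) \<cdot>\<^bsub>E\<^esub> on_arr G (on_arr F f)
        = s (on_obj F' ?Y) \<cdot>\<^bsub>E\<^esub> on_arr G (t ?Y \<cdot>\<^bsub>D\<^esub> on_arr F f)"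
      using f by (simp add: s.source.target.assoc)
    \<comment> \<open>The image of \<open>?Y\<close> under \<open>F'\<close> is written as the
      codomain of \<open>F' f\<close>, the form in which naturality of \<open>s\<close> can be
      applied.\<close>
    also have "\<dots> = (s (Cod D (on_arr F' f)) \<cdot>\<^bsub>E\<^esub> on_arr G (on_arr F' f)) \<cdot>\<^bsub>E\<^esub> on_arr G (t ?X)"
      using f by (simp add: s.source.target.assoc t.natural)
    also have "\<dots> = on_arr G' (on_arr F' f) \<cdot>\<^bsub>E\<^esub> (s (on_obj F' ?X) \<cdot>\<^bsub>E\<^esub> on_arr G (t ?X))"
      using f by (subst s.natural) (simp_all add: s.source.target.assoc)
    finally show "hcomp_nt C E G F' s t ?Y \<cdot>\<^bsub>E\<^esub> on_arr (comp_fnctr C G F) f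
        = on_arr (comp_fnctr C G' F') f \<cdot>\<^bsub>E\<^esub> hcomp_nt C E G F' s t ?X"
      using f by (simp add: hcomp_nt_def)
  qed (auto simp: hcomp_nt_def
      cat_functor_comp[OF t.source.cat_functor_axioms s.source.cat_functor_axioms]
      cat_functor_comp[OF t.target.cat_functor_axioms s.target.cat_functor_axioms])
qed

lemma hcomp_id_nt:
  assumes "cat_functor C D F" "cat_functor D E G"
  shows "hcomp_nt C E G F (id_nt D E G) (id_nt C D F) = id_nt C E (comp_fnctr C G F)"
proof -
  interpret F: cat_functor C D F by fact
  interpret G: cat_functor D E G by fact
  show ?thesis by (auto simp: hcomp_nt_def)
qed

lemma hcomp_unit:
  assumes "nat_trans C D F G t"
  shows "hcomp_nt C D (id_fnctr D) G (id_nt D D (id_fnctr D)) t = t"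
    and "hcomp_nt C D F (id_fnctr C) t (id_nt C C (id_fnctr C)) = t"
proof -
  interpret t: nat_trans C D F G t by fact
  show "hcomp_nt C D (id_fnctr D) G (id_nt D D (id_fnctr D)) t = t"
    "hcomp_nt C D F (id_fnctr C) t (id_nt C C (id_fnctr C)) = t"
    by (rule extensionalityI[of _ "Obj C"]; auto simp: hcomp_nt_def t.component_ext)+
qed

lemma hcomp_assoc:
  assumes "nat_trans B C F F' r" "nat_trans C D G G' s" "nat_trans D E H H' t"
  shows "hcomp_nt B E (comp_fnctr C H G) F' (hcomp_nt C E H G' t s) r
    = hcomp_nt B E H (comp_fnctr B G' F') t (hcomp_nt B D G F' s r)"
proof -
  interpret r: nat_trans B C F F' r by fact
  interpret s: nat_trans C D G G' s by fact
  interpret t: nat_trans D E H H' t by fact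
  show ?thesis by (auto simp: hcomp_nt_def t.source.target.assoc)
qed

text \<open>Both sides agree after one use of naturality of \<open>s\<close>, taken at the component
  \<open>t' X\<close>, which moves \<open>s\<close> past \<open>t'\<close>.\<close>

lemma interchange:
  assumes "nat_trans C D F F' t" "nat_trans C D F' F'' t'"
    and "nat_trans D E G G' s" "nat_trans D E G' G'' s'"
  shows "hcomp_nt C E G F'' (vcomp_nt D E s' s) (vcomp_nt C D t' t)
    = vcomp_nt C E (hcomp_nt C E G' F'' s' t') (hcomp_nt C E G F' s t)"
proof
  fix X
  interpret t: nat_trans C D F F' t by fact
  interpret t': nat_trans C D F' F'' t' by fact
  interpret s: nat_trans D E G G' s by fact
  interpret s': nat_trans D E G' G'' s' by fact
  have "(s' (on_obj F'' X) \<cdot>\<^bsub>E\<^esub> s (on_obj F'' X)) \<cdot>\<^bsub>E\<^esub> (on_arr G (t' X) \<cdot>\<^bsub>E\<^esub> on_arr G (t X))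
    = (s' (on_obj F'' X) \<cdot>\<^bsub>E\<^esub> on_arr G' (t' X)) \<cdot>\<^bsub>E\<^esub> (s (on_obj F' X) \<cdot>\<^bsub>E\<^esub> on_arr G (t X))"
    (is "?l = ?r") if X: "X \<in> Obj C"
  proof -
    have "?l = s' (on_obj F'' X) \<cdot>\<^bsub>E\<^esub> ((s (Cod D (t' X)) \<cdot>\<^bsub>E\<^esub> on_arr G (t' X)) \<cdot>\<^bsub>E\<^esub> on_arr G (t X))"
      using X by (simp add: s.source.target.assoc)
    also have "\<dots> = ?r"
      using X by (subst s.natural) (simp_all add: s.source.target.assoc)
    finally show ?thesis .
  qed
  then show "hcomp_nt C E G F'' (vcomp_nt D E s' s) (vcomp_nt C D t' t) X
    = vcomp_nt C E (hcomp_nt C E G' F'' s' t') (hcomp_nt C E G F' s t) X"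
    by (simp add: hcomp_nt_def vcomp_nt_def)
qed


subsection \<open>Isomorphisms and equivalences\<close>

lemma inverse_arrs_iff:
  "inverse_arrs C f g \<longleftrightarrow> f \<in> Arr C \<and> g \<in> Arr C \<and> Dom C g = Cod C f \<and> Cod C g = Dom C f
     \<and> g \<cdot>\<^bsub>C\<^esub> f = Ide C (Dom C f) \<and> f \<cdot>\<^bsub>C\<^esub> g = Ide C (Cod C f)"
  by (auto simp: inverse_arrs_def homset_iff)

lemma inverse_arrs_sym: "inverse_arrs C f g \<Longrightarrow> inverse_arrs C g f"
  by (auto simp: inverse_arrs_iff)

lemma (in category) inverse_arrs_ide: "X \<in> Obj C \<Longrightarrow> inverse_arrs C (Ide C X) (Ide C X)"
  by (auto simp: inverse_arrs_iff)

lemma (in category) iso_arr_ide: "X \<in> Obj C \<Longrightarrow> iso_arr C (Ide C X)"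
  using inverse_arrs_ide by (auto simp: iso_arr_def)

lemma (in category) isomorphic_refl: "X \<in> Obj C \<Longrightarrow> isomorphic C X X"
  unfolding isomorphic_def using iso_arr_ide ide_hom by blast

lemma (in category) inverse_arrs_comp:
  assumes f: "inverse_arrs C f f'" and g: "inverse_arrs C g g'" and fg: "Dom C g = Cod C f"
  shows "inverse_arrs C (g \<cdot>\<^bsub>C\<^esub> f) (f' \<cdot>\<^bsub>C\<^esub> g')"
proof -
  \<comment> \<open>With composites bracketed to the right, an adjacent inverse pair disappears in
    front of a further arrow; this removes the inner pair from either product.\<close>
  have cancel: "k' \<cdot>\<^bsub>C\<^esub> (k \<cdot>\<^bsub>C\<^esub> h) = h"
    if "inverse_arrs C k k'" "h \<in> Arr C" "Cod C h = Dom C k" for h k k'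
    using that unfolding inverse_arrs_iff by (simp flip: assoc)
  show ?thesis
    using assms cancel[OF g, of f] cancel[OF inverse_arrs_sym[OF f], of g']
    unfolding inverse_arrs_iff by (simp add: assoc)
qed

lemma (in cat_functor) inverse_arrs_on_arr:
  assumes "inverse_arrs C f g"
  shows "inverse_arrs D (on_arr F f) (on_arr F g)"
  using assms unfolding inverse_arrs_iff by (simp flip: on_arr_comp_arr)

lemma (in category) cancel_left_inverse:
  assumes "inverse_arrs C f g" "h \<in> Arr C" "k \<in> Arr C" "Cod C h = Dom C f" "Cod C k = Dom C f"
    and "f \<cdot>\<^bsub>C\<^esub> h = f \<cdot>\<^bsub>C\<^esub> k"
  shows "h = k"
proof -
  have "g \<cdot>\<^bsub>C\<^esub> (f \<cdot>\<^bsub>C\<^esub> h) = g \<cdot>\<^bsub>C\<^esub> (f \<cdot>\<^bsub>C\<^esub> k)" using assms by simp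
  then show ?thesis using assms(1-5) unfolding inverse_arrs_iff by (simp flip: assoc)
qed

text \<open>The identity \<open>t X \<cdot> u X\<close> is inserted to the right of
  \<open>G f\<close>; naturality of \<open>t\<close> then moves \<open>t\<close> to the other side,
  where it cancels against \<open>u\<close>.\<close>

lemma nat_trans_inverse:
  assumes "nat_trans C D F G t" "\<And>X. X \<in> Obj C \<Longrightarrow> inverse_arrs D (t X) (u X)"
    and "u \<in> extensional (Obj C)"
  shows "nat_trans C D G F u"
proof -
  interpret t: nat_trans C D F G t by fact
  have u: "u X \<in> Arr D" "Dom D (u X) = on_obj G X" "Cod D (u X) = on_obj F X"
      "u X \<cdot>\<^bsub>D\<^esub> t X = Ide D (on_obj F X)" "t X \<cdot>\<^bsub>D\<^esub> u X = Ide D (on_obj G X)"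
    if "X \<in> Obj C" for X
    using assms(2)[OF that] that by (auto simp: inverse_arrs_iff)
  show ?thesis
  proof (rule nat_transI)
    fix f assume f: "f \<in> Arr C"
    have "u (Cod C f) \<cdot>\<^bsub>D\<^esub> on_arr G f = u (Cod C f) \<cdot>\<^bsub>D\<^esub> ((on_arr G f \<cdot>\<^bsub>D\<^esub> t (Dom C f)) \<cdot>\<^bsub>D\<^esub> u (Dom C f))"
      using f by (simp add: u t.source.target.assoc)
    also have "\<dots> = (u (Cod C f) \<cdot>\<^bsub>D\<^esub> t (Cod C f)) \<cdot>\<^bsub>D\<^esub> (on_arr F f \<cdot>\<^bsub>D\<^esub> u (Dom C f))"
      using f by (subst t.natural[symmetric]) (simp_all add: u(1-3) t.source.target.assoc)
    also have "\<dots> = on_arr F f \<cdot>\<^bsub>D\<^esub> u (Dom C f)"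
      using f by (simp add: u)
    finally show "u (Cod C f) \<cdot>\<^bsub>D\<^esub> on_arr G f = on_arr F f \<cdot>\<^bsub>D\<^esub> u (Dom C f)" .
  qed (use u assms(3) in \<open>auto simp: t.source.cat_functor_axioms t.target.cat_functor_axioms\<close>)
qed

text \<open>The quasi-inverse is chosen: for each \<open>Y\<close> an object \<open>g Y\<close> with
  an isomorphism \<open>e Y\<close> from \<open>F (g Y)\<close> to \<open>Y\<close>, and arrows
  obtained by lifting conjugates through the full and faithful \<open>F\<close>. Equations between
  arrows of \<open>C\<close> are checked after applying \<open>F\<close>.\<close>

lemma equivalence_functorI:
  assumes "cat_functor C D F" and full: "full_functor C D F" and faithful: "faithful_functor C F"
    and surj: "\<And>Y. Y \<in> Obj D \<Longrightarrow> \<exists>X \<in> Obj C. isomorphic D (on_obj F X) Y"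
  shows "equivalence_functor C D F"
proof -
  interpret F: cat_functor C D F by fact
  \<comment> \<open>The implication sits inside the existential, so that choice yields functions
    defined for all \<open>Y\<close>.\<close>
  have "\<exists>X e e'. Y \<in> Obj D \<longrightarrow> X \<in> Obj C \<and> e \<in> homset D (on_obj F X) Y \<and> inverse_arrs D e e'" for Y
    using surj[of Y] by (auto simp: isomorphic_def iso_arr_def)
  then obtain g e e' where gee:
    "\<And>Y. Y \<in> Obj D \<Longrightarrow> g Y \<in> Obj C \<and> e Y \<in> homset D (on_obj F (g Y)) Y \<and> inverse_arrs D (e Y) (e' Y)"
    by metis
  have e: "g Y \<in> Obj C" "e Y \<in> Arr D" "Dom D (e Y) = on_obj F (g Y)" "Cod D (e Y) = Y"
      "e' Y \<in> Arr D" "Dom D (e' Y) = Y" "Cod D (e' Y) = on_obj F (g Y)"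
      "e' Y \<cdot>\<^bsub>D\<^esub> e Y = Ide D (on_obj F (g Y))" "e Y \<cdot>\<^bsub>D\<^esub> e' Y = Ide D Y"
    if "Y \<in> Obj D" for Y
    using gee[OF that] by (auto simp: inverse_arrs_iff homset_iff)
  have lift: "\<exists>k. k \<in> homset C X Y \<and> on_arr F k = h"
    if "X \<in> Obj C" "Y \<in> Obj C" "h \<in> homset D (on_obj F X) (on_obj F Y)" for X Y h
    using full that unfolding full_functor_def by (metis imageE)
  \<comment> \<open>Faithfulness is injectivity on single homsets, hence the demand that the
    endpoints agree.\<close>
  have unique: "k = k'"
    if "k \<in> Arr C" "k' \<in> Arr C" "Dom C k = Dom C k'" "Cod C k = Cod C k'" "on_arr F k = on_arr F k'"
    for k k'
  proof (rule inj_onD)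
    show "inj_on (on_arr F) (homset C (Dom C k) (Cod C k))"
      using faithful that(1) by (simp add: faithful_functor_def)
  qed (use that in \<open>auto simp: homset_iff\<close>)
  \<comment> \<open>On arrows, \<open>G f\<close> lifts the conjugate of \<open>f\<close> by the
    isomorphisms \<open>e\<close>. Uniqueness of the lift makes \<open>G\<close> functorial, and its
    defining equation makes \<open>e\<close> natural.\<close>
  define G where "G = \<lparr> on_obj = (\<lambda>Y \<in> Obj D. g Y),
    on_arr = (\<lambda>f \<in> Arr D. SOME k. k \<in> homset C (g (Dom D f)) (g (Cod D f))
      \<and> on_arr F k = e' (Cod D f) \<cdot>\<^bsub>D\<^esub> (f \<cdot>\<^bsub>D\<^esub> e (Dom D f))) \<rparr>"
  have Gobj: "on_obj G Y = g Y" if "Y \<in> Obj D" for Y using that by (simp add: G_def)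
  have Garr: "on_arr G f \<in> Arr C" "Dom C (on_arr G f) = g (Dom D f)" "Cod C (on_arr G f) = g (Cod D f)"
     "on_arr F (on_arr G f) = e' (Cod D f) \<cdot>\<^bsub>D\<^esub> (f \<cdot>\<^bsub>D\<^esub> e (Dom D f))"
    if "f \<in> Arr D" for f
    using someI_ex[OF lift[of "g (Dom D f)" "g (Cod D f)" "e' (Cod D f) \<cdot>\<^bsub>D\<^esub> (f \<cdot>\<^bsub>D\<^esub> e (Dom D f))"]] that
    by (auto simp: G_def homset_iff e)
  have G: "cat_functor D C G"
  proof (rule cat_functorI)
    fix f h assume fh: "f \<in> Arr D" "h \<in> Arr D" "Dom D h = Cod D f"
    let ?X = "Dom D f" and ?Y = "Cod D f" and ?Z = "Cod D h"
    have "(e' ?Z \<cdot>\<^bsub>D\<^esub> (h \<cdot>\<^bsub>D\<^esub> e ?Y)) \<cdot>\<^bsub>D\<^esub> (e' ?Y \<cdot>\<^bsub>D\<^esub> (f \<cdot>\<^bsub>D\<^esub> e ?X))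
      = e' ?Z \<cdot>\<^bsub>D\<^esub> (h \<cdot>\<^bsub>D\<^esub> ((e ?Y \<cdot>\<^bsub>D\<^esub> e' ?Y) \<cdot>\<^bsub>D\<^esub> (f \<cdot>\<^bsub>D\<^esub> e ?X)))"
      using fh by (simp del: e(9) add: e(1-7) F.target.assoc)
    also have "\<dots> = e' ?Z \<cdot>\<^bsub>D\<^esub> ((h \<cdot>\<^bsub>D\<^esub> f) \<cdot>\<^bsub>D\<^esub> e ?X)"
      using fh by (simp add: e F.target.assoc)
    finally show "on_arr G (h \<cdot>\<^bsub>D\<^esub> f) = on_arr G h \<cdot>\<^bsub>C\<^esub> on_arr G f"
      using fh by (intro unique) (simp_all add: Garr)
  next
    fix Y assume Y: "Y \<in> Obj D"
    then show "on_arr G (Ide D Y) = Ide C (on_obj G Y)"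
      by (intro unique) (simp_all add: Garr Gobj e)
  qed (auto simp: F.source.category_axioms F.target.category_axioms Garr Gobj e, auto simp: G_def)
  interpret G: cat_functor D C G by fact
  have "nat_trans D D (comp_fnctr D F G) (id_fnctr D) (restrict e (Obj D))"
  proof (rule nat_transI)
    fix f assume f: "f \<in> Arr D"
    have "e (Cod D f) \<cdot>\<^bsub>D\<^esub> (e' (Cod D f) \<cdot>\<^bsub>D\<^esub> (f \<cdot>\<^bsub>D\<^esub> e (Dom D f))) = f \<cdot>\<^bsub>D\<^esub> e (Dom D f)"
      using f by (simp add: e flip: F.target.assoc)
    then show "restrict e (Obj D) (Cod D f) \<cdot>\<^bsub>D\<^esub> on_arr (comp_fnctr D F G) f
      = on_arr (id_fnctr D) f \<cdot>\<^bsub>D\<^esub> restrict e (Obj D) (Dom D f)"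
      using f by (simp add: Garr)
  qed (auto simp: cat_functor_comp[OF G.cat_functor_axioms F.cat_functor_axioms]
      F.target.category_axioms e Gobj)
  then have \<epsilon>: "nat_iso D D (comp_fnctr D F G) (id_fnctr D) (restrict e (Obj D))"
    using gee by (auto simp: nat_iso_def iso_arr_def)
  \<comment> \<open>The unit at \<open>X\<close> is the lift of \<open>e' (F X)\<close>, the inverse
    of the counit at \<open>F X\<close>; the lift \<open>k'\<close> of the counit itself will be its
    inverse.\<close>
  have "\<exists>k k'. X \<in> Obj C \<longrightarrow> k \<in> homset C X (g (on_obj F X)) \<and> on_arr F k = e' (on_obj F X)
     \<and> k' \<in> homset C (g (on_obj F X)) X \<and> on_arr F k' = e (on_obj F X)" for X
    using lift[of X "g (on_obj F X)" "e' (on_obj F X)"] lift[of "g (on_obj F X)" X "e (on_obj F X)"]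
    by (metis F.on_obj_in e(1-7) homset_iff)
  then obtain k k' where kk: "\<And>X. X \<in> Obj C \<Longrightarrow> k X \<in> homset C X (g (on_obj F X))
      \<and> on_arr F (k X) = e' (on_obj F X)
     \<and> k' X \<in> homset C (g (on_obj F X)) X \<and> on_arr F (k' X) = e (on_obj F X)"
    by metis
  have k: "k X \<in> Arr C" "Dom C (k X) = X" "Cod C (k X) = g (on_obj F X)"
      "on_arr F (k X) = e' (on_obj F X)"
    "k' X \<in> Arr C" "Cod C (k' X) = X" "Dom C (k' X) = g (on_obj F X)" "on_arr F (k' X) = e (on_obj F X)"
    if "X \<in> Obj C" for X
    using kk[OF that] by (auto simp: homset_iff)
  have iso: "inverse_arrs C (k X) (k' X)" if "X \<in> Obj C" for X
    using that unfolding inverse_arrs_iff by (auto simp: k e intro!: unique)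
  have "nat_trans C C (id_fnctr C) (comp_fnctr C G F) (restrict k (Obj C))"
  proof (rule nat_transI)
    fix f assume f: "f \<in> Arr C"
    let ?X = "on_obj F (Dom C f)"
    have "(e' (on_obj F (Cod C f)) \<cdot>\<^bsub>D\<^esub> (on_arr F f \<cdot>\<^bsub>D\<^esub> e ?X)) \<cdot>\<^bsub>D\<^esub> e' ?X
      = e' (on_obj F (Cod C f)) \<cdot>\<^bsub>D\<^esub> (on_arr F f \<cdot>\<^bsub>D\<^esub> (e ?X \<cdot>\<^bsub>D\<^esub> e' ?X))"
      using f by (simp del: e(9) add: e(1-7) F.target.assoc)
    then have "k (Cod C f) \<cdot>\<^bsub>C\<^esub> f = on_arr G (on_arr F f) \<cdot>\<^bsub>C\<^esub> k (Dom C f)"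
      using f by (intro unique) (simp_all add: Garr Gobj e k)
    then show "restrict k (Obj C) (Cod C f) \<cdot>\<^bsub>C\<^esub> on_arr (id_fnctr C) f
      = on_arr (comp_fnctr C G F) f \<cdot>\<^bsub>C\<^esub> restrict k (Obj C) (Dom C f)"
      using f by simp
  qed (auto simp: cat_functor_comp[OF F.cat_functor_axioms G.cat_functor_axioms]
      F.source.category_axioms k Gobj)
  then have \<eta>: "nat_iso C C (id_fnctr C) (comp_fnctr C G F) (restrict k (Obj C))"
    using iso by (auto simp: nat_iso_def iso_arr_def)
  show ?thesis
    unfolding equivalence_functor_def using assms(1) G \<eta> \<epsilon> by blast
qed


subsection \<open>Full subcategories, products and inverse functors\<close>

lemma full_subcat_simps [simp]:
  "Obj (full_subcat C S) = Obj C \<inter> S"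
  "f \<in> Arr (full_subcat C S) \<longleftrightarrow> f \<in> Arr C \<and> Dom C f \<in> S \<and> Cod C f \<in> S"
  "\<lbrakk>f \<in> Arr C; Dom C f \<in> S; Cod C f \<in> S\<rbrakk> \<Longrightarrow> Dom (full_subcat C S) f = Dom C f"
  "\<lbrakk>f \<in> Arr C; Dom C f \<in> S; Cod C f \<in> S\<rbrakk> \<Longrightarrow> Cod (full_subcat C S) f = Cod C f"
  "\<lbrakk>X \<in> Obj C; X \<in> S\<rbrakk> \<Longrightarrow> Ide (full_subcat C S) X = Ide C X"
  "\<lbrakk>f \<in> Arr C; Dom C f \<in> S; Cod C f \<in> S; g \<in> Arr C; Dom C g = Cod C f; Cod C g \<in> S\<rbrakk>
   \<Longrightarrow> g \<cdot>\<^bsub>full_subcat C S\<^esub> f = g \<cdot>\<^bsub>C\<^esub> f"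
  by (auto simp: full_subcat_def Let_def)

lemma full_subcat_subcategory:
  assumes "category C"
  shows "subcategory (full_subcat C S) C"
proof -
  interpret C: category C by fact
  have "category (full_subcat C S)"
  proof (rule categoryI)
    fix f g h
    assume "f \<in> Arr (full_subcat C S)" "g \<in> Arr (full_subcat C S)" "h \<in> Arr (full_subcat C S)"
      "Dom (full_subcat C S) g = Cod (full_subcat C S) f"
      "Dom (full_subcat C S) h = Cod (full_subcat C S) g"
    then show "(h \<cdot>\<^bsub>full_subcat C S\<^esub> g) \<cdot>\<^bsub>full_subcat C S\<^esub> f
        = h \<cdot>\<^bsub>full_subcat C S\<^esub> (g \<cdot>\<^bsub>full_subcat C S\<^esub> f)"
      by (simp add: C.assoc)
  qed (auto, auto simp: full_subcat_def Let_def)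
  then show ?thesis
    by (auto simp: subcategory_def assms)
qed

lemma full_subcat_category: "category C \<Longrightarrow> category (full_subcat C S)"
  using full_subcat_subcategory by (auto simp: subcategory_def)

lemma full_subcat_incl_full:
  "full_functor (full_subcat C S) C (incl_fnctr (full_subcat C S))"
  by (force simp: full_functor_def homset_def image_def)

lemma full_subcat_incl_faithful:
  "faithful_functor (full_subcat C S) (incl_fnctr (full_subcat C S))"
  by (auto simp: faithful_functor_def inj_on_def homset_def)

lemma prod_cat_simps [simp]:
  "Obj (prod_cat C D) = Obj C \<times> Obj D"
  "Arr (prod_cat C D) = Arr C \<times> Arr D"
  "\<lbrakk>f \<in> Arr C; g \<in> Arr D\<rbrakk> \<Longrightarrow> Dom (prod_cat C D) (f, g) = (Dom C f, Dom D g)"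
  "\<lbrakk>f \<in> Arr C; g \<in> Arr D\<rbrakk> \<Longrightarrow> Cod (prod_cat C D) (f, g) = (Cod C f, Cod D g)"
  "\<lbrakk>X \<in> Obj C; Y \<in> Obj D\<rbrakk> \<Longrightarrow> Ide (prod_cat C D) (X, Y) = (Ide C X, Ide D Y)"
  "\<lbrakk>f \<in> Arr C; g \<in> Arr D; f' \<in> Arr C; g' \<in> Arr D; Dom C f' = Cod C f; Dom D g' = Cod D g\<rbrakk>
   \<Longrightarrow> (f', g') \<cdot>\<^bsub>prod_cat C D\<^esub> (f, g) = (f' \<cdot>\<^bsub>C\<^esub> f, g' \<cdot>\<^bsub>D\<^esub> g)"
  by (auto simp: prod_cat_def)

lemma prod_cat_category:
  assumes "category C" "category D"
  shows "category (prod_cat C D)"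
proof -
  interpret C: category C by fact
  interpret D: category D by fact
  show ?thesis
  proof (rule categoryI)
    show "g \<cdot>\<^bsub>prod_cat C D\<^esub> f = undefined"
      if "\<not> (g \<in> Arr (prod_cat C D) \<and> f \<in> Arr (prod_cat C D)
        \<and> Dom (prod_cat C D) g = Cod (prod_cat C D) f)" for f g
      using that by (auto simp: prod_cat_def)
  qed (auto simp: C.assoc D.assoc, auto simp: prod_cat_def)
qed

lemma prod_cat_functorI:
  assumes "category C" "category D" "category E"
    and "\<And>X Y. \<lbrakk>X \<in> Obj C; Y \<in> Obj D\<rbrakk> \<Longrightarrow> on_obj F (X, Y) \<in> Obj E"
    and "\<And>f g. \<lbrakk>f \<in> Arr C; g \<in> Arr D\<rbrakk> \<Longrightarrow> on_arr F (f, g) \<in> Arr E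
      \<and> Dom E (on_arr F (f, g)) = on_obj F (Dom C f, Dom D g)
      \<and> Cod E (on_arr F (f, g)) = on_obj F (Cod C f, Cod D g)"
    and "\<And>X Y. \<lbrakk>X \<in> Obj C; Y \<in> Obj D\<rbrakk>
      \<Longrightarrow> on_arr F (Ide C X, Ide D Y) = Ide E (on_obj F (X, Y))"
    and "\<And>f g f' g'. \<lbrakk>f \<in> Arr C; g \<in> Arr D; f' \<in> Arr C; g' \<in> Arr D;
        Dom C f' = Cod C f; Dom D g' = Cod D g\<rbrakk>
      \<Longrightarrow> on_arr F (f' \<cdot>\<^bsub>C\<^esub> f, g' \<cdot>\<^bsub>D\<^esub> g) = on_arr F (f', g') \<cdot>\<^bsub>E\<^esub> on_arr F (f, g)"
    and "on_obj F \<in> extensional (Obj C \<times> Obj D)" "on_arr F \<in> extensional (Arr C \<times> Arr D)"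
  shows "cat_functor (prod_cat C D) E F"
  by (rule cat_functorI) (use assms in \<open>auto simp: prod_cat_category\<close>)

section \<open>Strict inverses of functors that are bijective on objects and arrows\<close>

definition inv_fnctr where
  "inv_fnctr C D F =
    \<lparr> on_obj = restrict (inv_into (Obj C) (on_obj F)) (Obj D),
      on_arr = restrict (inv_into (Arr C) (on_arr F)) (Arr D) \<rparr>"

lemma inv_fnctr_simps:
  assumes "bij_betw (on_obj F) (Obj C) (Obj D)" "bij_betw (on_arr F) (Arr C) (Arr D)"
  shows "Y \<in> Obj D \<Longrightarrow> on_obj (inv_fnctr C D F) Y \<in> Obj C"
    and "Y \<in> Obj D \<Longrightarrow> on_obj F (on_obj (inv_fnctr C D F) Y) = Y"
    and "g \<in> Arr D \<Longrightarrow> on_arr (inv_fnctr C D F) g \<in> Arr C"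
    and "g \<in> Arr D \<Longrightarrow> on_arr F (on_arr (inv_fnctr C D F) g) = g"
    and "\<lbrakk>X \<in> Obj C; on_obj F X \<in> Obj D\<rbrakk> \<Longrightarrow> on_obj (inv_fnctr C D F) (on_obj F X) = X"
    and "\<lbrakk>f \<in> Arr C; on_arr F f \<in> Arr D\<rbrakk> \<Longrightarrow> on_arr (inv_fnctr C D F) (on_arr F f) = f"
  using assms
  by (auto simp: inv_fnctr_def bij_betw_def f_inv_into_f inv_into_into)

text \<open>The functor laws for the inverse hold because both sides have the same image under
  \<open>F\<close>, which is injective on objects and on arrows.\<close>

lemma inv_fnctr_functor:
  assumes "cat_functor C D F"
    and bij: "bij_betw (on_obj F) (Obj C) (Obj D)" "bij_betw (on_arr F) (Arr C) (Arr D)"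
  shows "cat_functor D C (inv_fnctr C D F)"
proof -
  interpret F: cat_functor C D F by fact
  note inv [simp] = inv_fnctr_simps[OF bij]
  have obj_eq: "X = Y" if "X \<in> Obj C" "Y \<in> Obj C" "on_obj F X = on_obj F Y" for X Y
    using bij(1) that by (auto simp: bij_betw_def inj_on_def)
  have arr_eq: "f = g" if "f \<in> Arr C" "g \<in> Arr C" "on_arr F f = on_arr F g" for f g
    using bij(2) that by (auto simp: bij_betw_def inj_on_def)
  have [simp]: "Dom C (on_arr (inv_fnctr C D F) g) = on_obj (inv_fnctr C D F) (Dom D g)"
    "Cod C (on_arr (inv_fnctr C D F) g) = on_obj (inv_fnctr C D F) (Cod D g)" if "g \<in> Arr D" for g
    using that F.on_arr_arr(2,3)[of "on_arr (inv_fnctr C D F) g"] by (auto intro!: obj_eq)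
  show ?thesis
    by (rule cat_functorI)
       (auto simp: F.source.category_axioms F.target.category_axioms intro!: arr_eq,
        auto simp: inv_fnctr_def)
qed

lemma inv_fnctr_comp:
  assumes "cat_functor C D F"
    and bij: "bij_betw (on_obj F) (Obj C) (Obj D)" "bij_betw (on_arr F) (Arr C) (Arr D)"
  shows "comp_fnctr C (inv_fnctr C D F) F = id_fnctr C"
    and "comp_fnctr D F (inv_fnctr C D F) = id_fnctr D"
proof -
  interpret F: cat_functor C D F by fact
  note inv [simp] = inv_fnctr_simps[OF bij]
  note I = inv_fnctr_functor[OF assms]
  show "comp_fnctr C (inv_fnctr C D F) F = id_fnctr C"
    by (rule fnctr_eqI[OF cat_functor_comp[OF assms(1) I] id_functor[OF F.source.category_axioms]]) auto
  show "comp_fnctr D F (inv_fnctr C D F) = id_fnctr D"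
    by (rule fnctr_eqI[OF cat_functor_comp[OF I assms(1)] id_functor[OF F.target.category_axioms]]) auto
qed


section \<open>Arrow categories\<close>

lemma squares_iff:
  "s \<in> squares C \<longleftrightarrow> sq_src s \<in> Arr C \<and> sq_tgt s \<in> Arr C \<and> sq_dom s \<in> Arr C \<and> sq_cod s \<in> Arr C
     \<and> Dom C (sq_dom s) = Dom C (sq_src s) \<and> Cod C (sq_dom s) = Dom C (sq_tgt s)
     \<and> Dom C (sq_cod s) = Cod C (sq_src s) \<and> Cod C (sq_cod s) = Cod C (sq_tgt s)
     \<and> sq_cod s \<cdot>\<^bsub>C\<^esub> sq_src s = sq_tgt s \<cdot>\<^bsub>C\<^esub> sq_dom s"
  by (cases s) (auto simp: squares_def homset_iff)

lemma square_arrD: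
  assumes "s \<in> squares C"
  shows "sq_src s \<in> Arr C" "sq_tgt s \<in> Arr C" "sq_dom s \<in> Arr C" "sq_cod s \<in> Arr C"
    "Dom C (sq_dom s) = Dom C (sq_src s)" "Cod C (sq_dom s) = Dom C (sq_tgt s)"
    "Dom C (sq_cod s) = Cod C (sq_src s)" "Cod C (sq_cod s) = Cod C (sq_tgt s)"
  using assms by (auto simp: squares_iff)

lemma square_commutes: "s \<in> squares C \<Longrightarrow> sq_cod s \<cdot>\<^bsub>C\<^esub> sq_src s = sq_tgt s \<cdot>\<^bsub>C\<^esub> sq_dom s"
  by (simp add: squares_iff)

lemma arrow_cat_simps [simp]:
  "Obj (arrow_cat C) = Arr C" "Arr (arrow_cat C) = squares C"
  "s \<in> squares C \<Longrightarrow> Dom (arrow_cat C) s = sq_src s"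
  "s \<in> squares C \<Longrightarrow> Cod (arrow_cat C) s = sq_tgt s"
  "f \<in> Arr C \<Longrightarrow> Ide (arrow_cat C) f = Square f f (Ide C (Dom C f)) (Ide C (Cod C f))"
  "\<lbrakk>t \<in> squares C; s \<in> squares C; sq_src t = sq_tgt s\<rbrakk> \<Longrightarrow> t \<cdot>\<^bsub>arrow_cat C\<^esub> s
     = Square (sq_src s) (sq_tgt t) (sq_dom t \<cdot>\<^bsub>C\<^esub> sq_dom s) (sq_cod t \<cdot>\<^bsub>C\<^esub> sq_cod s)"
  by (auto simp: arrow_cat_def)

lemma arrow_cat_category [intro]:
  assumes "category C"
  shows "category (arrow_cat C)"
proof -
  interpret C: category C by fact
  have comp: "Square (sq_src s) (sq_tgt t) (sq_dom t \<cdot>\<^bsub>C\<^esub> sq_dom s) (sq_cod t \<cdot>\<^bsub>C\<^esub> sq_cod s) \<in> squares C"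
    if s: "s \<in> squares C" and t: "t \<in> squares C" and st: "sq_src t = sq_tgt s" for s t
  proof -
    note [simp] = square_arrD[OF s] square_arrD[OF t]
    have "(sq_cod t \<cdot>\<^bsub>C\<^esub> sq_cod s) \<cdot>\<^bsub>C\<^esub> sq_src s = sq_cod t \<cdot>\<^bsub>C\<^esub> (sq_tgt s \<cdot>\<^bsub>C\<^esub> sq_dom s)"
      using st by (simp add: C.assoc square_commutes[OF s])
    also have "\<dots> = (sq_tgt t \<cdot>\<^bsub>C\<^esub> sq_dom t) \<cdot>\<^bsub>C\<^esub> sq_dom s"
      using st square_commutes[OF t] by (simp flip: C.assoc)
    also have "\<dots> = sq_tgt t \<cdot>\<^bsub>C\<^esub> (sq_dom t \<cdot>\<^bsub>C\<^esub> sq_dom s)"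
      using st by (simp add: C.assoc)
    finally show ?thesis using st by (simp add: squares_iff)
  qed
  have ide: "Square f f (Ide C (Dom C f)) (Ide C (Cod C f)) \<in> squares C" if "f \<in> Arr C" for f
    using that by (simp add: squares_iff)
  show ?thesis
  proof (rule categoryI)
    fix s t u
    assume *: "s \<in> Arr (arrow_cat C)" "t \<in> Arr (arrow_cat C)" "u \<in> Arr (arrow_cat C)"
      "Dom (arrow_cat C) t = Cod (arrow_cat C) s" "Dom (arrow_cat C) u = Cod (arrow_cat C) t"
    then have *: "s \<in> squares C" "t \<in> squares C" "u \<in> squares C" "sq_src t = sq_tgt s"
        "sq_src u = sq_tgt t"
      by auto
    note [simp] = *(4,5) square_arrD[OF *(1)] square_arrD[OF *(2)] square_arrD[OF *(3)]
    show "(u \<cdot>\<^bsub>arrow_cat C\<^esub> t) \<cdot>\<^bsub>arrow_cat C\<^esub> s = u \<cdot>\<^bsub>arrow_cat C\<^esub> (t \<cdot>\<^bsub>arrow_cat C\<^esub> s)"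
      using *(1-3) comp[OF *(1,2,4)] comp[OF *(2,3,5)] by (simp add: C.assoc)
  qed (auto simp: comp ide square_arrD square.expand, auto simp: arrow_cat_def)
qed

lemma cod_functor_simps [simp]:
  "f \<in> Arr C \<Longrightarrow> on_obj (cod_functor C) f = Cod C f"
  "s \<in> squares C \<Longrightarrow> on_arr (cod_functor C) s = sq_cod s"
  by (auto simp: cod_functor_def)

lemma cod_functor_functor:
  assumes "category C"
  shows "cat_functor (arrow_cat C) C (cod_functor C)"
proof -
  interpret C: category C by fact
  interpret A: category "arrow_cat C" using assms by blast
  show ?thesis
  proof (rule cat_functorI)
    fix s t assume *: "s \<in> Arr (arrow_cat C)" "t \<in> Arr (arrow_cat C)"
      "Dom (arrow_cat C) t = Cod (arrow_cat C) s"
    then show "on_arr (cod_functor C) (t \<cdot>\<^bsub>arrow_cat C\<^esub> s)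
        = on_arr (cod_functor C) t \<cdot>\<^bsub>C\<^esub> on_arr (cod_functor C) s"
      using A.comp_arr[OF *] by simp
  next
    fix f assume "f \<in> Obj (arrow_cat C)"
    then show "on_arr (cod_functor C) (Ide (arrow_cat C) f) = Ide C (on_obj (cod_functor C) f)"
      using A.ide_arr[of f] by simp
  qed (auto simp: assms square_arrD, auto simp: cod_functor_def)
qed

lemma arrow_functor_simps [simp]:
  "f \<in> Arr C \<Longrightarrow> on_obj (arrow_functor C F) f = on_arr F f"
  "s \<in> squares C \<Longrightarrow> on_arr (arrow_functor C F) s = map_square (on_arr F) s"
  by (auto simp: arrow_functor_def)

lemma (in cat_functor) map_square_squares:
  assumes "s \<in> squares C"
  shows "map_square (on_arr F) s \<in> squares D"
  using assms by (auto simp: squares_iff square.map_sel simp flip: on_arr_comp_arr)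

lemma arrow_functor_functor:
  assumes "cat_functor C D F"
  shows "cat_functor (arrow_cat C) (arrow_cat D) (arrow_functor C F)"
proof -
  interpret F: cat_functor C D F by fact
  interpret A: category "arrow_cat C" using F.source.category_axioms by blast
  interpret B: category "arrow_cat D" using F.target.category_axioms by blast
  show ?thesis
  proof (rule cat_functorI)
    fix s t assume *: "s \<in> Arr (arrow_cat C)" "t \<in> Arr (arrow_cat C)"
      "Dom (arrow_cat C) t = Cod (arrow_cat C) s"
    then show "on_arr (arrow_functor C F) (t \<cdot>\<^bsub>arrow_cat C\<^esub> s)
        = on_arr (arrow_functor C F) t \<cdot>\<^bsub>arrow_cat D\<^esub> on_arr (arrow_functor C F) s"
      using A.comp_arr[OF *] by (simp add: F.map_square_squares square.map_sel square_arrD)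
  next
    fix f assume "f \<in> Obj (arrow_cat C)"
    then show "on_arr (arrow_functor C F) (Ide (arrow_cat C) f)
        = Ide (arrow_cat D) (on_obj (arrow_functor C F) f)"
      using A.ide_arr[of f] by simp
  qed (auto simp: A.category_axioms B.category_axioms F.map_square_squares square.map_sel square_arrD,
       auto simp: arrow_functor_def)
qed

lemma inverse_squares:
  assumes "category C" "inverse_arrs (arrow_cat C) s t"
  shows "inverse_arrs C (sq_dom s) (sq_dom t)" "inverse_arrs C (sq_cod s) (sq_cod t)"
proof -
  interpret A: category "arrow_cat C" using assms by blast
  have s: "s \<in> squares C" "t \<in> squares C" "sq_src t = sq_tgt s" "sq_tgt t = sq_src s"
    using assms(2) by (auto simp: inverse_arrs_iff)
  show "inverse_arrs C (sq_dom s) (sq_dom t)" "inverse_arrs C (sq_cod s) (sq_cod t)"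
    using assms(2) s by (auto simp: inverse_arrs_iff square_arrD)
qed

text \<open>Inverting the two components suffices: composing the commutation of \<open>s\<close>
  with \<open>u\<close> on the right and \<open>v\<close> on the left gives the commutation of the
  reversed square.\<close>

lemma inverse_squaresI:
  assumes "category C" "s \<in> squares C" "inverse_arrs C (sq_dom s) u" "inverse_arrs C (sq_cod s) v"
  shows "inverse_arrs (arrow_cat C) s (Square (sq_tgt s) (sq_src s) u v)"
proof -
  interpret C: category C by fact
  note [simp] = square_arrD[OF assms(2)]
  have uv: "u \<in> Arr C" "v \<in> Arr C" "Dom C u = Dom C (sq_tgt s)" "Cod C u = Dom C (sq_src s)"
    "Dom C v = Cod C (sq_tgt s)" "Cod C v = Cod C (sq_src s)"
    "u \<cdot>\<^bsub>C\<^esub> sq_dom s = Ide C (Dom C (sq_src s))" "sq_dom s \<cdot>\<^bsub>C\<^esub> u = Ide C (Dom C (sq_tgt s))"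
    "v \<cdot>\<^bsub>C\<^esub> sq_cod s = Ide C (Cod C (sq_src s))" "sq_cod s \<cdot>\<^bsub>C\<^esub> v = Ide C (Cod C (sq_tgt s))"
    using assms by (auto simp: inverse_arrs_iff)
  have "v \<cdot>\<^bsub>C\<^esub> (sq_tgt s \<cdot>\<^bsub>C\<^esub> (sq_dom s \<cdot>\<^bsub>C\<^esub> u)) = v \<cdot>\<^bsub>C\<^esub> ((sq_tgt s \<cdot>\<^bsub>C\<^esub> sq_dom s) \<cdot>\<^bsub>C\<^esub> u)"
    by (simp add: uv(1-6) C.assoc)
  also have "\<dots> = (v \<cdot>\<^bsub>C\<^esub> sq_cod s) \<cdot>\<^bsub>C\<^esub> (sq_src s \<cdot>\<^bsub>C\<^esub> u)"
    by (simp only: square_commutes[OF assms(2), symmetric]) (simp add: uv(1-6) C.assoc)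
  finally have "Square (sq_tgt s) (sq_src s) u v \<in> squares C"
    by (simp add: squares_iff uv)
  then show ?thesis
    using assms(2) by (simp add: inverse_arrs_iff uv)
qed


section \<open>Constructions on 2-categories\<close>

lemma two_category_full_sub:
  assumes "two_category A"
  shows "two_category (full_sub_twocat A P)"
proof -
  interpret A: two_category A by fact
  show ?thesis
    unfolding full_sub_twocat_def
    by (rule two_category.intro)
       (simp_all add: A.hom_category A.id1_in A.hcomp_functor A.hcomp_assoc_1 A.hcomp_assoc_2
          A.hcomp_unit_1 A.hcomp_unit_2)
qed

text \<open>Restriction to certain objects and restriction to certain 1-cells change different
  fields, so they commute. Hence \<open>CompCat_str2_repl\<close> is also the locally full
  sub-2-category of \<open>CompCat_repl\<close> on strict maps, the form to which the results on
  inclusions apply.\<close>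

lemma full_sub_locally_full_sub:
  "full_sub_twocat (locally_full_sub_twocat A P) R = locally_full_sub_twocat (full_sub_twocat A R) P"
  by (simp add: full_sub_twocat_def locally_full_sub_twocat_def Let_def)

text \<open>Functoriality of \<open>HComp\<close> out of the product category, spelled out on pairs
  for the simplifier.\<close>

lemma (in two_category) hcomp_simps [simp]:
  assumes "X \<in> Ob A" "Y \<in> Ob A" "Z \<in> Ob A"
  shows "\<lbrakk>g \<in> Obj (HomCat A Y Z); f \<in> Obj (HomCat A X Y)\<rbrakk>
      \<Longrightarrow> on_obj (HComp A X Y Z) (g, f) \<in> Obj (HomCat A X Z)"
    and "\<lbrakk>t \<in> Arr (HomCat A Y Z); s \<in> Arr (HomCat A X Y)\<rbrakk>
      \<Longrightarrow> on_arr (HComp A X Y Z) (t, s) \<in> Arr (HomCat A X Z)"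
    and "\<lbrakk>t \<in> Arr (HomCat A Y Z); s \<in> Arr (HomCat A X Y)\<rbrakk>
      \<Longrightarrow> Dom (HomCat A X Z) (on_arr (HComp A X Y Z) (t, s))
        = on_obj (HComp A X Y Z) (Dom (HomCat A Y Z) t, Dom (HomCat A X Y) s)"
    and "\<lbrakk>t \<in> Arr (HomCat A Y Z); s \<in> Arr (HomCat A X Y)\<rbrakk>
      \<Longrightarrow> Cod (HomCat A X Z) (on_arr (HComp A X Y Z) (t, s))
        = on_obj (HComp A X Y Z) (Cod (HomCat A Y Z) t, Cod (HomCat A X Y) s)"
    and "\<lbrakk>g \<in> Obj (HomCat A Y Z); f \<in> Obj (HomCat A X Y)\<rbrakk>
      \<Longrightarrow> on_arr (HComp A X Y Z) (Ide (HomCat A Y Z) g, Ide (HomCat A X Y) f)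
        = Ide (HomCat A X Z) (on_obj (HComp A X Y Z) (g, f))"
    and "\<lbrakk>t \<in> Arr (HomCat A Y Z); s \<in> Arr (HomCat A X Y);
        t' \<in> Arr (HomCat A Y Z); s' \<in> Arr (HomCat A X Y);
        Dom (HomCat A Y Z) t' = Cod (HomCat A Y Z) t; Dom (HomCat A X Y) s' = Cod (HomCat A X Y) s\<rbrakk>
      \<Longrightarrow> on_arr (HComp A X Y Z) (t' \<cdot>\<^bsub>HomCat A Y Z\<^esub> t, s' \<cdot>\<^bsub>HomCat A X Y\<^esub> s)
        = on_arr (HComp A X Y Z) (t', s') \<cdot>\<^bsub>HomCat A X Z\<^esub> on_arr (HComp A X Y Z) (t, s)"
  using cat_functor.on_obj_in[OF hcomp_functor[OF assms], of "(g, f)"]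
    cat_functor.on_arr_arr[OF hcomp_functor[OF assms], of "(t, s)"]
    cat_functor.on_arr_ide[OF hcomp_functor[OF assms], of "(g, f)"]
    cat_functor.on_arr_comp_arr[OF hcomp_functor[OF assms], of "(t, s)" "(t', s')"]
  by simp_all

section \<open>Locally full sub-2-categories and their inclusions\<close>

lemma locally_full_sub_simps:
  "Ob (locally_full_sub_twocat A P) = Ob A"
      "HomCat (locally_full_sub_twocat A P) X Y = full_subcat (HomCat A X Y) {f. P X Y f}"
          "Id1 (locally_full_sub_twocat A P) = Id1 A"
  "\<lbrakk>g \<in> Obj (HomCat A Y Z); P Y Z g; f \<in> Obj (HomCat A X Y); P X Y f\<rbrakk>
    \<Longrightarrow> on_obj (HComp (locally_full_sub_twocat A P) X Y Z) (g, f) = on_obj (HComp A X Y Z) (g, f)"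
  "\<lbrakk>t \<in> Arr (full_subcat (HomCat A Y Z) {f. P Y Z f}); s \<in> Arr (full_subcat
      (HomCat A X Y) {f. P X Y f})\<rbrakk>
    \<Longrightarrow> on_arr (HComp (locally_full_sub_twocat A P) X Y Z) (t, s) = on_arr (HComp A X Y Z) (t, s)"
  by (simp_all add: locally_full_sub_twocat_def Let_def)

lemma incl_locally_full_sub_hom:
  assumes "X \<in> Ob A" "Y \<in> Ob A"
  shows "full_functor (HomCat (locally_full_sub_twocat A P) X Y) (HomCat A X Y)
      (tf_hom (incl_twofnctr (locally_full_sub_twocat A P)) X Y)"
    and "faithful_functor (HomCat (locally_full_sub_twocat A P) X Y)
      (tf_hom (incl_twofnctr (locally_full_sub_twocat A P)) X Y)"
  using assms full_subcat_incl_full full_subcat_incl_faithful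
  by (auto simp: id_twofnctr_def locally_full_sub_simps)

context
  fixes A :: "('x, 'f, 't) twocat" and P :: "'x \<Rightarrow> 'x \<Rightarrow> 'f \<Rightarrow> bool"
  assumes A: "two_category A"
    and P_id: "\<And>X. X \<in> Ob A \<Longrightarrow> P X X (Id1 A X)"
    and P_comp: "\<And>X Y Z f g. \<lbrakk>X \<in> Ob A; Y \<in> Ob A; Z \<in> Ob A; f \<in> Obj (HomCat A X Y);
      g \<in> Obj (HomCat A Y Z); P X Y f; P Y Z g\<rbrakk> \<Longrightarrow> P X Z (on_obj (HComp A X Y Z) (g, f))"
begin

interpretation A: two_category A by (rule A)

private abbreviation (input) "S \<equiv> locally_full_sub_twocat A P"

text \<open>Closure of \<open>P\<close> under identities and composites keeps the restricted
  composition inside the full subcategories of the hom-categories; for 2-cells only source and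
  target are constrained. All equations are inherited from \<open>A\<close>.\<close>

lemma two_category_locally_full_sub: "two_category S"
proof (rule two_category.intro)
  fix X Y Z assume *: "X \<in> Ob S" "Y \<in> Ob S" "Z \<in> Ob S"
  note [simp] = locally_full_sub_simps P_id P_comp 
  interpret XY: category "HomCat A X Y" using * by (simp add: A.hom_category)
  interpret YZ: category "HomCat A Y Z" using * by (simp add: A.hom_category)
  interpret XZ: category "HomCat A X Z" using * by (simp add: A.hom_category)
  show "category (HomCat S X Y)"
    by (simp add: full_subcat_category XY.category_axioms)
  show "Id1 S X \<in> Obj (HomCat S X X)"
    using * A.id1_in by simp
  show "cat_functor (prod_cat (HomCat S Y Z) (HomCat S X Y)) (HomCat S X Z) (HComp S X Y Z)"
  proof (rule prod_cat_functorI)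
    show "on_obj (HComp S X Y Z) \<in> extensional (Obj (HomCat S Y Z) \<times> Obj (HomCat S X Y))"
      "on_arr (HComp S X Y Z) \<in> extensional (Arr (HomCat S Y Z) \<times> Arr (HomCat S X Y))"
      by (simp_all add: locally_full_sub_twocat_def Let_def comp_fnctr_def)
  qed (use * in \<open>auto simp: full_subcat_category A.hom_category\<close>)
next
  fix X Y f assume "X \<in> Ob S" "Y \<in> Ob S" "f \<in> Obj (HomCat S X Y)"
  then show "on_obj (HComp S X Y Y) (Id1 S Y, f) = f \<and> on_obj (HComp S X X Y) (f, Id1 S X) = f"
    by (simp add: locally_full_sub_simps P_id A.id1_in A.hcomp_unit_1)
next
  fix X Y t assume *: "X \<in> Ob S" "Y \<in> Ob S" "t \<in> Arr (HomCat S X Y)"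
  interpret XX: category "HomCat A X X" using * by (simp add: A.hom_category locally_full_sub_simps)
  interpret YY: category "HomCat A Y Y" using * by (simp add: A.hom_category locally_full_sub_simps)
  show "on_arr (HComp S X Y Y) (Ide (HomCat S Y Y) (Id1 S Y), t) = t
      \<and> on_arr (HComp S X X Y) (t, Ide (HomCat S X X) (Id1 S X)) = t"
    using * by (simp add: locally_full_sub_simps P_id A.id1_in A.hcomp_unit_2)
qed (simp_all add: locally_full_sub_simps P_comp A.hcomp_assoc_1 A.hcomp_assoc_2
      category.dom_obj[OF A.hom_category] category.cod_obj[OF A.hom_category])

lemma incl_locally_full_sub: "two_functor S A (incl_twofnctr S)"
proof -
  interpret S: two_category S by (rule two_category_locally_full_sub)
  show ?thesis
  proof (rule two_functor.intro[OF S.two_category_axioms A two_functor_axioms.intro])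
    show "cat_functor (HomCat S X Y) (HomCat A (tf_ob (incl_twofnctr S) X) (tf_ob (incl_twofnctr S) Y))
        (tf_hom (incl_twofnctr S) X Y)" if "X \<in> Ob S" "Y \<in> Ob S" for X Y
      using that A.hom_category
      by (simp add: id_twofnctr_def locally_full_sub_simps full_subcat_subcategory
          subcategory_incl_functor)
  qed (auto simp: id_twofnctr_def S.id1_in, simp_all add: locally_full_sub_simps)
qed

end

text \<open>The identity 1-cell composes with itself to itself, so reflexivity of isomorphism serves
  both conditions. This gives surjectivity up to equivalence for 2-functors that hit every object
  exactly.\<close>

lemma (in two_category) internally_equivalent_refl:
  assumes X: "X \<in> Ob A"
  shows "internally_equivalent A X X"
proof -
  interpret category "HomCat A X X" using X by (rule hom_category[OF X])
  have "on_obj (HComp A X X X) (Id1 A X, Id1 A X) = Id1 A X"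
    using X id1_in hcomp_unit_1 by blast
  then show ?thesis
    unfolding internally_equivalent_def using id1_in[OF X] isomorphic_refl by metis
qed

section \<open>Composition and inversion of 2-functors\<close>

lemma comp_twofnctr_simps [simp]:
  "X \<in> Ob A \<Longrightarrow> tf_ob (comp_twofnctr A Q P) X = tf_ob Q (tf_ob P X)"
  "\<lbrakk>X \<in> Ob A; Y \<in> Ob A\<rbrakk> \<Longrightarrow> tf_hom (comp_twofnctr A Q P) X Y
    = comp_fnctr (HomCat A X Y) (tf_hom Q (tf_ob P X) (tf_ob P Y)) (tf_hom P X Y)"
  by (auto simp: comp_twofnctr_def compose_def)

lemma two_functor_comp:
  assumes "two_functor A B P" "two_functor B C Q"
  shows "two_functor A C (comp_twofnctr A Q P)"
proof -
  interpret P: two_functor A B P by fact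
  interpret Q: two_functor B C Q by fact
  have P: "on_obj (tf_hom P X Y) f \<in> Obj (HomCat B (tf_ob P X) (tf_ob P Y))"
    if "X \<in> Ob A" "Y \<in> Ob A" "f \<in> Obj (HomCat A X Y)" for X Y f
    using cat_functor.on_obj_in[OF P.tf_hom_functor[OF that(1,2)]] that by simp
  have P2: "on_arr (tf_hom P X Y) f \<in> Arr (HomCat B (tf_ob P X) (tf_ob P Y))"
    if "X \<in> Ob A" "Y \<in> Ob A" "f \<in> Arr (HomCat A X Y)" for X Y f
    using cat_functor.on_arr_arr[OF P.tf_hom_functor[OF that(1,2)]] that by simp
  show ?thesis
  proof (rule two_functor.intro[OF P.source.two_category_axioms Q.target.two_category_axioms
      two_functor_axioms.intro])
    show "cat_functor (HomCat A X Y)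
        (HomCat C (tf_ob (comp_twofnctr A Q P) X) (tf_ob (comp_twofnctr A Q P) Y))
        (tf_hom (comp_twofnctr A Q P) X Y)" if "X \<in> Ob A" "Y \<in> Ob A" for X Y
      using that P.tf_hom_functor[of X Y] Q.tf_hom_functor[of "tf_ob P X" "tf_ob P Y"]
      by (auto simp: P.tf_ob_in)
  qed (simp_all add: P P2 P.tf_ob_in Q.tf_ob_in P.source.id1_in P.tf_id1 Q.tf_id1 P.tf_hcomp_1
      Q.tf_hcomp_1
        P.tf_hcomp_2 Q.tf_hcomp_2, auto simp: comp_twofnctr_def)
qed

lemma full_functor_comp:
  assumes "cat_functor C D F" "full_functor C D F" "full_functor D E G"
  shows "full_functor C E (comp_fnctr C G F)"
proof -
  interpret F: cat_functor C D F by fact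
  have "on_arr (comp_fnctr C G F) ` homset C X Y = on_arr G ` (on_arr F ` homset C X Y)" for X Y
    by (simp add: image_image homset_def)
  then show ?thesis
    using assms(2,3) by (simp add: full_functor_def)
qed

lemma faithful_functor_comp:
  assumes "cat_functor C D F" "faithful_functor C F" "faithful_functor D G"
  shows "faithful_functor C (comp_fnctr C G F)"
proof -
  interpret F: cat_functor C D F by fact
  show ?thesis
    unfolding faithful_functor_def
  proof (intro ballI inj_onI)
    fix X Y f g assume X: "X \<in> Obj C" "Y \<in> Obj C"
      and f: "f \<in> homset C X Y" and g: "g \<in> homset C X Y"
      and eq: "on_arr (comp_fnctr C G F) f = on_arr (comp_fnctr C G F) g"
    have "on_arr F f = on_arr F g"
      by (rule inj_onD[of "on_arr G" "homset D (on_obj F X) (on_obj F Y)"])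
         (use assms X f g eq in \<open>auto simp: faithful_functor_def homset_iff\<close>)
    then show "f = g"
      using assms(2) X f g by (auto simp: faithful_functor_def inj_on_def)
  qed
qed

lemma bij_functor_full_faithful:
  assumes "cat_functor C D F"
    and bij: "bij_betw (on_obj F) (Obj C) (Obj D)" "bij_betw (on_arr F) (Arr C) (Arr D)"
  shows "full_functor C D F" "faithful_functor C F"
proof -
  interpret F: cat_functor C D F by fact
  show "full_functor C D F"
    unfolding full_functor_def
  proof (intro ballI equalityI subsetI)
    fix X Y g assume X: "X \<in> Obj C" "Y \<in> Obj C" and g: "g \<in> homset D (on_obj F X) (on_obj F Y)"
    then obtain f where f: "f \<in> Arr C" "g = on_arr F f"
      using bij(2) by (auto simp: homset_iff bij_betw_def)
    \<comment> \<open>Injectivity on objects identifies the endpoints of the preimage, since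
      \<open>F\<close> sends them to \<open>F X\<close> and \<open>F Y\<close>.\<close>
    moreover have "Dom C f = X" "Cod C f = Y"
      using X f g bij(1) F.source.dom_obj[of f] F.source.cod_obj[of f]
      by (auto simp: homset_iff bij_betw_def inj_on_def simp del: F.source.dom_obj F.source.cod_obj)
    ultimately show "g \<in> on_arr F ` homset C X Y" by (auto simp: homset_iff)
  qed (auto simp: homset_iff)
  show "faithful_functor C F"
    using bij(2) by (auto simp: faithful_functor_def homset_def bij_betw_def intro: inj_on_subset)
qed

text \<open>The hypotheses concern the inverse \<open>Q\<close>, so that laws have to be verified
  only in the direction in which the 2-functor is easy to define. The laws of \<open>P\<close>
  follow by applying \<open>Q\<close>, which is injective on 1-cells and 2-cells. The further
  conclusions record what bijectivity on hom-categories yields for \<open>P\<close>, in the form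
  needed to build an equivalence from it.\<close>

lemma two_isomorphismI:
  assumes Q: "two_functor B A Q"
    and bij_ob: "bij_betw (tf_ob Q) (Ob B) (Ob A)"
    and bij_1: "\<And>X Y. \<lbrakk>X \<in> Ob B; Y \<in> Ob B\<rbrakk> \<Longrightarrow> bij_betw (on_obj (tf_hom Q X Y))
      (Obj (HomCat B X Y)) (Obj (HomCat A (tf_ob Q X) (tf_ob Q Y)))"
    and bij_2: "\<And>X Y. \<lbrakk>X \<in> Ob B; Y \<in> Ob B\<rbrakk> \<Longrightarrow> bij_betw (on_arr (tf_hom Q X Y))
      (Arr (HomCat B X Y)) (Arr (HomCat A (tf_ob Q X) (tf_ob Q Y)))"
  obtains P where "two_isomorphism A B P" "\<And>X. X \<in> Ob B \<Longrightarrow> tf_ob P (tf_ob Q X) = X"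
    and "\<And>X Y. \<lbrakk>X \<in> Ob A; Y \<in> Ob A\<rbrakk> \<Longrightarrow>
      full_functor (HomCat A X Y) (HomCat B (tf_ob P X) (tf_ob P Y)) (tf_hom P X Y)
      \<and> faithful_functor (HomCat A X Y) (tf_hom P X Y)
      \<and> on_obj (tf_hom P X Y) ` Obj (HomCat A X Y) = Obj (HomCat B (tf_ob P X) (tf_ob P Y))"
proof -
  interpret Q: two_functor B A Q by fact
  define p where "p = restrict (inv_into (Ob B) (tf_ob Q)) (Ob A)"
  define P where "P = \<lparr> tf_ob = p, tf_hom = (\<lambda>X Y. if X \<in> Ob A \<and> Y \<in> Ob A
    then inv_fnctr (HomCat B (p X) (p Y)) (HomCat A X Y) (tf_hom Q (p X) (p Y)) else undefined) \<rparr>"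
  have p: "p X \<in> Ob B" "tf_ob Q (p X) = X" if "X \<in> Ob A" for X
    using bij_ob that by (auto simp: p_def bij_betw_def f_inv_into_f inv_into_into)
  have p_Q: "p (tf_ob Q X) = X" if "X \<in> Ob B" for X
    using bij_ob that by (auto simp: p_def Q.tf_ob_in bij_betw_def)
  have ob: "tf_ob P = p" and hom: "\<And>X Y. \<lbrakk>X \<in> Ob A; Y \<in> Ob A\<rbrakk>
      \<Longrightarrow> tf_hom P X Y = inv_fnctr (HomCat B (p X) (p Y)) (HomCat A X Y) (tf_hom Q (p X) (p Y))"
    by (auto simp: P_def)
  have bij: "cat_functor (HomCat B (p X) (p Y)) (HomCat A X Y) (tf_hom Q (p X) (p Y))"
    "bij_betw (on_obj (tf_hom Q (p X) (p Y))) (Obj (HomCat B (p X) (p Y))) (Obj (HomCat A X Y))"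
    "bij_betw (on_arr (tf_hom Q (p X) (p Y))) (Arr (HomCat B (p X) (p Y))) (Arr (HomCat A X Y))"
    if "X \<in> Ob A" "Y \<in> Ob A" for X Y
    using bij_1[of "p X" "p Y"] bij_2[of "p X" "p Y"] Q.tf_hom_functor[of "p X" "p Y"] that
    by (auto simp: p)
  note inv = inv_fnctr_simps[OF bij(2,3)]
  \<comment> \<open>Equations between cells of \<open>B\<close> are tested after applying
    \<open>Q\<close>; this is how the laws of \<open>P\<close> reduce to those of
    \<open>Q\<close>.\<close>
  have eq1: "f = g" if "on_obj (tf_hom Q (p X) (p Y)) f = on_obj (tf_hom Q (p X) (p Y)) g"
    "f \<in> Obj (HomCat B (p X) (p Y))" "g \<in> Obj (HomCat B (p X) (p Y))" "X \<in> Ob A" "Y \<in> Ob A" for f g X Y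
    using bij(2)[OF that(4,5)] that by (auto simp: bij_betw_def inj_on_def)
  have eq2: "f = g" if "on_arr (tf_hom Q (p X) (p Y)) f = on_arr (tf_hom Q (p X) (p Y)) g"
    "f \<in> Arr (HomCat B (p X) (p Y))" "g \<in> Arr (HomCat B (p X) (p Y))" "X \<in> Ob A" "Y \<in> Ob A" for f g X Y
    using bij(3)[OF that(4,5)] that by (auto simp: bij_betw_def inj_on_def)
  have P: "two_functor A B P"
  proof (rule two_functor.intro[OF Q.target.two_category_axioms Q.source.two_category_axioms
      two_functor_axioms.intro])
    show "cat_functor (HomCat A X Y) (HomCat B (tf_ob P X) (tf_ob P Y)) (tf_hom P X Y)"
      if "X \<in> Ob A" "Y \<in> Ob A" for X Y
      using that by (simp add: ob hom inv_fnctr_functor bij)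
    show "on_obj (tf_hom P X X) (Id1 A X) = Id1 B (tf_ob P X)" if "X \<in> Ob A" for X
      by (rule eq1[of X X])
         (use that Q.target.id1_in Q.source.id1_in in \<open>simp_all add: ob hom inv p Q.tf_id1\<close>)
    show "on_obj (tf_hom P X Z) (on_obj (HComp A X Y Z) (g, f))
        = on_obj (HComp B (tf_ob P X) (tf_ob P Y) (tf_ob P Z))
            (on_obj (tf_hom P Y Z) g, on_obj (tf_hom P X Y) f)"
      if "X \<in> Ob A" "Y \<in> Ob A" "Z \<in> Ob A" "f \<in> Obj (HomCat A X Y)" "g \<in> Obj (HomCat A Y Z)"
          for X Y Z f g
      by (rule eq1[of X Z]) (use that in \<open>simp_all add: ob hom inv p Q.tf_hcomp_1\<close>)
    show "on_arr (tf_hom P X Z) (on_arr (HComp A X Y Z) (g, f))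
        = on_arr (HComp B (tf_ob P X) (tf_ob P Y) (tf_ob P Z))
            (on_arr (tf_hom P Y Z) g, on_arr (tf_hom P X Y) f)"
      if "X \<in> Ob A" "Y \<in> Ob A" "Z \<in> Ob A" "f \<in> Arr (HomCat A X Y)" "g \<in> Arr (HomCat A Y Z)"
          for X Y Z f g
      by (rule eq2[of X Z]) (use that in \<open>simp_all add: ob hom inv p Q.tf_hcomp_2\<close>)
    show "tf_ob P X \<in> Ob B" if "X \<in> Ob A" for X
      using that by (simp add: ob p)
  qed (auto simp: P_def p_def)
  show thesis
  proof
    show "two_isomorphism A B P"
      unfolding two_isomorphism_def
    proof (intro conjI exI)
      show "comp_twofnctr A Q P = id_twofnctr A"
        by (rule twofnctr.equality)
           (auto simp: comp_twofnctr_def id_twofnctr_def ob hom p inv_fnctr_comp bij fun_eq_iff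
               compose_def)
      \<comment> \<open>For the composite that starts from \<open>B\<close>, the preimage chosen for
        \<open>tf_ob Q X\<close> is \<open>X\<close> itself, so on homs \<open>P\<close> is the
        inverse of \<open>tf_hom Q X Y\<close>.\<close>
      have "comp_fnctr (HomCat B X Y) (inv_fnctr (HomCat B X Y) (HomCat A (tf_ob Q X) (tf_ob Q Y))
          (tf_hom Q X Y))
          (tf_hom Q X Y) = id_fnctr (HomCat B X Y)" if "X \<in> Ob B" "Y \<in> Ob B" for X Y
        by (rule inv_fnctr_comp[OF Q.tf_hom_functor bij_1 bij_2]) (use that in auto)
      then show "comp_twofnctr B P Q = id_twofnctr B"
        by (intro twofnctr.equality)
           (auto simp: comp_twofnctr_def id_twofnctr_def ob hom p_Q Q.tf_ob_in fun_eq_iff compose_def)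
    qed (fact P Q)+
    show "tf_ob P (tf_ob Q X) = X" if "X \<in> Ob B" for X
      using that by (simp add: ob p_Q)
    fix X Y assume *: "X \<in> Ob A" "Y \<in> Ob A"
    let ?F = "tf_hom P X Y" and ?C = "HomCat A X Y" and ?D = "HomCat B (p X) (p Y)"
    have F: "?F = inv_fnctr ?D ?C (tf_hom Q (p X) (p Y))" using * by (simp add: hom)
    have "bij_betw (on_obj ?F) (Obj ?C) (Obj ?D)" "bij_betw (on_arr ?F) (Arr ?C) (Arr ?D)"
      unfolding F inv_fnctr_def using bij(2,3)[OF *] by (auto simp: bij_betw_inv_into)
    then show "full_functor (HomCat A X Y) (HomCat B (tf_ob P X) (tf_ob P Y)) (tf_hom P X Y)
      \<and> faithful_functor (HomCat A X Y) (tf_hom P X Y)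
      \<and> on_obj (tf_hom P X Y) ` Obj (HomCat A X Y) = Obj (HomCat B (tf_ob P X) (tf_ob P Y))"
      using bij_functor_full_faithful[of ?C ?D ?F] two_functor.tf_hom_functor[OF P *]
      by (auto simp: ob bij_betw_def)
  qed
qed


section \<open>The 2-category of comprehension categories\<close>

sublocale comprehension_category \<subseteq> base: category "Base K"
  by (rule base_category)

sublocale comprehension_category \<subseteq> proj: fibration "Total K" "Base K" "Proj K"
  by (rule proj_fibration)

sublocale comprehension_category \<subseteq> compr: cat_functor "Total K" "arrow_cat (Base K)" "Compr K"
  by (rule compr_functor)

context comprehension_category
begin

lemma compr_obj [simp]:
  assumes "A \<in> Obj (Total K)"
  shows "on_obj (Compr K) A \<in> Arr (Base K)" "Cod (Base K) (on_obj (Compr K) A) = on_obj (Proj K) A"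
proof -
  show A: "on_obj (Compr K) A \<in> Arr (Base K)" using compr.on_obj_in[OF assms] by simp
  show "Cod (Base K) (on_obj (Compr K) A) = on_obj (Proj K) A"
    unfolding cod_compr[symmetric] using A assms by simp
qed

lemma compr_arr [simp]:
  assumes "f \<in> Arr (Total K)"
  shows "on_arr (Compr K) f \<in> squares (Base K)"
    "sq_src (on_arr (Compr K) f) = on_obj (Compr K) (Dom (Total K) f)"
    "sq_tgt (on_arr (Compr K) f) = on_obj (Compr K) (Cod (Total K) f)"
    "sq_cod (on_arr (Compr K) f) = on_arr (Proj K) f"
proof -
  show f: "on_arr (Compr K) f \<in> squares (Base K)" using compr.on_arr_arr(1)[OF assms] by simp
  show "sq_src (on_arr (Compr K) f) = on_obj (Compr K) (Dom (Total K) f)"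
    "sq_tgt (on_arr (Compr K) f) = on_obj (Compr K) (Cod (Total K) f)"
    using compr.on_arr_arr(2,3)[OF assms] f by simp_all
  show "sq_cod (on_arr (Compr K) f) = on_arr (Proj K) f"
    unfolding cod_compr[symmetric] using f assms by simp
qed

lemma compr_dom [simp]:
  assumes "f \<in> Arr (Total K)"
  shows "sq_dom (on_arr (Compr K) f) \<in> Arr (Base K)"
    "Dom (Base K) (sq_dom (on_arr (Compr K) f)) = Dom (Base K) (on_obj (Compr K) (Dom (Total K) f))"
    "Cod (Base K) (sq_dom (on_arr (Compr K) f)) = Dom (Base K) (on_obj (Compr K) (Cod (Total K) f))"
  using square_arrD[OF compr_arr(1)[OF assms]] assms by simp_all

end

section \<open>Pseudo maps, strict maps and their composition\<close>

sublocale pseudo_map \<subseteq> base: cat_functor "Base K" "Base L" "pm_base m"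
  by (rule pm_base_functor)

sublocale pseudo_map \<subseteq> total: cat_functor "Total K" "Total L" "pm_total m"
  by (rule pm_total_functor)

context pseudo_map
begin

lemma over_obj [simp]: "A \<in> Obj (Total K)
    \<Longrightarrow> on_obj (Proj L) (on_obj (pm_total m) A) = on_obj (pm_base m) (on_obj (Proj K) A)"
  using arg_cong[OF pm_over, of "\<lambda>F. on_obj F A"] by simp

lemma over_arr [simp]: "f \<in> Arr (Total K)
    \<Longrightarrow> on_arr (Proj L) (on_arr (pm_total m) f) = on_arr (pm_base m) (on_arr (Proj K) f)"
  using arg_cong[OF pm_over, of "\<lambda>F. on_arr F f"] by simp

lemma iso_square [simp]:
  assumes "A \<in> Obj (Total K)"
  shows "pm_iso m A \<in> squares (Base L)"
    "sq_src (pm_iso m A) = on_obj (Compr L) (on_obj (pm_total m) A)"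
    "sq_tgt (pm_iso m A) = on_arr (pm_base m) (on_obj (Compr K) A)"
    "sq_cod (pm_iso m A) = Ide (Base L) (on_obj (pm_base m) (on_obj (Proj K) A))"
proof -
  interpret nat_trans "Total K" "arrow_cat (Base L)" "comp_fnctr (Total K) (Compr L) (pm_total m)"
    "comp_fnctr (Total K) (arrow_functor (Base K) (pm_base m)) (Compr K)" "pm_iso m"
    using pm_nat_iso by (simp add: nat_iso_def)
  show "pm_iso m A \<in> squares (Base L)"
    using component_arr(1)[OF assms] by simp
  then show "sq_src (pm_iso m A) = on_obj (Compr L) (on_obj (pm_total m) A)"
    "sq_tgt (pm_iso m A) = on_arr (pm_base m) (on_obj (Compr K) A)"
    using component_arr(2,3)[OF assms] assms by simp_all
qed (use assms pm_iso_over in simp)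

lemma iso_dom [simp]:
  assumes "A \<in> Obj (Total K)"
  shows "sq_dom (pm_iso m A) \<in> Arr (Base L)"
    "Dom (Base L) (sq_dom (pm_iso m A)) = Dom (Base L) (on_obj (Compr L) (on_obj (pm_total m) A))"
    "Cod (Base L) (sq_dom (pm_iso m A)) = on_obj (pm_base m) (Dom (Base K) (on_obj (Compr K) A))"
  using square_arrD[OF iso_square(1)[OF assms]] assms by simp_all

text \<open>Of the naturality equation of the comparison isomorphism, which is an equation of
  squares, the domain components are kept. The codomain components carry no further information,
  since the isomorphism lies over the identity.\<close>

lemma iso_natural:
  assumes "f \<in> Arr (Total K)"
  shows "sq_dom (pm_iso m (Cod (Total K) f)) \<cdot>\<^bsub>Base L\<^esub> sq_dom (on_arr (Compr L) (on_arr (pm_total m) f))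
    = on_arr (pm_base m) (sq_dom (on_arr (Compr K) f)) \<cdot>\<^bsub>Base L\<^esub> sq_dom (pm_iso m (Dom (Total K) f))"
proof -
  interpret nat_trans "Total K" "arrow_cat (Base L)" "comp_fnctr (Total K) (Compr L) (pm_total m)"
    "comp_fnctr (Total K) (arrow_functor (Base K) (pm_base m)) (Compr K)" "pm_iso m"
    using pm_nat_iso by (simp add: nat_iso_def)
  show ?thesis
    using natural[OF assms] assms by (simp add: base.map_square_squares square.map_sel)
qed

lemma iso_iso: "A \<in> Obj (Total K) \<Longrightarrow> iso_arr (arrow_cat (Base L)) (pm_iso m A)"
  using pm_nat_iso by (simp add: nat_iso_def)

lemma iso_dom_iso: "A \<in> Obj (Total K) \<Longrightarrow> iso_arr (Base L) (sq_dom (pm_iso m A))"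
  using iso_iso[of A] inverse_squares(1)[OF target.base_category] by (auto simp: iso_arr_def)

lemma iso_ext: "pm_iso m \<in> extensional (Obj (Total K))"
  using pm_nat_iso by (simp add: nat_iso_def nat_trans_def nat_trans_axioms_def)

end

text \<open>Source, target and codomain component of each comparison square are prescribed, so
  naturality and invertibility have to be shown for domain components only. The codomain part of
  naturality is the strict commutation with the projections.\<close>

lemma pseudo_mapI:
  assumes "comprehension_category K" "comprehension_category L"
    and "cat_functor (Base K) (Base L) (pm_base m)" "cat_functor (Total K) (Total L) (pm_total m)"
    and over: "\<And>A. A \<in> Obj (Total K)
      \<Longrightarrow> on_obj (Proj L) (on_obj (pm_total m) A) = on_obj (pm_base m) (on_obj (Proj K) A)"
      "\<And>f. f \<in> Arr (Total K)
      \<Longrightarrow> on_arr (Proj L) (on_arr (pm_total m) f) = on_arr (pm_base m) (on_arr (Proj K) f)"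
    and cart: "\<And>g. cartesian (Total K) (Base K) (Proj K) g
      \<Longrightarrow> cartesian (Total L) (Base L) (Proj L) (on_arr (pm_total m) g)"
    and iso: "\<And>A. A \<in> Obj (Total K) \<Longrightarrow> pm_iso m A \<in> squares (Base L)
      \<and> sq_src (pm_iso m A) = on_obj (Compr L) (on_obj (pm_total m) A)
      \<and> sq_tgt (pm_iso m A) = on_arr (pm_base m) (on_obj (Compr K) A)
      \<and> sq_cod (pm_iso m A) = Ide (Base L) (on_obj (pm_base m) (on_obj (Proj K) A))
      \<and> iso_arr (Base L) (sq_dom (pm_iso m A))"
    and natural: "\<And>f. f \<in> Arr (Total K) \<Longrightarrow>
      sq_dom (pm_iso m (Cod (Total K) f)) \<cdot>\<^bsub>Base L\<^esub> sq_dom (on_arr (Compr L) (on_arr (pm_total m) f))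
      = on_arr (pm_base m) (sq_dom (on_arr (Compr K) f)) \<cdot>\<^bsub>Base L\<^esub> sq_dom (pm_iso m (Dom (Total K) f))"
    and ext: "pm_iso m \<in> extensional (Obj (Total K))"
  shows "pseudo_map K L m"
proof -
  interpret K: comprehension_category K by fact
  interpret L: comprehension_category L by fact
  interpret base: cat_functor "Base K" "Base L" "pm_base m" by fact
  interpret total: cat_functor "Total K" "Total L" "pm_total m" by fact
  let ?F = "comp_fnctr (Total K) (Compr L) (pm_total m)"
    and ?G = "comp_fnctr (Total K) (arrow_functor (Base K) (pm_base m)) (Compr K)"
  have "nat_trans (Total K) (arrow_cat (Base L)) ?F ?G (pm_iso m)"
  proof (rule nat_transI)
    fix f assume f: "f \<in> Arr (Total K)"
    show "pm_iso m (Cod (Total K) f) \<cdot>\<^bsub>arrow_cat (Base L)\<^esub> on_arr ?F f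
      = on_arr ?G f \<cdot>\<^bsub>arrow_cat (Base L)\<^esub> pm_iso m (Dom (Total K) f)"
      using f by (simp add: iso base.map_square_squares square.map_sel natural over)
  qed (auto simp: iso ext cat_functor_comp[OF assms(4) L.compr_functor]
      cat_functor_comp[OF K.compr_functor arrow_functor_functor[OF assms(3)]])
  moreover have "iso_arr (arrow_cat (Base L)) (pm_iso m A)" if A: "A \<in> Obj (Total K)" for A
  proof -
    \<comment> \<open>The inverse square pairs the inverse of the domain component with an identity
      in the base.\<close>
    obtain u where "inverse_arrs (Base L) (sq_dom (pm_iso m A)) u"
      using iso[OF A] by (auto simp: iso_arr_def)
    then show ?thesis
      using iso[OF A] inverse_squaresI[OF L.base_category, of "pm_iso m A" u]
        L.base.inverse_arrs_ide[of "on_obj (pm_base m) (on_obj (Proj K) A)"] A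
      by (auto simp: iso_arr_def)
  qed
  ultimately have "nat_iso (Total K) (arrow_cat (Base L)) ?F ?G (pm_iso m)"
    by (simp add: nat_iso_def)
  moreover have "comp_fnctr (Total K) (Proj L) (pm_total m) = comp_fnctr (Total K) (pm_base m) (Proj K)"
    by (rule fnctr_eqI[OF cat_functor_comp[OF assms(4) L.proj.cat_functor_axioms]
          cat_functor_comp[OF K.proj.cat_functor_axioms assms(3)]]) (simp_all add: over)
  ultimately show ?thesis
    using assms(1-4) cart iso by (intro pseudo_map.intro pseudo_map_axioms.intro) auto
qed

text \<open>A comparison square is determined by its domain component: its source and target come
  from the functors, and its codomain component is an identity.\<close>

lemma pmap_eqI:
  assumes "pseudo_map K L m" "pseudo_map K L n" "pm_base m = pm_base n" "pm_total m = pm_total n"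
    and "\<And>A. A \<in> Obj (Total K) \<Longrightarrow> sq_dom (pm_iso m A) = sq_dom (pm_iso n A)"
  shows "m = n"
proof -
  interpret m: pseudo_map K L m by fact
  interpret n: pseudo_map K L n by fact
  have "pm_iso m = pm_iso n"
    by (rule extensionalityI[OF m.iso_ext n.iso_ext]) (simp add: square.expand assms)
  then show ?thesis using assms by simp
qed

text \<open>Equality of the two composite functors on arrows is forced by the conditions on objects:
  naturality of the comparison, with identity domain components, identifies the domain parts, and
  the codomain parts agree because everything lies over the base functor.\<close>

lemma strict_map_iff:
  "strict_map K L m \<longleftrightarrow> pseudo_map K L m \<and> (\<forall>A \<in> Obj (Total K).
     on_obj (Compr L) (on_obj (pm_total m) A) = on_arr (pm_base m) (on_obj (Compr K) A)
     \<and> sq_dom (pm_iso m A) = Ide (Base L) (Dom (Base L) (on_obj (Compr L) (on_obj (pm_total m) A))))"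
  (is "?l \<longleftrightarrow> _ \<and> ?r")
proof (cases "pseudo_map K L m")
  case True
  then interpret pseudo_map K L m .
  let ?F = "comp_fnctr (Total K) (Compr L) (pm_total m)"
    and ?G = "comp_fnctr (Total K) (arrow_functor (Base K) (pm_base m)) (Compr K)"
  show ?thesis
  proof
    assume l: ?l
    then have eq: "?F = ?G" and iso: "pm_iso m
        = (\<lambda>A\<in>Obj (Total K). Ide (arrow_cat (Base L)) (on_obj (Compr L) (on_obj (pm_total m) A)))"
      by (simp_all add: strict_map_def)
    have "on_obj (Compr L) (on_obj (pm_total m) A) = on_arr (pm_base m) (on_obj (Compr K) A)"
      if "A \<in> Obj (Total K)" for A
      using that arg_cong[OF eq, of "\<lambda>F. on_obj F A"] by simp
    then show "pseudo_map K L m \<and> ?r"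
      using True by (auto simp: iso)
  next
    assume r: "pseudo_map K L m \<and> ?r"
    have "?F = ?G"
    proof (rule fnctr_eqI[OF cat_functor_comp[OF pm_total_functor target.compr_functor]
          cat_functor_comp[OF source.compr_functor arrow_functor_functor[OF pm_base_functor]]])
      fix f assume "f \<in> Arr (Total K)"
      then show "on_arr ?F f = on_arr ?G f"
        using iso_natural[of f] r
        by (simp add: square.expand square.map_sel)
    qed (use r in simp)
    moreover have "pm_iso m A = Ide (arrow_cat (Base L)) (on_obj (Compr L) (on_obj (pm_total m) A))"
      if "A \<in> Obj (Total K)" for A
      using r that by (simp add: square.expand)
    ultimately show ?l
      using True iso_ext by (auto simp: strict_map_def intro!: extensionalityI[of _ "Obj (Total K)"])
  qed
qed (simp add: strict_map_def)

lemma pm_id_simps [simp]: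
  "pm_base (pm_id K) = id_fnctr (Base K)" "pm_total (pm_id K) = id_fnctr (Total K)"
  by (simp_all add: pm_id_def)

lemma pm_id_pseudo:
  assumes "comprehension_category K"
  shows "pseudo_map K K (pm_id K)"
    and "A \<in> Obj (Total K) \<Longrightarrow> sq_dom (pm_iso (pm_id K) A)
        = Ide (Base K) (Dom (Base K) (on_obj (Compr K) A))"
proof -
  interpret K: comprehension_category K by fact
  have iso: "pm_iso (pm_id K) A = Ide (arrow_cat (Base K)) (on_obj (Compr K) A)"
    if "A \<in> Obj (Total K)" for A
    using that by (simp add: pm_id_def)
  show "A \<in> Obj (Total K) \<Longrightarrow> sq_dom (pm_iso (pm_id K) A)
      = Ide (Base K) (Dom (Base K) (on_obj (Compr K) A))"
    by (simp add: iso)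
  show "pseudo_map K K (pm_id K)"
  proof (rule pseudo_mapI)
    fix A assume A: "A \<in> Obj (Total K)"
    have "Ide (arrow_cat (Base K)) (on_obj (Compr K) A) \<in> squares (Base K)"
      using K.compr.target.ide_arr(1)[of "on_obj (Compr K) A"] A by simp
    then show "pm_iso (pm_id K) A \<in> squares (Base K)
      \<and> sq_src (pm_iso (pm_id K) A) = on_obj (Compr K) (on_obj (pm_total (pm_id K)) A)
      \<and> sq_tgt (pm_iso (pm_id K) A) = on_arr (pm_base (pm_id K)) (on_obj (Compr K) A)
      \<and> sq_cod (pm_iso (pm_id K) A) = Ide (Base K) (on_obj (pm_base (pm_id K)) (on_obj (Proj K) A))
      \<and> iso_arr (Base K) (sq_dom (pm_iso (pm_id K) A))"
      using A by (simp add: iso K.base.iso_arr_ide)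
  qed (auto simp: assms iso K.base_category K.proj.source.category_axioms cartesian_def pm_id_def)
qed

lemma pm_comp_simps [simp]:
  "pm_base (pm_comp K L M n m) = comp_fnctr (Base K) (pm_base n) (pm_base m)"
  "pm_total (pm_comp K L M n m) = comp_fnctr (Total K) (pm_total n) (pm_total m)"
  by (simp_all add: pm_comp_def)

text \<open>Naturality of the pasted comparison uses that of \<open>n\<close> at the arrow
  \<open>m f\<close> and then the image under \<open>n\<close> of that of \<open>m\<close> at
  \<open>f\<close>. The inverses of the domain components compose in the opposite order.\<close>

lemma pm_comp_pseudo:
  assumes "pseudo_map K L m" "pseudo_map L M n"
  shows "pseudo_map K M (pm_comp K L M n m)"
    and "A \<in> Obj (Total K) \<Longrightarrow> sq_dom (pm_iso (pm_comp K L M n m) A)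
      = on_arr (pm_base n) (sq_dom (pm_iso m A)) \<cdot>\<^bsub>Base M\<^esub> sq_dom (pm_iso n (on_obj (pm_total m) A))"
proof -
  interpret m: pseudo_map K L m by fact
  interpret n: pseudo_map L M n by fact
  have iso: "pm_iso (pm_comp K L M n m) A
    = map_square (on_arr (pm_base n)) (pm_iso m A) \<cdot>\<^bsub>arrow_cat (Base M)\<^esub> pm_iso n (on_obj (pm_total m) A)"
    if "A \<in> Obj (Total K)" for A
    using that by (simp add: pm_comp_def)
  have src: "map_square (on_arr (pm_base n)) (pm_iso m A) \<in> squares (Base M)"
    "sq_src (map_square (on_arr (pm_base n)) (pm_iso m A)) = sq_tgt (pm_iso n (on_obj (pm_total m) A))"
    if "A \<in> Obj (Total K)" for A
    using that by (simp_all add: n.base.map_square_squares square.map_sel)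
  have dom: "sq_dom (pm_iso (pm_comp K L M n m) A)
      = on_arr (pm_base n) (sq_dom (pm_iso m A)) \<cdot>\<^bsub>Base M\<^esub> sq_dom (pm_iso n (on_obj (pm_total m) A))"
    if "A \<in> Obj (Total K)" for A
    using that by (simp add: iso src square.map_sel)
  then show "A \<in> Obj (Total K) \<Longrightarrow> sq_dom (pm_iso (pm_comp K L M n m) A)
      = on_arr (pm_base n) (sq_dom (pm_iso m A)) \<cdot>\<^bsub>Base M\<^esub> sq_dom (pm_iso n (on_obj (pm_total m) A))" .
  show "pseudo_map K M (pm_comp K L M n m)"
  proof (rule pseudo_mapI)
    fix A assume A: "A \<in> Obj (Total K)"
    have "pm_iso (pm_comp K L M n m) A \<in> squares (Base M)"
      using A n.target.compr.target.comp_arr(1)[of "pm_iso n (on_obj (pm_total m) A)"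
          "map_square (on_arr (pm_base n)) (pm_iso m A)"]
      by (simp add: iso src del: arrow_cat_simps(6))
    moreover obtain u v where "inverse_arrs (Base L) (sq_dom (pm_iso m A)) u"
      "inverse_arrs (Base M) (sq_dom (pm_iso n (on_obj (pm_total m) A))) v"
      using m.iso_dom_iso[OF A] n.iso_dom_iso[of "on_obj (pm_total m) A"] A by (auto simp: iso_arr_def)
    then have "inverse_arrs (Base M) (sq_dom (pm_iso (pm_comp K L M n m) A))
        (v \<cdot>\<^bsub>Base M\<^esub> on_arr (pm_base n) u)"
      using A by (simp add: dom n.target.base.inverse_arrs_comp n.base.inverse_arrs_on_arr)
    ultimately show "pm_iso (pm_comp K L M n m) A \<in> squares (Base M)
      \<and> sq_src (pm_iso (pm_comp K L M n m) A)
          = on_obj (Compr M) (on_obj (pm_total (pm_comp K L M n m)) A)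
      \<and> sq_tgt (pm_iso (pm_comp K L M n m) A)
          = on_arr (pm_base (pm_comp K L M n m)) (on_obj (Compr K) A)
      \<and> sq_cod (pm_iso (pm_comp K L M n m) A)
        = Ide (Base M) (on_obj (pm_base (pm_comp K L M n m)) (on_obj (Proj K) A))
      \<and> iso_arr (Base M) (sq_dom (pm_iso (pm_comp K L M n m) A))"
      using A by (auto simp: iso src square.map_sel iso_arr_def)
  next
    fix f assume f: "f \<in> Arr (Total K)"
    let ?X = "Dom (Total K) f" and ?Y = "Cod (Total K) f"
    let ?N = "on_arr (pm_base n)"
    let ?\<phi> = "\<lambda>A. sq_dom (pm_iso m A)" and ?\<psi> = "\<lambda>A. sq_dom (pm_iso n (on_obj (pm_total m) A))"
    have "(?N (?\<phi> ?Y) \<cdot>\<^bsub>Base M\<^esub> ?\<psi> ?Y)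
        \<cdot>\<^bsub>Base M\<^esub> sq_dom (on_arr (Compr M) (on_arr (pm_total n) (on_arr (pm_total m) f)))
      = ?N (?\<phi> ?Y) \<cdot>\<^bsub>Base M\<^esub> (?N (sq_dom (on_arr (Compr L) (on_arr (pm_total m) f))) \<cdot>\<^bsub>Base M\<^esub> ?\<psi> ?X)"
      using f n.iso_natural[of "on_arr (pm_total m) f"] by (simp add: n.target.base.assoc)
    also have "\<dots> = ?N (?\<phi> ?Y \<cdot>\<^bsub>Base L\<^esub> sq_dom (on_arr (Compr L) (on_arr (pm_total m) f))) \<cdot>\<^bsub>Base M\<^esub> ?\<psi> ?X"
      using f by (simp add: n.target.base.assoc)
    also have "\<dots> = ?N (on_arr (pm_base m) (sq_dom (on_arr (Compr K) f))) \<cdot>\<^bsub>Base M\<^esub> (?N (?\<phi> ?X)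
        \<cdot>\<^bsub>Base M\<^esub> ?\<psi> ?X)"
      using f by (simp only: m.iso_natural) (simp add: n.target.base.assoc)
    finally show "sq_dom (pm_iso (pm_comp K L M n m) ?Y)
        \<cdot>\<^bsub>Base M\<^esub> sq_dom (on_arr (Compr M) (on_arr (pm_total (pm_comp K L M n m)) f))
      = on_arr (pm_base (pm_comp K L M n m)) (sq_dom (on_arr (Compr K) f))
        \<cdot>\<^bsub>Base M\<^esub> sq_dom (pm_iso (pm_comp K L M n m) ?X)"
      using f by (simp add: dom)
  next
    fix g assume g: "cartesian (Total K) (Base K) (Proj K) g"
    then have "g \<in> Arr (Total K)" by (simp add: cartesian_def)
    with g show "cartesian (Total M) (Base M) (Proj M) (on_arr (pm_total (pm_comp K L M n m)) g)"
      by (simp add: m.pm_cartesian n.pm_cartesian)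
  qed (auto simp: m.source.comprehension_category_axioms n.target.comprehension_category_axioms
      cat_functor_comp[OF m.pm_base_functor n.pm_base_functor]
      cat_functor_comp[OF m.pm_total_functor n.pm_total_functor], auto simp: pm_comp_def)
qed

lemma strict_map_id:
  assumes "comprehension_category K"
  shows "strict_map K K (pm_id K)"
proof -
  interpret comprehension_category K by fact
  show ?thesis
    using assms by (simp add: strict_map_iff pm_id_pseudo)
qed

lemma strict_map_comp:
  assumes "strict_map K L m" "strict_map L M n"
  shows "strict_map K M (pm_comp K L M n m)"
proof -
  interpret m: pseudo_map K L m using assms by (simp add: strict_map_iff)
  interpret n: pseudo_map L M n using assms by (simp add: strict_map_iff)
  have "Dom (Base L) (on_arr (pm_base m) (on_obj (Compr K) A))
      = on_obj (pm_base m) (Dom (Base K) (on_obj (Compr K) A))"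
    if "A \<in> Obj (Total K)" for A using that by simp
  then show ?thesis
    using assms by (simp add: strict_map_iff pm_comp_pseudo)
qed

text \<open>Both sides have the same functors by strict associativity of composition, and the domain
  components of their comparisons are the same threefold composite up to rebracketing in the
  base.\<close>

lemma pm_comp_assoc:
  assumes "pseudo_map J K l" "pseudo_map K L m" "pseudo_map L M n"
  shows "pm_comp J K M (pm_comp K L M n m) l = pm_comp J L M n (pm_comp J K L m l)"
proof -
  interpret l: pseudo_map J K l by fact
  interpret m: pseudo_map K L m by fact
  interpret n: pseudo_map L M n by fact
  show ?thesis
    by (rule pmap_eqI[of J M])
       (simp_all add: assms pm_comp_pseudo n.target.base.assoc comp_fnctr_assoc[OF l.pm_base_functor]
          comp_fnctr_assoc[OF l.pm_total_functor])
qed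

lemma pm_comp_id:
  assumes "pseudo_map K L m"
  shows "pm_comp K L L (pm_id L) m = m" "pm_comp K K L m (pm_id K) = m"
proof -
  interpret m: pseudo_map K L m by fact
  note id = pm_id_pseudo[OF m.source.comprehension_category_axioms]
    pm_id_pseudo[OF m.target.comprehension_category_axioms]
  show "pm_comp K L L (pm_id L) m = m"
    by (rule pmap_eqI[of K L])
       (simp_all add: assms id pm_comp_pseudo comp_fnctr_id[OF m.pm_base_functor]
          comp_fnctr_id[OF m.pm_total_functor])
  show "pm_comp K K L m (pm_id K) = m"
    by (rule pmap_eqI[of K L])
       (simp_all add: assms id pm_comp_pseudo comp_fnctr_id[OF m.pm_base_functor]
          comp_fnctr_id[OF m.pm_total_functor])
qed

section \<open>Transformations and the 2-category structure\<close>

sublocale cc_transformation \<subseteq> base: nat_trans "Base K" "Base L" "pm_base (ct_src t)"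
    "pm_base (ct_tgt t)" "ct_base t"
  by (rule ct_base_nt)

sublocale cc_transformation \<subseteq> total: nat_trans "Total K" "Total L" "pm_total (ct_src t)"
    "pm_total (ct_tgt t)" "ct_total t"
  by (rule ct_total_nt)

lemma cc_transformationI:
  assumes "pseudo_map K L (ct_src t)" "pseudo_map K L (ct_tgt t)"
    and "nat_trans (Base K) (Base L) (pm_base (ct_src t)) (pm_base (ct_tgt t)) (ct_base t)"
    and "nat_trans (Total K) (Total L) (pm_total (ct_src t)) (pm_total (ct_tgt t)) (ct_total t)"
    and "\<And>A. A \<in> Obj (Total K) \<Longrightarrow> on_arr (Proj L) (ct_total t A) = ct_base t (on_obj (Proj K) A)"
    and "\<And>A. A \<in> Obj (Total K)
      \<Longrightarrow> sq_dom (pm_iso (ct_tgt t) A) \<cdot>\<^bsub>Base L\<^esub> sq_dom (on_arr (Compr L) (ct_total t A))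
        = ct_base t (Dom (Base K) (on_obj (Compr K) A)) \<cdot>\<^bsub>Base L\<^esub> sq_dom (pm_iso (ct_src t) A)"
  shows "cc_transformation K L t"
  using assms by (simp add: cc_transformation_def cc_transformation_axioms_def ext_ctx_def)

lemma (in cc_transformation) compat: "A \<in> Obj (Total K)
      \<Longrightarrow> sq_dom (pm_iso (ct_tgt t) A) \<cdot>\<^bsub>Base L\<^esub> sq_dom (on_arr (Compr L) (ct_total t A))
        = ct_base t (Dom (Base K) (on_obj (Compr K) A)) \<cdot>\<^bsub>Base L\<^esub> sq_dom (pm_iso (ct_src t) A)"
  using ct_compat by (simp add: ext_ctx_def)

lemma compcat_hom_simps [simp]:
  "m \<in> Obj (compcat_hom K L) \<longleftrightarrow> pseudo_map K L m"
  "t \<in> Arr (compcat_hom K L) \<longleftrightarrow> cc_transformation K L t"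
  "cc_transformation K L t \<Longrightarrow> Dom (compcat_hom K L) t = ct_src t"
  "cc_transformation K L t \<Longrightarrow> Cod (compcat_hom K L) t = ct_tgt t"
  "pseudo_map K L m \<Longrightarrow> Ide (compcat_hom K L) m = \<lparr> ct_src = m, ct_tgt = m,
     ct_base = id_nt (Base K) (Base L) (pm_base m), ct_total = id_nt (Total K) (Total L) (pm_total m) \<rparr>"
  "\<lbrakk>cc_transformation K L s; cc_transformation K L t; ct_src s = ct_tgt t\<rbrakk>
   \<Longrightarrow> s \<cdot>\<^bsub>compcat_hom K L\<^esub> t = \<lparr> ct_src = ct_src t, ct_tgt = ct_tgt s,
         ct_base = vcomp_nt (Base K) (Base L) (ct_base s) (ct_base t),
         ct_total = vcomp_nt (Total K) (Total L) (ct_total s) (ct_total t) \<rparr>"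
  by (simp_all add: compcat_hom_def)

lemma cc_transformation_id:
  assumes "pseudo_map K L m"
  shows "cc_transformation K L (Ide (compcat_hom K L) m)"
proof -
  interpret m: pseudo_map K L m by fact
  show ?thesis
    by (rule cc_transformationI)
       (simp_all add: assms nat_trans_id m.pm_base_functor m.pm_total_functor)
qed

text \<open>Comprehension turns a composite of total components into the composite of their domain
  parts, after which compatibility of \<open>s\<close> and then of \<open>t\<close> applies.\<close>

lemma cc_transformation_vcomp:
  assumes "cc_transformation K L t" "cc_transformation K L s" "ct_src s = ct_tgt t"
  shows "cc_transformation K L (s \<cdot>\<^bsub>compcat_hom K L\<^esub> t)"
proof -
  interpret t: cc_transformation K L t by fact
  interpret s: cc_transformation K L s by fact
  note [simp] = assms(3)
  show ?thesis
  proof (rule cc_transformationI)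
    fix A assume A: "A \<in> Obj (Total K)"
    let ?d = "\<lambda>k. sq_dom (on_arr (Compr L) k)" and ?X = "Dom (Base K) (on_obj (Compr K) A)"
    have "sq_dom (pm_iso (ct_tgt s) A) \<cdot>\<^bsub>Base L\<^esub> (?d (ct_total s A) \<cdot>\<^bsub>Base L\<^esub> ?d (ct_total t A))
      = (sq_dom (pm_iso (ct_tgt s) A) \<cdot>\<^bsub>Base L\<^esub> ?d (ct_total s A)) \<cdot>\<^bsub>Base L\<^esub> ?d (ct_total t A)"
      using A by (simp add: t.source.target.base.assoc)
    also have "\<dots> = ct_base s ?X \<cdot>\<^bsub>Base L\<^esub> (sq_dom (pm_iso (ct_tgt t) A) \<cdot>\<^bsub>Base L\<^esub> ?d (ct_total t A))"
      using A by (simp only: s.compat) (simp add: t.source.target.base.assoc)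
    also have "\<dots> = (ct_base s ?X \<cdot>\<^bsub>Base L\<^esub> ct_base t ?X) \<cdot>\<^bsub>Base L\<^esub> sq_dom (pm_iso (ct_src t) A)"
      using A by (simp only: t.compat) (simp add: t.source.target.base.assoc)
    finally show "sq_dom (pm_iso (ct_tgt (s \<cdot>\<^bsub>compcat_hom K L\<^esub> t)) A)
        \<cdot>\<^bsub>Base L\<^esub> sq_dom (on_arr (Compr L) (ct_total (s \<cdot>\<^bsub>compcat_hom K L\<^esub> t) A))
      = ct_base (s \<cdot>\<^bsub>compcat_hom K L\<^esub> t) ?X \<cdot>\<^bsub>Base L\<^esub> sq_dom (pm_iso (ct_src (s \<cdot>\<^bsub>compcat_hom K L\<^esub> t)) A)"
      using A assms by (simp add: vcomp_nt_def)
  qed (use assms nat_trans_vcomp[OF t.ct_base_nt] nat_trans_vcomp[OF t.ct_total_nt] s.ct_base_nt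
      s.ct_total_nt t.source.pseudo_map_axioms s.target.pseudo_map_axioms
      in \<open>simp_all add: vcomp_nt_def t.ct_over s.ct_over\<close>)
qed

lemma compcat_hom_category:
  assumes "comprehension_category K" "comprehension_category L"
  shows "category (compcat_hom K L)"
proof (rule categoryI)
  fix t assume "t \<in> Arr (compcat_hom K L)"
  then interpret t: cc_transformation K L t by simp
  show "Dom (compcat_hom K L) t \<in> Obj (compcat_hom K L)"
      "Cod (compcat_hom K L) t \<in> Obj (compcat_hom K L)"
    by (simp_all add: t.source.pseudo_map_axioms t.target.pseudo_map_axioms t.cc_transformation_axioms)
  show "Ide (compcat_hom K L) (Cod (compcat_hom K L) t) \<cdot>\<^bsub>compcat_hom K L\<^esub> t = t"
    "t \<cdot>\<^bsub>compcat_hom K L\<^esub> Ide (compcat_hom K L) (Dom (compcat_hom K L) t) = t"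
    using cc_transformation_id[OF t.source.pseudo_map_axioms] cc_transformation_id[OF
        t.target.pseudo_map_axioms]
    by (simp_all add: t.source.pseudo_map_axioms t.target.pseudo_map_axioms
        t.cc_transformation_axioms vcomp_id[OF t.ct_base_nt] vcomp_id[OF t.ct_total_nt])
next
  fix r s t assume *: "r \<in> Arr (compcat_hom K L)" "s \<in> Arr (compcat_hom K L)"
      "t \<in> Arr (compcat_hom K L)"
    "Dom (compcat_hom K L) s = Cod (compcat_hom K L) r"
        "Dom (compcat_hom K L) t = Cod (compcat_hom K L) s"
  then interpret r: cc_transformation K L r + s: cc_transformation K L s + t: cc_transformation K L t
    by simp_all
  have "vcomp_nt (Base K) (Base L) (vcomp_nt (Base K) (Base L) (ct_base t) (ct_base s)) (ct_base r)
      = vcomp_nt (Base K) (Base L) (ct_base t) (vcomp_nt (Base K) (Base L) (ct_base s) (ct_base r))"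
    by (rule vcomp_assoc[OF r.ct_base_nt]) (use * s.ct_base_nt t.ct_base_nt in simp_all)
  moreover
  have "vcomp_nt (Total K) (Total L) (vcomp_nt (Total K) (Total L) (ct_total t) (ct_total s))
      (ct_total r)
      = vcomp_nt (Total K) (Total L) (ct_total t) (vcomp_nt (Total K) (Total L) (ct_total s)
          (ct_total r))"
    by (rule vcomp_assoc[OF r.ct_total_nt]) (use * s.ct_total_nt t.ct_total_nt in simp_all)
  ultimately show "(t \<cdot>\<^bsub>compcat_hom K L\<^esub> s) \<cdot>\<^bsub>compcat_hom K L\<^esub> r
      = t \<cdot>\<^bsub>compcat_hom K L\<^esub> (s \<cdot>\<^bsub>compcat_hom K L\<^esub> r)"
    using * cc_transformation_vcomp[of K L r s] cc_transformation_vcomp[of K L s t] by simp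
next
  fix t s assume *: "t \<in> Arr (compcat_hom K L)" "s \<in> Arr (compcat_hom K L)"
    "Dom (compcat_hom K L) s = Cod (compcat_hom K L) t"
  then show "s \<cdot>\<^bsub>compcat_hom K L\<^esub> t \<in> Arr (compcat_hom K L)
      \<and> Dom (compcat_hom K L) (s \<cdot>\<^bsub>compcat_hom K L\<^esub> t) = Dom (compcat_hom K L) t
      \<and> Cod (compcat_hom K L) (s \<cdot>\<^bsub>compcat_hom K L\<^esub> t) = Cod (compcat_hom K L) s"
    using cc_transformation_vcomp[of K L t s] by simp
next
  fix m assume "m \<in> Obj (compcat_hom K L)"
  then show "Ide (compcat_hom K L) m \<in> Arr (compcat_hom K L)
      \<and> Dom (compcat_hom K L) (Ide (compcat_hom K L) m) = m
      \<and> Cod (compcat_hom K L) (Ide (compcat_hom K L) m) = m"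
    using cc_transformation_id[of K L m] by simp
qed (auto simp: compcat_hom_def)

text \<open>The 2-cell assigned by \<open>HComp CompCat\<close>, named so that it stays folded
  during simplification until its components are needed.\<close>

definition cc_hcomp where
  "cc_hcomp K L M s t =
    \<lparr> ct_src = pm_comp K L M (ct_src s) (ct_src t),
      ct_tgt = pm_comp K L M (ct_tgt s) (ct_tgt t),
      ct_base = hcomp_nt (Base K) (Base M) (pm_base (ct_src s)) (pm_base (ct_tgt t)) (ct_base s)
          (ct_base t),
      ct_total = hcomp_nt (Total K) (Total M) (pm_total (ct_src s)) (pm_total (ct_tgt t))
        (ct_total s) (ct_total t) \<rparr>"

lemma CompCat_simps [simp]:
  "K \<in> Ob CompCat \<longleftrightarrow> comprehension_category K"
  "HomCat CompCat = compcat_hom" "Id1 CompCat = pm_id"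
  "\<lbrakk>pseudo_map L M n; pseudo_map K L m\<rbrakk> \<Longrightarrow> on_obj (HComp CompCat K L M) (n, m) = pm_comp K L M n m"
  "\<lbrakk>cc_transformation L M s; cc_transformation K L t\<rbrakk>
   \<Longrightarrow> on_arr (HComp CompCat K L M) (s, t) = cc_hcomp K L M s t"
  by (simp_all add: CompCat_def cc_hcomp_def)

text \<open>Four facts combine in the compatibility condition: compatibility of \<open>s\<close> at
  the object \<open>?mA'\<close>, naturality of the comparison of \<open>ct_src s\<close> at the
  arrow \<open>ct_total t A\<close>, naturality of \<open>ct_base s\<close> at the comparison arrow
  \<open>?\<phi>'\<close>, and compatibility of \<open>t\<close> carried through the base functor of
  \<open>ct_src s\<close>.\<close>

lemma cc_transformation_hcomp:
  assumes "cc_transformation K L t" "cc_transformation L M s"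
  shows "cc_transformation K M (cc_hcomp K L M s t)"
proof -
  interpret t: cc_transformation K L t by fact
  interpret s: cc_transformation L M s by fact
  have src: "pseudo_map K M (pm_comp K L M (ct_src s) (ct_src t))"
    and tgt: "pseudo_map K M (pm_comp K L M (ct_tgt s) (ct_tgt t))"
    by (simp_all add: pm_comp_pseudo t.source.pseudo_map_axioms t.target.pseudo_map_axioms
        s.source.pseudo_map_axioms s.target.pseudo_map_axioms)
  show ?thesis
  proof (rule cc_transformationI)
    fix A assume A: "A \<in> Obj (Total K)"
    let ?mA = "on_obj (pm_total (ct_src t)) A" and ?mA' = "on_obj (pm_total (ct_tgt t)) A"
    let ?\<phi> = "sq_dom (pm_iso (ct_src t) A)" and ?\<phi>' = "sq_dom (pm_iso (ct_tgt t) A)"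
    let ?\<psi> = "sq_dom (pm_iso (ct_src s) ?mA)" and ?\<psi>' = "sq_dom (pm_iso (ct_tgt s) ?mA')"
    let ?\<psi>'' = "sq_dom (pm_iso (ct_src s) ?mA')"
    let ?N = "on_arr (pm_base (ct_src s))" and ?N' = "on_arr (pm_base (ct_tgt s))"
    let ?nt = "sq_dom (on_arr (Compr M) (on_arr (pm_total (ct_src s)) (ct_total t A)))"
    let ?s = "sq_dom (on_arr (Compr M) (ct_total s ?mA'))"
    let ?t = "sq_dom (on_arr (Compr L) (ct_total t A))"
    let ?X = "Dom (Base K) (on_obj (Compr K) A)"
    let ?\<beta> = "ct_base s (Dom (Base L) (on_obj (Compr L) ?mA'))"
    let ?\<beta>X = "ct_base s (on_obj (pm_base (ct_tgt t)) ?X)"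
    have "(?N' ?\<phi>' \<cdot>\<^bsub>Base M\<^esub> ?\<psi>') \<cdot>\<^bsub>Base M\<^esub> (?s \<cdot>\<^bsub>Base M\<^esub> ?nt)
      = ?N' ?\<phi>' \<cdot>\<^bsub>Base M\<^esub> ((?\<psi>' \<cdot>\<^bsub>Base M\<^esub> ?s) \<cdot>\<^bsub>Base M\<^esub> ?nt)"
      using A by (simp add: s.source.target.base.assoc)
    also have "\<dots> = ?N' ?\<phi>' \<cdot>\<^bsub>Base M\<^esub> (?\<beta> \<cdot>\<^bsub>Base M\<^esub> (?\<psi>'' \<cdot>\<^bsub>Base M\<^esub> ?nt))"
      using A by (subst s.compat) (simp_all add: s.source.target.base.assoc)
    also have "?\<psi>'' \<cdot>\<^bsub>Base M\<^esub> ?nt = ?N ?t \<cdot>\<^bsub>Base M\<^esub> ?\<psi>"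
      using A s.source.iso_natural[of "ct_total t A"] by simp
    also have "?N' ?\<phi>' \<cdot>\<^bsub>Base M\<^esub> (?\<beta> \<cdot>\<^bsub>Base M\<^esub> (?N ?t \<cdot>\<^bsub>Base M\<^esub> ?\<psi>))
      = (?N' ?\<phi>' \<cdot>\<^bsub>Base M\<^esub> ?\<beta>) \<cdot>\<^bsub>Base M\<^esub> (?N ?t \<cdot>\<^bsub>Base M\<^esub> ?\<psi>)"
      using A by (simp add: s.source.target.base.assoc)
    also have "?N' ?\<phi>' \<cdot>\<^bsub>Base M\<^esub> ?\<beta> = ?\<beta>X \<cdot>\<^bsub>Base M\<^esub> ?N ?\<phi>'"
      using A s.base.natural[of ?\<phi>'] by simp
    also have "(?\<beta>X \<cdot>\<^bsub>Base M\<^esub> ?N ?\<phi>') \<cdot>\<^bsub>Base M\<^esub> (?N ?t \<cdot>\<^bsub>Base M\<^esub> ?\<psi>)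
      = ?\<beta>X \<cdot>\<^bsub>Base M\<^esub> (?N (?\<phi>' \<cdot>\<^bsub>Base L\<^esub> ?t) \<cdot>\<^bsub>Base M\<^esub> ?\<psi>)"
      using A by (simp add: s.source.target.base.assoc)
    also have "\<dots> = (?\<beta>X \<cdot>\<^bsub>Base M\<^esub> ?N (ct_base t ?X)) \<cdot>\<^bsub>Base M\<^esub> (?N ?\<phi> \<cdot>\<^bsub>Base M\<^esub> ?\<psi>)"
      using A by (simp only: t.compat) (simp add: s.source.target.base.assoc)
    finally show "sq_dom (pm_iso (ct_tgt (cc_hcomp K L M s t)) A)
        \<cdot>\<^bsub>Base M\<^esub> sq_dom (on_arr (Compr M) (ct_total (cc_hcomp K L M s t) A))
      = ct_base (cc_hcomp K L M s t) ?X \<cdot>\<^bsub>Base M\<^esub> sq_dom (pm_iso (ct_src (cc_hcomp K L M s t)) A)"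
      using A by (simp add: cc_hcomp_def hcomp_nt_def pm_comp_pseudo(2) t.source.pseudo_map_axioms
          t.target.pseudo_map_axioms s.source.pseudo_map_axioms s.target.pseudo_map_axioms)
  qed (simp_all add: cc_hcomp_def src tgt nat_trans_hcomp[OF t.ct_base_nt s.ct_base_nt]
      nat_trans_hcomp[OF t.ct_total_nt s.ct_total_nt],
      simp add: hcomp_nt_def t.ct_over s.ct_over)
qed

lemma two_category_CompCat:
  "two_category (CompCat :: (('o, 'a, 'to, 'ta) compcat, ('o, 'a, 'to, 'ta) pmap,
      ('o, 'a, 'to, 'ta) cctrans) twocat)"
proof (rule two_category.intro)
  fix K L :: "('o, 'a, 'to, 'ta) compcat" assume "K \<in> Ob CompCat" "L \<in> Ob CompCat"
  then show "category (HomCat CompCat K L)" by (simp add: compcat_hom_category)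
next
  fix K :: "('o, 'a, 'to, 'ta) compcat" assume "K \<in> Ob CompCat"
  then show "Id1 CompCat K \<in> Obj (HomCat CompCat K K)" by (simp add: pm_id_pseudo)
next
  fix K L M :: "('o, 'a, 'to, 'ta) compcat"
  assume *: "K \<in> Ob CompCat" "L \<in> Ob CompCat" "M \<in> Ob CompCat"
  show "cat_functor (prod_cat (HomCat CompCat L M) (HomCat CompCat K L)) (HomCat CompCat K M)
      (HComp CompCat K L M)"
  proof (rule prod_cat_functorI)
    fix s t assume "s \<in> Arr (HomCat CompCat L M)" "t \<in> Arr (HomCat CompCat K L)"
    then interpret s: cc_transformation L M s + t: cc_transformation K L t by simp_all
    show "on_arr (HComp CompCat K L M) (s, t) \<in> Arr (HomCat CompCat K M)
      \<and> Dom (HomCat CompCat K M) (on_arr (HComp CompCat K L M) (s, t))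
        = on_obj (HComp CompCat K L M) (Dom (HomCat CompCat L M) s, Dom (HomCat CompCat K L) t)
      \<and> Cod (HomCat CompCat K M) (on_arr (HComp CompCat K L M) (s, t))
        = on_obj (HComp CompCat K L M) (Cod (HomCat CompCat L M) s, Cod (HomCat CompCat K L) t)"
      using cc_transformation_hcomp[OF t.cc_transformation_axioms s.cc_transformation_axioms]
      by (simp add: s.cc_transformation_axioms t.cc_transformation_axioms
          t.source.pseudo_map_axioms t.target.pseudo_map_axioms
          s.source.pseudo_map_axioms s.target.pseudo_map_axioms, simp add: cc_hcomp_def)
  next
    fix n m assume "n \<in> Obj (HomCat CompCat L M)" "m \<in> Obj (HomCat CompCat K L)"
    then interpret n: pseudo_map L M n + m: pseudo_map K L m by simp_all
    note ax = n.pseudo_map_axioms m.pseudo_map_axioms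
    show "on_obj (HComp CompCat K L M) (n, m) \<in> Obj (HomCat CompCat K M)"
      by (simp add: ax pm_comp_pseudo)
    show "on_arr (HComp CompCat K L M) (Ide (HomCat CompCat L M) n, Ide (HomCat CompCat K L) m)
        = Ide (HomCat CompCat K M) (on_obj (HComp CompCat K L M) (n, m))"
      using cc_transformation_id[OF ax(1)] cc_transformation_id[OF ax(2)]
      by (simp add: ax pm_comp_pseudo cc_hcomp_def hcomp_id_nt[OF m.pm_base_functor n.pm_base_functor]
          hcomp_id_nt[OF m.pm_total_functor n.pm_total_functor])
  next
    fix s t s' t' assume **: "s \<in> Arr (HomCat CompCat L M)" "t \<in> Arr (HomCat CompCat K L)"
      "s' \<in> Arr (HomCat CompCat L M)" "t' \<in> Arr (HomCat CompCat K L)"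
      "Dom (HomCat CompCat L M) s' = Cod (HomCat CompCat L M) s"
      "Dom (HomCat CompCat K L) t' = Cod (HomCat CompCat K L) t"
    then interpret s: cc_transformation L M s + t: cc_transformation K L t
      + s': cc_transformation L M s' + t': cc_transformation K L t' by simp_all
    have eq: "ct_src s' = ct_tgt s" "ct_src t' = ct_tgt t" using ** by simp_all
    note interchange[OF t.ct_base_nt t'.ct_base_nt[unfolded eq] s.ct_base_nt s'.ct_base_nt[unfolded eq]]
    moreover note interchange[OF t.ct_total_nt t'.ct_total_nt[unfolded eq] s.ct_total_nt
        s'.ct_total_nt[unfolded eq]]
    moreover have "ct_src (cc_hcomp K L M s' t') = ct_tgt (cc_hcomp K L M s t)"
      by (simp add: cc_hcomp_def eq)
    \<comment> \<open>The rule unfolding vertical composites is withheld, since otherwise the goal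
      would no longer match the closure rule.\<close>
    moreover have "cc_transformation L M (s' \<cdot>\<^bsub>compcat_hom L M\<^esub> s)"
        "cc_transformation K L (t' \<cdot>\<^bsub>compcat_hom K L\<^esub> t)"
      using ** eq by (auto intro: cc_transformation_vcomp simp del: compcat_hom_simps(6))
    \<comment> \<open>At first only composites in the hom-category from \<open>K\<close> to
      \<open>M\<close> are unfolded, because \<open>HComp\<close> is evaluated at arguments that are
      recognizable as transformations. The resulting records are then compared by the interchange
      law.\<close>
    ultimately show "on_arr (HComp CompCat K L M) (s' \<cdot>\<^bsub>HomCat CompCat L M\<^esub> s, t' \<cdot>\<^bsub>HomCat CompCat K L\<^esub> t)
      = on_arr (HComp CompCat K L M) (s', t') \<cdot>\<^bsub>HomCat CompCat K M\<^esub> on_arr (HComp CompCat K L M) (s, t)"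
      using ** cc_transformation_hcomp[of K L t M s] cc_transformation_hcomp[of K L t' M s']
      by (simp del: compcat_hom_simps(6) add: compcat_hom_simps(6)[of K M]) (simp add: cc_hcomp_def eq)
  qed (use * in \<open>simp_all add: compcat_hom_category\<close>, auto simp: CompCat_def)
next
  fix J K L M :: "('o, 'a, 'to, 'ta) compcat" and l m n
  assume "l \<in> Obj (HomCat CompCat J K)" "m \<in> Obj (HomCat CompCat K L)" "n \<in> Obj (HomCat CompCat L M)"
  then show "on_obj (HComp CompCat J K M) (on_obj (HComp CompCat K L M) (n, m), l)
      = on_obj (HComp CompCat J L M) (n, on_obj (HComp CompCat J K L) (m, l))"
    by (simp add: pm_comp_pseudo pm_comp_assoc)
next
  fix J K L M :: "('o, 'a, 'to, 'ta) compcat" and r s t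
  assume *: "r \<in> Arr (HomCat CompCat J K)" "s \<in> Arr (HomCat CompCat K L)" "t \<in> Arr (HomCat CompCat L M)"
  then interpret r: cc_transformation J K r + s: cc_transformation K L s + t: cc_transformation L M t
    by simp_all
  show "on_arr (HComp CompCat J K M) (on_arr (HComp CompCat K L M) (t, s), r)
      = on_arr (HComp CompCat J L M) (t, on_arr (HComp CompCat J K L) (s, r))"
    using * cc_transformation_hcomp[of J K r L s] cc_transformation_hcomp[of K L s M t]
    by (simp, simp add: cc_hcomp_def pm_comp_assoc r.source.pseudo_map_axioms r.target.pseudo_map_axioms
        s.source.pseudo_map_axioms s.target.pseudo_map_axioms t.source.pseudo_map_axioms
        t.target.pseudo_map_axioms hcomp_assoc[OF r.ct_base_nt s.ct_base_nt t.ct_base_nt]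
        hcomp_assoc[OF r.ct_total_nt s.ct_total_nt t.ct_total_nt])
next
  fix K L :: "('o, 'a, 'to, 'ta) compcat" and m
  assume "K \<in> Ob CompCat" "L \<in> Ob CompCat" "m \<in> Obj (HomCat CompCat K L)"
  then show "on_obj (HComp CompCat K L L) (Id1 CompCat L, m) = m
      \<and> on_obj (HComp CompCat K K L) (m, Id1 CompCat K) = m"
    by (simp add: pm_id_pseudo pm_comp_id)
next
  fix K L :: "('o, 'a, 'to, 'ta) compcat" and t
  assume *: "K \<in> Ob CompCat" "L \<in> Ob CompCat" "t \<in> Arr (HomCat CompCat K L)"
  then interpret t: cc_transformation K L t by simp
  show "on_arr (HComp CompCat K L L) (Ide (HomCat CompCat L L) (Id1 CompCat L), t) = t
      \<and> on_arr (HComp CompCat K K L) (t, Ide (HomCat CompCat K K) (Id1 CompCat K)) = t"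
    using * cc_transformation_id[OF pm_id_pseudo(1)[of K]] cc_transformation_id[OF
        pm_id_pseudo(1)[of L]]
    by (simp add: pm_id_pseudo, simp add: cc_hcomp_def pm_comp_id t.source.pseudo_map_axioms
        t.target.pseudo_map_axioms hcomp_unit[OF t.ct_base_nt] hcomp_unit[OF t.ct_total_nt])
qed


section \<open>Pullback squares and display maps\<close>

lemma pullback_squareD:
  assumes "pullback_square C s" "category C"
    and "x \<in> Arr C" "y \<in> Arr C" "Dom C x = Dom C y"
    and "Cod C x = Dom C (sq_tgt s)" "Cod C y = Cod C (sq_src s)" "sq_tgt s \<cdot>\<^bsub>C\<^esub> x = sq_cod s \<cdot>\<^bsub>C\<^esub> y"
  obtains z where "z \<in> Arr C" "Dom C z = Dom C x" "Cod C z = Dom C (sq_src s)"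
    "sq_dom s \<cdot>\<^bsub>C\<^esub> z = x" "sq_src s \<cdot>\<^bsub>C\<^esub> z = y"
proof -
  have "\<exists>!z. z \<in> homset C (Dom C x) (Dom C (sq_src s)) \<and> sq_dom s \<cdot>\<^bsub>C\<^esub> z = x \<and> sq_src s \<cdot>\<^bsub>C\<^esub> z = y"
    using assms by (auto simp: pullback_square_def)
  then show thesis using that by (auto simp: homset_iff)
qed

text \<open>The two legs of a pullback are jointly monic: both arrows factor the cone that
  \<open>z\<close> itself induces.\<close>

lemma pullback_square_unique:
  assumes s: "pullback_square C s" and "category C"
    and z: "z \<in> Arr C" "z' \<in> Arr C" "Dom C z = Dom C z'" "Cod C z = Dom C (sq_src s)"
        "Cod C z' = Dom C (sq_src s)"
    and eq: "sq_dom s \<cdot>\<^bsub>C\<^esub> z = sq_dom s \<cdot>\<^bsub>C\<^esub> z'" "sq_src s \<cdot>\<^bsub>C\<^esub> z = sq_src s \<cdot>\<^bsub>C\<^esub> z'"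
  shows "z = z'"
proof -
  interpret C: category C by fact
  have sq: "s \<in> squares C" using s by (simp add: pullback_square_def)
  note [simp] = square_arrD[OF sq]
  let ?x = "sq_dom s \<cdot>\<^bsub>C\<^esub> z" and ?y = "sq_src s \<cdot>\<^bsub>C\<^esub> z"
  have "sq_tgt s \<cdot>\<^bsub>C\<^esub> ?x = sq_cod s \<cdot>\<^bsub>C\<^esub> ?y"
    using z square_commutes[OF sq] by (simp flip: C.assoc)
  then have "\<exists>!z. z \<in> homset C (Dom C ?x) (Dom C (sq_src s)) \<and> sq_dom s \<cdot>\<^bsub>C\<^esub> z = ?x \<and> sq_src s \<cdot>\<^bsub>C\<^esub> z = ?y"
    using s[unfolded pullback_square_def, THEN conjunct2, rule_format, of ?x ?y] z by simp
  then show ?thesis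
    using z eq by (auto simp: homset_iff)
qed

text \<open>Unique existence is split into existence and joint monicity of the legs, which can be
  transported separately.\<close>

lemma pullback_squareI:
  assumes "s \<in> squares C"
    and "\<And>x y. \<lbrakk>x \<in> Arr C; y \<in> Arr C; Dom C x = Dom C y; Cod C x = Dom C (sq_tgt s);
        Cod C y = Cod C (sq_src s); sq_tgt s \<cdot>\<^bsub>C\<^esub> x = sq_cod s \<cdot>\<^bsub>C\<^esub> y\<rbrakk>
      \<Longrightarrow> \<exists>z \<in> Arr C. Dom C z = Dom C x \<and> Cod C z = Dom C (sq_src s)
            \<and> sq_dom s \<cdot>\<^bsub>C\<^esub> z = x \<and> sq_src s \<cdot>\<^bsub>C\<^esub> z = y"
    and "\<And>z z'. \<lbrakk>z \<in> Arr C; z' \<in> Arr C; Dom C z = Dom C z'; Cod C z = Dom C (sq_src s);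
        Cod C z' = Dom C (sq_src s); sq_dom s \<cdot>\<^bsub>C\<^esub> z = sq_dom s \<cdot>\<^bsub>C\<^esub> z';
        sq_src s \<cdot>\<^bsub>C\<^esub> z = sq_src s \<cdot>\<^bsub>C\<^esub> z'\<rbrakk> \<Longrightarrow> z = z'"
  shows "pullback_square C s"
  unfolding pullback_square_def
proof (intro conjI ballI impI)
  fix x y assume "x \<in> Arr C" "y \<in> Arr C" "Dom C x = Dom C y \<and> Cod C x = Dom C (sq_tgt s)
    \<and> Cod C y = Cod C (sq_src s) \<and> sq_tgt s \<cdot>\<^bsub>C\<^esub> x = sq_cod s \<cdot>\<^bsub>C\<^esub> y"
  then obtain z where z: "z \<in> Arr C" "Dom C z = Dom C x" "Cod C z = Dom C (sq_src s)"
    "sq_dom s \<cdot>\<^bsub>C\<^esub> z = x" "sq_src s \<cdot>\<^bsub>C\<^esub> z = y"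
    using assms(2)[of x y] by blast
  show "\<exists>!z. z \<in> homset C (Dom C x) (Dom C (sq_src s)) \<and> sq_dom s \<cdot>\<^bsub>C\<^esub> z = x \<and> sq_src s \<cdot>\<^bsub>C\<^esub> z = y"
  proof (rule ex1I[of _ z])
    fix z' assume "z' \<in> homset C (Dom C x) (Dom C (sq_src s)) \<and> sq_dom s \<cdot>\<^bsub>C\<^esub> z' = x \<and> sq_src s \<cdot>\<^bsub>C\<^esub> z' = y"
    then show "z' = z"
      by - (rule assms(3), simp_all only: z homset_iff)
  qed (simp add: z homset_iff)
qed fact

text \<open>A cone over \<open>t\<close> becomes a cone over \<open>s\<close> by composing one leg
  with \<open>b'\<close>; the factorization found there returns along \<open>a\<close>. This serves
  both to recognize cartesian arrows as pullbacks and to carry pullbacks along a comparison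
  isomorphism.\<close>

lemma pullback_square_transport:
  assumes s: "pullback_square C s" and "category C" and t: "t \<in> squares C" and cod:
      "sq_cod t = sq_cod s"
    and a: "inverse_arrs C a a'" "Dom C a = Dom C (sq_src s)" "Cod C a = Dom C (sq_src t)"
    and b: "inverse_arrs C b b'" "Dom C b = Dom C (sq_tgt s)" "Cod C b = Dom C (sq_tgt t)"
    and src: "sq_src t \<cdot>\<^bsub>C\<^esub> a = sq_src s" and tgt: "sq_tgt t \<cdot>\<^bsub>C\<^esub> b = sq_tgt s"
    and dom: "sq_dom t \<cdot>\<^bsub>C\<^esub> a = b \<cdot>\<^bsub>C\<^esub> sq_dom s"
  shows "pullback_square C t"
proof -
  interpret C: category C by fact
  have sq: "s \<in> squares C" using s by (simp add: pullback_square_def)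
  note [simp] = square_arrD[OF sq] square_arrD[OF t]
  have ab [simp]: "a \<in> Arr C" "a' \<in> Arr C" "b \<in> Arr C" "b' \<in> Arr C"
    "Dom C a' = Dom C (sq_src t)" "Cod C a' = Dom C (sq_src s)"
    "Dom C b' = Dom C (sq_tgt t)" "Cod C b' = Dom C (sq_tgt s)"
    using a b by (auto simp: inverse_arrs_iff)
  have inv: "a' \<cdot>\<^bsub>C\<^esub> a = Ide C (Dom C (sq_src s))" "a \<cdot>\<^bsub>C\<^esub> a' = Ide C (Dom C (sq_src t))"
    "b' \<cdot>\<^bsub>C\<^esub> b = Ide C (Dom C (sq_tgt s))" "b \<cdot>\<^bsub>C\<^esub> b' = Ide C (Dom C (sq_tgt t))"
    using a b by (auto simp: inverse_arrs_iff)
  have cods: "Cod C (sq_src s) = Cod C (sq_src t)" "Cod C (sq_tgt s) = Cod C (sq_tgt t)"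
    using square_arrD[OF sq] square_arrD[OF t] cod by auto
  have cancel: "f \<cdot>\<^bsub>C\<^esub> (f' \<cdot>\<^bsub>C\<^esub> x) = x" if "f \<cdot>\<^bsub>C\<^esub> f' = Ide C (Cod C x)" "f \<in> Arr C" "f' \<in> Arr C" "x \<in> Arr C"
    "Cod C x = Dom C f'" "Cod C f' = Dom C f" for f f' x
    using that by (simp flip: C.assoc)
  have src': "sq_src s \<cdot>\<^bsub>C\<^esub> a' = sq_src t"
    unfolding src[symmetric] using a by (simp add: C.assoc inv)
  have dom': "sq_dom s \<cdot>\<^bsub>C\<^esub> a' = b' \<cdot>\<^bsub>C\<^esub> sq_dom t"
  proof -
    have "sq_dom s \<cdot>\<^bsub>C\<^esub> a' = b' \<cdot>\<^bsub>C\<^esub> ((b \<cdot>\<^bsub>C\<^esub> sq_dom s) \<cdot>\<^bsub>C\<^esub> a')"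
      using b by (simp add: C.assoc cancel inv)
    also have "\<dots> = b' \<cdot>\<^bsub>C\<^esub> sq_dom t"
      unfolding dom[symmetric] using a by (simp add: C.assoc inv)
    finally show ?thesis .
  qed
  have tgt': "sq_tgt s \<cdot>\<^bsub>C\<^esub> b' = sq_tgt t"
    unfolding tgt[symmetric] using b by (simp add: C.assoc inv)
  show ?thesis
  proof (rule pullback_squareI[OF t])
    fix x y assume xy: "x \<in> Arr C" "y \<in> Arr C" "Dom C x = Dom C y" "Cod C x = Dom C (sq_tgt t)"
      "Cod C y = Cod C (sq_src t)" "sq_tgt t \<cdot>\<^bsub>C\<^esub> x = sq_cod t \<cdot>\<^bsub>C\<^esub> y"
    have eq: "sq_tgt s \<cdot>\<^bsub>C\<^esub> (b' \<cdot>\<^bsub>C\<^esub> x) = sq_cod s \<cdot>\<^bsub>C\<^esub> y"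
      using xy tgt' cod by (simp flip: C.assoc)
    obtain z where z: "z \<in> Arr C" "Dom C z = Dom C x" "Cod C z = Dom C (sq_src s)"
      "sq_dom s \<cdot>\<^bsub>C\<^esub> z = b' \<cdot>\<^bsub>C\<^esub> x" "sq_src s \<cdot>\<^bsub>C\<^esub> z = y"
      by (rule pullback_squareD[OF s \<open>category C\<close>, of "b' \<cdot>\<^bsub>C\<^esub> x" y]) (use xy cods eq in auto)
    have "sq_dom t \<cdot>\<^bsub>C\<^esub> (a \<cdot>\<^bsub>C\<^esub> z) = x"
      using z xy a b dom cancel[of b b' x] inv by (simp add: C.assoc flip: C.assoc[of _ a])
    moreover have "sq_src t \<cdot>\<^bsub>C\<^esub> (a \<cdot>\<^bsub>C\<^esub> z) = y"
      using z xy a src by (simp flip: C.assoc)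
    ultimately show "\<exists>z\<in>Arr C. Dom C z = Dom C x \<and> Cod C z = Dom C (sq_src t)
      \<and> sq_dom t \<cdot>\<^bsub>C\<^esub> z = x \<and> sq_src t \<cdot>\<^bsub>C\<^esub> z = y"
      using z xy a by (intro bexI[of _ "a \<cdot>\<^bsub>C\<^esub> z"]) auto
  next
    fix z z' assume z: "z \<in> Arr C" "z' \<in> Arr C" "Dom C z = Dom C z'" "Cod C z = Dom C (sq_src t)"
      "Cod C z' = Dom C (sq_src t)" "sq_dom t \<cdot>\<^bsub>C\<^esub> z = sq_dom t \<cdot>\<^bsub>C\<^esub> z'"
      "sq_src t \<cdot>\<^bsub>C\<^esub> z = sq_src t \<cdot>\<^bsub>C\<^esub> z'"
    \<comment> \<open>Composition with \<open>a'\<close> turns factorizations through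
      \<open>t\<close> into factorizations through \<open>s\<close>, where uniqueness is available;
      \<open>a'\<close> is cancelled at the end.\<close>
    have "sq_dom s \<cdot>\<^bsub>C\<^esub> (a' \<cdot>\<^bsub>C\<^esub> v) = b' \<cdot>\<^bsub>C\<^esub> (sq_dom t \<cdot>\<^bsub>C\<^esub> v)" "sq_src s \<cdot>\<^bsub>C\<^esub> (a' \<cdot>\<^bsub>C\<^esub> v) = sq_src t \<cdot>\<^bsub>C\<^esub> v"
      if "v \<in> Arr C" "Cod C v = Dom C (sq_src t)" for v
      using that src' dom' by (simp_all flip: C.assoc)
    then have "a' \<cdot>\<^bsub>C\<^esub> z = a' \<cdot>\<^bsub>C\<^esub> z'"
      using z by - (rule pullback_square_unique[OF s \<open>category C\<close>], simp_all)
    then show "z = z'"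
      using C.cancel_left_inverse[OF inverse_arrs_sym[OF a(1)], of z z'] z a by simp
  qed
qed

text \<open>Each square factors through the other by its universal property, and the two
  factorizations are mutually inverse by uniqueness. Paired with an identity on codomains they form
  an isomorphism of the arrow category, which is what repleteness of a class of display maps refers
  to.\<close>

lemma pullback_squares_isomorphic:
  assumes s: "pullback_square C s" and t: "pullback_square C t" and "category C"
    and eq: "sq_tgt s = sq_tgt t" "sq_cod s = sq_cod t"
  shows "isomorphic (arrow_cat C) (sq_src s) (sq_src t)"
proof -
  interpret C: category C by fact
  have sq: "s \<in> squares C" "t \<in> squares C" using s t by (simp_all add: pullback_square_def)
  note [simp] = square_arrD[OF sq(1)] square_arrD[OF sq(2)]
  have cods: "Cod C (sq_src s) = Cod C (sq_src t)"
    using square_arrD[OF sq(1)] square_arrD[OF sq(2)] eq by auto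
  obtain u where u: "u \<in> Arr C" "Dom C u = Dom C (sq_src s)" "Cod C u = Dom C (sq_src t)"
    "sq_dom t \<cdot>\<^bsub>C\<^esub> u = sq_dom s" "sq_src t \<cdot>\<^bsub>C\<^esub> u = sq_src s"
    by (rule pullback_squareD[OF t \<open>category C\<close>, of "sq_dom s" "sq_src s"])
       (use square_commutes[OF sq(1)] eq cods in auto)
  obtain v where v: "v \<in> Arr C" "Dom C v = Dom C (sq_src t)" "Cod C v = Dom C (sq_src s)"
    "sq_dom s \<cdot>\<^bsub>C\<^esub> v = sq_dom t" "sq_src s \<cdot>\<^bsub>C\<^esub> v = sq_src t"
    by (rule pullback_squareD[OF s \<open>category C\<close>, of "sq_dom t" "sq_src t"])
       (use square_commutes[OF sq(2)] eq cods in auto)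
  have "v \<cdot>\<^bsub>C\<^esub> u = Ide C (Dom C (sq_src s))"
    by (rule pullback_square_unique[OF s \<open>category C\<close>]) (use u v in \<open>simp_all flip: C.assoc\<close>)
  moreover have "u \<cdot>\<^bsub>C\<^esub> v = Ide C (Dom C (sq_src t))"
    by (rule pullback_square_unique[OF t \<open>category C\<close>]) (use u v in \<open>simp_all flip: C.assoc\<close>)
  ultimately have uv: "inverse_arrs C u v" using u v by (simp add: inverse_arrs_iff)
  define w where "w = Square (sq_src s) (sq_src t) u (Ide C (Cod C (sq_src s)))"
  have w: "w \<in> squares C" using u cods by (simp add: w_def squares_iff)
  have "inverse_arrs (arrow_cat C) w (Square (sq_tgt w) (sq_src w) v (Ide C (Cod C (sq_src s))))"
    by (rule inverse_squaresI[OF \<open>category C\<close> w]) (use uv C.inverse_arrs_ide in \<open>simp_all add: w_def\<close>)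
  then show ?thesis
    using w by (auto simp: isomorphic_def homset_iff iso_arr_def w_def intro!: bexI[of _ w])
qed

text \<open>Fullness determines the arrows, and \<open>subcategory\<close> determines the structure
  maps on the carriers; elsewhere both sides are undefined, so the records are equal. This recovers
  the total category of a replete comprehension category from its objects.\<close>

lemma full_subcat_eqI:
  assumes sub: "subcategory S C" and full: "full_functor S C (incl_fnctr S)"
  shows "full_subcat C (Obj S) = S"
proof -
  interpret S: category S using sub by (simp add: subcategory_def)
  have dom: "Dom S f = Dom C f" "Cod S f = Cod C f" if "f \<in> Arr S" for f
    using sub that by (simp_all add: subcategory_def)
  have "homset S X Y = homset C X Y" if "X \<in> Obj S" "Y \<in> Obj S" for X Y
  proof -
    have "homset S X Y = on_arr (incl_fnctr S) ` homset S X Y" by (force simp: homset_iff image_iff)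
    then show ?thesis using full that by (simp add: full_functor_def)
  qed
  then have arr: "f \<in> Arr S \<longleftrightarrow> f \<in> Arr C \<and> Dom C f \<in> Obj S \<and> Cod C f \<in> Obj S" for f
    by (metis dom S.dom_obj S.cod_obj homset_iff)
  have obj: "Obj C \<inter> Obj S = Obj S" using sub by (auto simp: subcategory_def)
  have comp: "g \<cdot>\<^bsub>S\<^esub> f = (if g \<in> Arr S \<and> f \<in> Arr S \<and> Dom C g = Cod C f then g \<cdot>\<^bsub>C\<^esub> f else undefined)"
      for f g
    using sub S.comp_ext[of g f] dom by (auto simp: subcategory_def)
  have A: "{f \<in> Arr C. Dom C f \<in> Obj S \<and> Cod C f \<in> Obj S} = Arr S" using arr by auto
  have "restrict (Ide C) (Obj S) = Ide S"
    by (rule extensionalityI[OF _ S.ide_ext]) (use sub in \<open>auto simp: subcategory_def\<close>)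
  moreover have "restrict (Dom C) (Arr S) = Dom S"
    by (rule extensionalityI[OF _ S.dom_ext]) (auto simp: dom)
  moreover have "restrict (Cod C) (Arr S) = Cod S"
    by (rule extensionalityI[OF _ S.cod_ext]) (auto simp: dom)
  ultimately show ?thesis
    unfolding full_subcat_def Let_def A obj by (intro cat.equality) (simp_all add: comp fun_eq_iff)
qed

section \<open>Between display map categories and their comprehension categories\<close>

lemma square_full_subcat_iff [simp]:
  "s \<in> Arr (full_subcat (arrow_cat C) D) \<longleftrightarrow> s \<in> squares C \<and> sq_src s \<in> D \<and> sq_tgt s \<in> D"
  by auto

lemma dmc_compcat_simps [simp]:
  "Base (dmc_compcat X) = fst X"
  "Total (dmc_compcat X) = full_subcat (arrow_cat (fst X)) (snd X)"
  "Compr (dmc_compcat X) = incl_fnctr (full_subcat (arrow_cat (fst X)) (snd X))"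
  by (simp_all add: dmc_compcat_def Let_def)

lemma dmc_compcat_Proj [simp]:
  "\<lbrakk>d \<in> Arr (fst X); d \<in> snd X\<rbrakk> \<Longrightarrow> on_obj (Proj (dmc_compcat X)) d = Cod (fst X) d"
  "\<lbrakk>s \<in> squares (fst X); sq_src s \<in> snd X; sq_tgt s \<in> snd X\<rbrakk>
      \<Longrightarrow> on_arr (Proj (dmc_compcat X)) s = sq_cod s"
  by (simp_all add: dmc_compcat_def Let_def)

lemma dmc_compcat_Proj_functor:
  assumes "category (fst X)"
  shows "cat_functor (Total (dmc_compcat X)) (fst X) (Proj (dmc_compcat X))"
  using cat_functor_comp[OF subcategory_incl_functor[OF full_subcat_subcategory[OF
      arrow_cat_category[OF assms]]]
      cod_functor_functor[OF assms]]
  by (simp add: dmc_compcat_def Let_def)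

text \<open>A lifting problem \<open>h\<close>, \<open>w\<close> is a cone over \<open>g\<close>
  with legs \<open>sq_dom h\<close> and \<open>w \<cdot> sq_src h\<close>. The induced arrow becomes
  the domain component of the lift, whose codomain component must be \<open>w\<close>.\<close>

lemma pullback_square_cartesian:
  assumes g: "pullback_square (fst X) g" "sq_src g \<in> snd X" "sq_tgt g \<in> snd X" and X: "category (fst X)"
  shows "cartesian (Total (dmc_compcat X)) (fst X) (Proj (dmc_compcat X)) g"
proof -
  interpret C: category "fst X" by fact
  let ?T = "Total (dmc_compcat X)" and ?p = "Proj (dmc_compcat X)"
  interpret T: category ?T
    using X by (auto intro: full_subcat_category)
  have sq: "g \<in> squares (fst X)" using g by (simp add: pullback_square_def)
  note [simp] = square_arrD[OF sq]
  show ?thesis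
    unfolding cartesian_def
  proof (intro conjI ballI impI)
    show "g \<in> Arr ?T" using sq g by simp
    fix h w assume h: "h \<in> Arr ?T" and w:
        "w \<in> homset (fst X) (on_obj ?p (Dom ?T h)) (on_obj ?p (Dom ?T g))"
      and *: "Cod ?T h = Cod ?T g \<and> on_arr ?p g \<cdot>\<^bsub>fst X\<^esub> w = on_arr ?p h"
    from h have h: "h \<in> squares (fst X)" "sq_src h \<in> snd X" "sq_tgt h \<in> snd X" by auto
    note [simp] = square_arrD[OF h(1)]
    have w: "w \<in> Arr (fst X)" "Dom (fst X) w = Cod (fst X) (sq_src h)"
        "Cod (fst X) w = Cod (fst X) (sq_src g)"
      using w h g sq by (simp_all add: homset_iff)
    have tgt: "sq_tgt h = sq_tgt g" and cod: "sq_cod g \<cdot>\<^bsub>fst X\<^esub> w = sq_cod h"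
      using * h g sq by simp_all
    have "sq_tgt g \<cdot>\<^bsub>fst X\<^esub> sq_dom h = sq_cod g \<cdot>\<^bsub>fst X\<^esub> (w \<cdot>\<^bsub>fst X\<^esub> sq_src h)"
      using w square_commutes[OF h(1)] by (simp add: tgt flip: cod C.assoc)
    with w tgt obtain z where z: "z \<in> Arr (fst X)" "Dom (fst X) z = Dom (fst X) (sq_src h)"
      "Cod (fst X) z = Dom (fst X) (sq_src g)" "sq_dom g \<cdot>\<^bsub>fst X\<^esub> z = sq_dom h"
      "sq_src g \<cdot>\<^bsub>fst X\<^esub> z = w \<cdot>\<^bsub>fst X\<^esub> sq_src h"
      using pullback_squareD[OF g(1) X, of "sq_dom h" "w \<cdot>\<^bsub>fst X\<^esub> sq_src h"]
      by (metis C.comp_arr h(1) square_arrD(1,3,5,6))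
    let ?k = "Square (sq_src h) (sq_src g) z w"
    have k: "?k \<in> squares (fst X)" using z w by (simp add: squares_iff)
    show "\<exists>!k. k \<in> homset ?T (Dom ?T h) (Dom ?T g) \<and> on_arr ?p k = w \<and> g \<cdot>\<^bsub>?T\<^esub> k = h"
    proof (rule ex1I[of _ ?k])
      show "?k \<in> homset ?T (Dom ?T h) (Dom ?T g) \<and> on_arr ?p ?k = w \<and> g \<cdot>\<^bsub>?T\<^esub> ?k = h"
        using k g h sq z tgt cod by (simp add: homset_iff square.expand)
      fix k assume "k \<in> homset ?T (Dom ?T h) (Dom ?T g) \<and> on_arr ?p k = w \<and> g \<cdot>\<^bsub>?T\<^esub> k = h"
      then have kT: "k \<in> Arr ?T" "Dom ?T k = Dom ?T h" "Cod ?T k = Dom ?T g" "on_arr ?p k = w"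
        and gk: "g \<cdot>\<^bsub>?T\<^esub> k = h"
        by (simp_all only: homset_iff)
      have k: "k \<in> squares (fst X)" "sq_src k \<in> snd X" "sq_tgt k \<in> snd X"
        using kT(1) by auto
      then have k': "sq_src k = sq_src h" "sq_tgt k = sq_src g" "sq_cod k = w"
        using kT(2-4) h g sq by simp_all
      have "sq_dom (g \<cdot>\<^bsub>?T\<^esub> k) = sq_dom g \<cdot>\<^bsub>fst X\<^esub> sq_dom k"
        using k k'(2) g sq by simp
      then have kd: "sq_dom g \<cdot>\<^bsub>fst X\<^esub> sq_dom k = sq_dom h"
        by (simp only: gk)
      note [simp] = square_arrD[OF k(1)]
      \<comment> \<open>The domain component of any lift solves the same factorization problem as
        \<open>z\<close>; the other three entries of the square are prescribed.\<close>
      have "sq_dom k = z"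
        by (rule pullback_square_unique[OF g(1) X])
           (use z k' kd square_commutes[OF k(1)] in simp_all)
      then show "k = ?k" using k' by (simp add: square.expand)
    qed
  qed
qed

context display_map_category
begin

abbreviation "T \<equiv> Total (dmc_compcat (C, D))"

abbreviation "p \<equiv> Proj (dmc_compcat (C, D))"

text \<open>The axiom provides some pullback with display source along \<open>sq_cod s\<close>; by
  uniqueness of pullbacks the source of \<open>s\<close> is isomorphic to that source, and
  \<open>D\<close> is replete.\<close>

lemma display_pullback_src:
  assumes "pullback_square C s" "sq_tgt s \<in> D"
  shows "sq_src s \<in> D"
proof -
  have s: "s \<in> squares C" using assms by (simp add: pullback_square_def)
  obtain t where "pullback_square C t" "sq_tgt t = sq_tgt s" "sq_cod t = sq_cod s" "sq_src t \<in> D"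
    using display_pullback[OF assms(2), of "sq_cod s"] square_arrD[OF s] by auto
  then show ?thesis
    using display_replete pullback_squares_isomorphic[of C t s] assms category_axioms by auto
qed

text \<open>Cartesianness only handles squares whose source is a display map, so arbitrary cones
  cannot be tested directly. Instead \<open>g\<close> is compared with a pullback square
  \<open>s\<close> over the same data and with display source; the comparison is invertible and
  transports the universal property.\<close>

lemma cartesian_pullback_square:
  assumes g: "cartesian T C p g"
  shows "pullback_square C g"
proof -
  have sq: "g \<in> squares C" "sq_src g \<in> D" "sq_tgt g \<in> D"
    using g by (auto simp: cartesian_def)
  note [simp] = square_arrD[OF sq(1)]
  obtain s where s: "pullback_square C s" "sq_tgt s = sq_tgt g" "sq_cod s = sq_cod g" "sq_src s \<in> D"
    using display_pullback[OF sq(3), of "sq_cod g"] by auto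
  have sqs: "s \<in> squares C" using s by (simp add: pullback_square_def)
  note sd [simp] = square_arrD[OF sqs]
  have src: "Cod C (sq_src s) = Cod C (sq_src g)"
    using sd(7) s(3) by simp
  \<comment> \<open>Cartesianness is applied over an identity, to squares with the same target and
    codomain component as \<open>g\<close>.\<close>
  have lift: "\<exists>!k. k \<in> homset T (sq_src h) (sq_src g) \<and> on_arr p k = Ide C (Cod C (sq_src g))
      \<and> g \<cdot>\<^bsub>T\<^esub> k = h"
    if h: "h \<in> squares C" "sq_src h \<in> D" "sq_tgt h = sq_tgt g" "sq_cod h = sq_cod g" for h
  proof -
    have "Cod C (sq_src h) = Cod C (sq_src g)"
      using square_arrD(7)[OF h(1)] h(4) by simp
    then have "Ide C (Cod C (sq_src g)) \<in> homset C (on_obj p (Dom T h)) (on_obj p (Dom T g))"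
      using sq h square_arrD(1)[OF h(1)] by (simp add: homset_iff)
    moreover have "Cod T h = Cod T g" "on_arr p g \<cdot>\<^bsub>C\<^esub> Ide C (Cod C (sq_src g)) = on_arr p h"
      "Dom T h = sq_src h" "Dom T g = sq_src g" "h \<in> Arr T"
      using sq h by simp_all
    ultimately show ?thesis using g unfolding cartesian_def by metis
  qed
  obtain k where k: "k \<in> homset T (sq_src s) (sq_src g)" "on_arr p k = Ide C (Cod C (sq_src g))"
      "g \<cdot>\<^bsub>T\<^esub> k = s"
    using lift[of s] s sqs by blast
  have ksq: "k \<in> squares C" "sq_src k \<in> D" "sq_tgt k \<in> D" using k by (auto simp: homset_iff)
  have k': "sq_src k = sq_src s" "sq_tgt k = sq_src g" "sq_cod k = Ide C (Cod C (sq_src g))"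
    using k ksq by (auto simp: homset_iff)
  note kd [simp] = square_arrD[OF ksq(1)]
  have "sq_dom (g \<cdot>\<^bsub>T\<^esub> k) = sq_dom g \<cdot>\<^bsub>C\<^esub> sq_dom k"
    using ksq sq k' by simp
  then have gk: "sq_dom g \<cdot>\<^bsub>C\<^esub> sq_dom k = sq_dom s"
    by (simp only: k(3))
  have srck: "sq_src g \<cdot>\<^bsub>C\<^esub> sq_dom k = sq_src s"
    using square_commutes[OF ksq(1)] k' src by simp
  \<comment> \<open>In the reverse direction the universal property of \<open>s\<close> applies,
    since \<open>g\<close> is itself a commuting square over the same data.\<close>
  obtain z where z: "z \<in> Arr C" "Dom C z = Dom C (sq_src g)" "Cod C z = Dom C (sq_src s)"
    "sq_dom s \<cdot>\<^bsub>C\<^esub> z = sq_dom g" "sq_src s \<cdot>\<^bsub>C\<^esub> z = sq_src g"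
    by (rule pullback_squareD[OF s(1) category_axioms, of "sq_dom g" "sq_src g"])
       (use square_commutes[OF sq(1)] s src in auto)
  have "z \<cdot>\<^bsub>C\<^esub> sq_dom k = Ide C (Dom C (sq_src s))"
    by (rule pullback_square_unique[OF s(1) category_axioms]) (use z k' gk srck
        in \<open>simp_all flip: assoc\<close>)
  moreover have "sq_dom k \<cdot>\<^bsub>C\<^esub> z = Ide C (Dom C (sq_src g))"
  proof -
    have eq: "sq_dom g \<cdot>\<^bsub>C\<^esub> (sq_dom k \<cdot>\<^bsub>C\<^esub> z) = sq_dom g" "sq_src g \<cdot>\<^bsub>C\<^esub> (sq_dom k \<cdot>\<^bsub>C\<^esub> z) = sq_src g"
      using z k' gk srck by (simp_all flip: assoc)
    \<comment> \<open>Uniqueness of lifts is used for the problem of factoring \<open>g\<close>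
      through itself. Both \<open>sq_dom k \<cdot> z\<close> and the identity, completed to squares
      over an identity, solve it.\<close>
    have unique: "l = l'" if "l \<in> homset T (sq_src g) (sq_src g)
        \<and> on_arr p l = Ide C (Cod C (sq_src g)) \<and> g \<cdot>\<^bsub>T\<^esub> l = g"
      "l' \<in> homset T (sq_src g) (sq_src g) \<and> on_arr p l' = Ide C (Cod C (sq_src g)) \<and> g \<cdot>\<^bsub>T\<^esub> l' = g"
          for l l'
      using lift[of g] sq that by blast
    have exists: "Square (sq_src g) (sq_src g) y (Ide C (Cod C (sq_src g))) \<in> homset T (sq_src g)
        (sq_src g)
      \<and> on_arr p (Square (sq_src g) (sq_src g) y (Ide C (Cod C (sq_src g)))) = Ide C (Cod C (sq_src g))
      \<and> g \<cdot>\<^bsub>T\<^esub> Square (sq_src g) (sq_src g) y (Ide C (Cod C (sq_src g))) = g"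
      if "y \<in> Arr C" "Dom C y = Dom C (sq_src g)" "Cod C y = Dom C (sq_src g)"
        "sq_dom g \<cdot>\<^bsub>C\<^esub> y = sq_dom g" "sq_src g \<cdot>\<^bsub>C\<^esub> y = sq_src g" for y
    proof -
      have "Square (sq_src g) (sq_src g) y (Ide C (Cod C (sq_src g))) \<in> squares C"
        using that by (simp add: squares_iff)
      then show ?thesis using sq that by (simp add: homset_iff square.expand)
    qed
    have "Square (sq_src g) (sq_src g) (sq_dom k \<cdot>\<^bsub>C\<^esub> z) (Ide C (Cod C (sq_src g)))
      = Square (sq_src g) (sq_src g) (Ide C (Dom C (sq_src g))) (Ide C (Cod C (sq_src g)))"
      by (rule unique; rule exists) (use z k' eq in simp_all)
    then show ?thesis by simp
  qed
  ultimately have inv: "inverse_arrs C (sq_dom k) z" using z k' by (simp add: inverse_arrs_iff)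
  show ?thesis
  proof (rule pullback_square_transport[OF s(1) category_axioms sq(1) s(3)[symmetric] inv])
    \<comment> \<open>The squares \<open>s\<close> and \<open>g\<close> share their target, so the
      isomorphism on that side is an identity.\<close>
    show "inverse_arrs C (Ide C (Dom C (sq_tgt g))) (Ide C (Dom C (sq_tgt g)))"
      by (simp add: inverse_arrs_ide)
    show "sq_tgt g \<cdot>\<^bsub>C\<^esub> Ide C (Dom C (sq_tgt g)) = sq_tgt s"
      by (simp add: s(2))
    show "sq_dom g \<cdot>\<^bsub>C\<^esub> sq_dom k = Ide C (Dom C (sq_tgt g)) \<cdot>\<^bsub>C\<^esub> sq_dom s"
      using sd(6) by (simp add: gk s(2))
    show "Dom C (sq_dom k) = Dom C (sq_src s)" "Cod C (sq_dom k) = Dom C (sq_src g)"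
      using kd(5,6) by (simp_all only: k'(1,2))
  qed (simp_all add: srck s(2))
qed

text \<open>The pullbacks with display source supplied by the axiom serve as cartesian
  lifts.\<close>

lemma dmc_compcat_fibration:
  "fibration T C p"
proof (rule fibration.intro[OF _ fibration_axioms.intro])
  show "cat_functor T C p"
    using dmc_compcat_Proj_functor[of "(C, D)"] category_axioms by simp
  fix A f assume A: "A \<in> Obj T" and f: "f \<in> Arr C"
    and "Cod C f = on_obj p A"
  then have AD: "A \<in> D" "Cod C f = Cod C A" by simp_all
  then obtain s where s: "pullback_square C s" "sq_tgt s = A" "sq_cod s = f" "sq_src s \<in> D"
    using display_pullback f by metis
  have sq: "s \<in> squares C" using s by (simp add: pullback_square_def)
  show "\<exists>g. cartesian T C p g
      \<and> Cod T g = A \<and> on_arr p g = f"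
  proof (intro exI[of _ s] conjI)
    show "cartesian T C p s"
      using pullback_square_cartesian[of "(C, D)" s] s AD category_axioms by simp
  qed (use s sq AD in simp_all)
qed

lemma dmc_compcat_comprehension: "comprehension_category (dmc_compcat (C, D))"
proof (rule comprehension_category.intro)
  show "category (Base (dmc_compcat (C, D)))" by (simp add: category_axioms)
  show "fibration T (Base (dmc_compcat (C, D))) p"
    using dmc_compcat_fibration by simp
  show "cat_functor T (arrow_cat (Base (dmc_compcat (C, D)))) (Compr (dmc_compcat (C, D)))"
    using subcategory_incl_functor[OF full_subcat_subcategory[OF arrow_cat_category[OF
        category_axioms]]]
    by simp
  show "comp_fnctr T (cod_functor (Base (dmc_compcat (C, D)))) (Compr (dmc_compcat (C, D)))
      = p"
    by (simp add: dmc_compcat_def Let_def)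
  fix g assume "cartesian T (Base (dmc_compcat (C, D))) p g"
  then have g: "cartesian T C p g"
    by (simp only: dmc_compcat_simps fst_conv)
  then have "g \<in> Arr T" unfolding cartesian_def by blast
  then show "pullback_square (Base (dmc_compcat (C, D))) (on_arr (Compr (dmc_compcat (C, D))) g)"
    using cartesian_pullback_square[OF g] by auto
qed

text \<open>An isomorphism out of a display map ends at a display map because \<open>D\<close> is
  replete, so the isomorphism itself lies in the full subcategory.\<close>

lemma dmc_compcat_replete: "replete_compcat (dmc_compcat (C, D))"
proof -
  have sub: "subcategory (full_subcat (arrow_cat C) D) (arrow_cat C)"
    using category_axioms by (auto intro: full_subcat_subcategory)
  moreover have "replete_subcategory (full_subcat (arrow_cat C) D) (arrow_cat C)"
    unfolding replete_subcategory_def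
  proof (intro conjI ballI impI sub)
    fix f assume f: "f \<in> Arr (arrow_cat C)" "iso_arr (arrow_cat C) f"
      "Dom (arrow_cat C) f \<in> Obj (full_subcat (arrow_cat C) D)"
    then have "isomorphic (arrow_cat C) (sq_src f) (sq_tgt f)"
      by (auto simp: isomorphic_def homset_iff)
    then show "f \<in> Arr (full_subcat (arrow_cat C) D)"
      using f display_replete by auto
  qed
  ultimately show ?thesis
    by (auto simp: replete_compcat_def subcategorical_def dmc_compcat_comprehension
        full_subcat_incl_full full_subcat_incl_faithful inj_on_def)
qed

end

text \<open>Pullbacks of display maps are cartesian lifts, which comprehension, being the inclusion,
  leaves unchanged and exhibits as pullback squares. Closure under isomorphism comes from
  repleteness, which puts the isomorphism itself into the total category and hence its codomain
  among the objects.\<close>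

lemma replete_compcat_display:
  assumes "replete_compcat K"
  shows "display_map_category (Base K) (Obj (Total K))"
    and "dmc_compcat (Base K, Obj (Total K)) = K"
proof -
  interpret K: comprehension_category K
    using assms by (simp add: replete_compcat_def subcategorical_def)
  have sub: "subcategory (Total K) (arrow_cat (Base K))" and compr: "Compr K = incl_fnctr (Total K)"
    and full: "full_functor (Total K) (arrow_cat (Base K)) (incl_fnctr (Total K))"
    using assms by (auto simp: replete_compcat_def subcategorical_def)
  have T: "full_subcat (arrow_cat (Base K)) (Obj (Total K)) = Total K"
    by (rule full_subcat_eqI[OF sub full])
  show K: "dmc_compcat (Base K, Obj (Total K)) = K"
    using K.cod_compr by (simp add: dmc_compcat_def Let_def T compr)
  show "display_map_category (Base K) (Obj (Total K))"
  proof (rule display_map_category.intro[OF K.base_category display_map_category_axioms.intro])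
    show "Obj (Total K) \<subseteq> Arr (Base K)" using sub by (auto simp: subcategory_def)
    fix d assume d: "d \<in> Obj (Total K)"
    show "e \<in> Obj (Total K)" if iso: "isomorphic (arrow_cat (Base K)) d e" for e
    proof -
      obtain f where f: "f \<in> Arr (arrow_cat (Base K))" "iso_arr (arrow_cat (Base K)) f"
        "Dom (arrow_cat (Base K)) f = d" "Cod (arrow_cat (Base K)) f = e"
        using iso unfolding isomorphic_def Bex_def homset_iff by blast
      then have fT: "f \<in> Arr (Total K)"
        using assms d by (simp add: replete_compcat_def replete_subcategory_def)
      then have "Cod (Total K) f = e"
        using sub f(4) unfolding subcategory_def by metis
      then show ?thesis
        using K.proj.source.cod_obj[OF fT] by simp
    qed
    fix f assume f: "f \<in> Arr (Base K)" "Cod (Base K) f = Cod (Base K) d"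
    then obtain g where g: "cartesian (Total K) (Base K) (Proj K) g" "Cod (Total K) g = d"
        "on_arr (Proj K) g = f"
      using K.proj.cartesian_lift[OF d f(1)] K.compr_obj[OF d] d by (auto simp: compr)
    then have gT: "g \<in> Arr (Total K)" by (simp add: cartesian_def)
    then have "pullback_square (Base K) g" using K.compr_cartesian[OF g(1)] by (simp add: compr)
    then show "\<exists>s. pullback_square (Base K) s \<and> sq_tgt s = d \<and> sq_cod s = f \<and> sq_src s \<in> Obj (Total K)"
      using K.compr_arr[OF gT] g gT K.proj.source.dom_obj[OF gT] K.proj.source.cod_obj[OF gT]
      by (intro exI[of _ g]) (auto simp: compr)
  qed
qed


section \<open>The 2-category of display map categories\<close>

text \<open>The arrow functor is replaced by \<open>map_square\<close>, with which it agrees on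
  squares, so that no membership condition stands in the way of rewriting.\<close>

lemma dmc_mapI:
  assumes "display_map_category (fst X) (snd X)" "display_map_category (fst Y) (snd Y)"
    and "cat_functor (fst X) (fst Y) F"
    and "\<And>d. d \<in> snd X \<Longrightarrow> on_arr F d \<in> snd Y"
    and "\<And>s. \<lbrakk>pullback_square (fst X) s; sq_tgt s \<in> snd X\<rbrakk>
        \<Longrightarrow> pullback_square (fst Y) (map_square (on_arr F) s)"
  shows "dmc_map X Y F"
  using assms by (simp add: dmc_map_def dmc_map_axioms_def pullback_square_def)

lemma (in dmc_map) map_pullback: "\<lbrakk>pullback_square (fst X) s; sq_tgt s \<in> snd X\<rbrakk>
    \<Longrightarrow> pullback_square (fst Y) (map_square (on_arr F) s)"
  using pullback_preserved[of s] by (simp add: pullback_square_def)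

lemma dmc_map_functor: "dmc_map X Y F \<Longrightarrow> cat_functor (fst X) (fst Y) F"
  by (simp add: dmc_map_def)

lemma dmc_map_id:
  assumes "display_map_category (fst X) (snd X)"
  shows "dmc_map X X (id_fnctr (fst X))"
proof -
  interpret display_map_category "fst X" "snd X" by fact
  have "map_square (on_arr (id_fnctr (fst X))) s = s" if "s \<in> squares (fst X)" for s
    using square_arrD[OF that] by (simp add: square.expand square.map_sel)
  then show ?thesis
    using assms display_arr category_axioms by (intro dmc_mapI) (auto simp: pullback_square_def)
qed

lemma dmc_map_comp:
  assumes "dmc_map X Y F" "dmc_map Y Z G"
  shows "dmc_map X Z (comp_fnctr (fst X) G F)"
proof -
  interpret F: dmc_map X Y F by fact
  interpret G: dmc_map Y Z G by fact
  show ?thesis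
  proof (rule dmc_mapI)
    fix s assume s: "pullback_square (fst X) s" "sq_tgt s \<in> snd X"
    then have sq: "s \<in> squares (fst X)" by (simp add: pullback_square_def)
    have "map_square (on_arr (comp_fnctr (fst X) G F)) s
        = map_square (on_arr G) (map_square (on_arr F) s)"
      using square_arrD[OF sq] by (simp add: square.expand square.map_sel)
    then show "pullback_square (fst Z) (map_square (on_arr (comp_fnctr (fst X) G F)) s)"
      using G.map_pullback[OF F.map_pullback[OF s]] s F.display_preserved by (simp add: square.map_sel)
  qed (use F.source.display_arr in \<open>auto simp: F.display_preserved G.display_preserved
      F.source.display_map_category_axioms G.target.display_map_category_axioms
      cat_functor_comp[OF F.cat_functor_axioms G.cat_functor_axioms]\<close>)
qed

lemma dmc_transformationD:
  assumes "dmc_transformation X Y t"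
  shows "dmc_map X Y (dt_src t)" "dmc_map X Y (dt_tgt t)"
    "nat_trans (fst X) (fst Y) (dt_src t) (dt_tgt t) (dt_comp t)"
  using assms by (simp_all add: dmc_transformation_def)

lemma dmc_hom_simps [simp]:
  "F \<in> Obj (dmc_hom X Y) \<longleftrightarrow> dmc_map X Y F"
  "t \<in> Arr (dmc_hom X Y) \<longleftrightarrow> dmc_transformation X Y t"
  "dmc_transformation X Y t \<Longrightarrow> Dom (dmc_hom X Y) t = dt_src t"
  "dmc_transformation X Y t \<Longrightarrow> Cod (dmc_hom X Y) t = dt_tgt t"
  "dmc_map X Y F \<Longrightarrow> Ide (dmc_hom X Y) F
     = \<lparr> dt_src = F, dt_tgt = F, dt_comp = id_nt (fst X) (fst Y) F \<rparr>"
  "\<lbrakk>dmc_transformation X Y s; dmc_transformation X Y t; dt_src s = dt_tgt t\<rbrakk>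
   \<Longrightarrow> s \<cdot>\<^bsub>dmc_hom X Y\<^esub> t = \<lparr> dt_src = dt_src t, dt_tgt = dt_tgt s,
         dt_comp = vcomp_nt (fst X) (fst Y) (dt_comp s) (dt_comp t) \<rparr>"
  by (simp_all add: dmc_hom_def)

lemma dmc_transformation_id:
  "dmc_map X Y F \<Longrightarrow> dmc_transformation X Y \<lparr> dt_src = F, dt_tgt = F, dt_comp = id_nt (fst X) (fst Y) F \<rparr>"
  by (simp add: dmc_transformation_def nat_trans_id dmc_map_functor)

lemma dmc_transformation_vcomp:
  assumes "dmc_transformation X Y t" "dmc_transformation X Y s" "dt_src s = dt_tgt t"
  shows "dmc_transformation X Y \<lparr> dt_src = dt_src t, dt_tgt = dt_tgt s,
         dt_comp = vcomp_nt (fst X) (fst Y) (dt_comp s) (dt_comp t) \<rparr>"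
  using nat_trans_vcomp[OF dmc_transformationD(3)[OF assms(1)]] assms
  by (simp add: dmc_transformation_def)

lemma dmc_hom_category: "category (dmc_hom X Y)"
proof (rule categoryI)
  fix t assume t: "t \<in> Arr (dmc_hom X Y)"
  then show "Ide (dmc_hom X Y) (Cod (dmc_hom X Y) t) \<cdot>\<^bsub>dmc_hom X Y\<^esub> t = t"
    "t \<cdot>\<^bsub>dmc_hom X Y\<^esub> Ide (dmc_hom X Y) (Dom (dmc_hom X Y) t) = t"
    using dmc_transformationD[of X Y t]
    by (simp_all add: dmc_transformation_id vcomp_id[of _ _ "dt_src t" "dt_tgt t"])
next
  fix r s t assume *: "r \<in> Arr (dmc_hom X Y)" "s \<in> Arr (dmc_hom X Y)" "t \<in> Arr (dmc_hom X Y)"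
    "Dom (dmc_hom X Y) s = Cod (dmc_hom X Y) r" "Dom (dmc_hom X Y) t = Cod (dmc_hom X Y) s"
  have "vcomp_nt (fst X) (fst Y) (vcomp_nt (fst X) (fst Y) (dt_comp t) (dt_comp s)) (dt_comp r)
      = vcomp_nt (fst X) (fst Y) (dt_comp t) (vcomp_nt (fst X) (fst Y) (dt_comp s) (dt_comp r))"
    by (rule vcomp_assoc[of _ _ "dt_src r" "dt_src s" _ "dt_src t" _ "dt_tgt t"])
       (use * dmc_transformationD(3)[of X Y r] dmc_transformationD(3)[of X Y s]
         dmc_transformationD(3)[of X Y t] in simp_all)
  then show "(t \<cdot>\<^bsub>dmc_hom X Y\<^esub> s) \<cdot>\<^bsub>dmc_hom X Y\<^esub> r = t \<cdot>\<^bsub>dmc_hom X Y\<^esub> (s \<cdot>\<^bsub>dmc_hom X Y\<^esub> r)"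
    using * dmc_transformation_vcomp[of X Y r s] dmc_transformation_vcomp[of X Y s t] by simp
qed (auto simp: dmc_transformation_id dmc_transformation_vcomp dmc_transformationD, auto simp:
    dmc_hom_def)

definition dmc_hcomp where
  "dmc_hcomp X Z s t =
    \<lparr> dt_src = comp_fnctr (fst X) (dt_src s) (dt_src t),
      dt_tgt = comp_fnctr (fst X) (dt_tgt s) (dt_tgt t),
      dt_comp = hcomp_nt (fst X) (fst Z) (dt_src s) (dt_tgt t) (dt_comp s) (dt_comp t) \<rparr>"

lemma DMC_simps [simp]:
  "X \<in> Ob DMC \<longleftrightarrow> display_map_category (fst X) (snd X)"
  "HomCat DMC = dmc_hom" "Id1 DMC X = id_fnctr (fst X)"
  "\<lbrakk>dmc_map Y Z G; dmc_map X Y F\<rbrakk> \<Longrightarrow> on_obj (HComp DMC X Y Z) (G, F) = comp_fnctr (fst X) G F"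
  "\<lbrakk>dmc_transformation Y Z s; dmc_transformation X Y t\<rbrakk>
   \<Longrightarrow> on_arr (HComp DMC X Y Z) (s, t) = dmc_hcomp X Z s t"
  by (simp_all add: DMC_def dmc_hcomp_def)

lemma dmc_transformation_hcomp:
  assumes "dmc_transformation X Y t" "dmc_transformation Y Z s"
  shows "dmc_transformation X Z (dmc_hcomp X Z s t)"
  using dmc_transformationD[OF assms(1)] dmc_transformationD[OF assms(2)]
  by (simp add: dmc_transformation_def dmc_hcomp_def nat_trans_hcomp dmc_map_comp)

text \<open>Apart from closure of the maps under identities and composition, the axioms are the
  corresponding equations for functors and natural transformations, because neither kind of cell
  carries additional structure.\<close>

lemma two_category_DMC: "two_category (DMC :: ('o, 'a) dmc_twocat)"
proof (rule two_category.intro)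
  fix X Y Z :: "('o, 'a) dmcat"
  show "cat_functor (prod_cat (HomCat DMC Y Z) (HomCat DMC X Y)) (HomCat DMC X Z) (HComp DMC X Y Z)"
  proof (rule prod_cat_functorI)
    fix s t assume *: "s \<in> Arr (HomCat DMC Y Z)" "t \<in> Arr (HomCat DMC X Y)"
    then show "on_arr (HComp DMC X Y Z) (s, t) \<in> Arr (HomCat DMC X Z)
      \<and> Dom (HomCat DMC X Z) (on_arr (HComp DMC X Y Z) (s, t))
        = on_obj (HComp DMC X Y Z) (Dom (HomCat DMC Y Z) s, Dom (HomCat DMC X Y) t)
      \<and> Cod (HomCat DMC X Z) (on_arr (HComp DMC X Y Z) (s, t))
        = on_obj (HComp DMC X Y Z) (Cod (HomCat DMC Y Z) s, Cod (HomCat DMC X Y) t)"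
      using dmc_transformationD[of Y Z s] dmc_transformationD[of X Y t]
          dmc_transformation_hcomp[of X Y t Z s]
      by simp (simp add: dmc_hcomp_def)
  next
    fix G F assume *: "G \<in> Obj (HomCat DMC Y Z)" "F \<in> Obj (HomCat DMC X Y)"
    then show "on_arr (HComp DMC X Y Z) (Ide (HomCat DMC Y Z) G, Ide (HomCat DMC X Y) F)
        = Ide (HomCat DMC X Z) (on_obj (HComp DMC X Y Z) (G, F))"
      by (simp add: dmc_transformation_id dmc_map_comp dmc_hcomp_def
          hcomp_id_nt[of _ "fst Y"] dmc_map_functor)
  next
    fix s t s' t' assume *: "s \<in> Arr (HomCat DMC Y Z)" "t \<in> Arr (HomCat DMC X Y)"
      "s' \<in> Arr (HomCat DMC Y Z)" "t' \<in> Arr (HomCat DMC X Y)"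
      "Dom (HomCat DMC Y Z) s' = Cod (HomCat DMC Y Z) s"
          "Dom (HomCat DMC X Y) t' = Cod (HomCat DMC X Y) t"
    then have D: "dmc_transformation Y Z s" "dmc_transformation X Y t" "dmc_transformation Y Z s'"
      "dmc_transformation X Y t'" and eq: "dt_src s' = dt_tgt s" "dt_src t' = dt_tgt t"
      by simp_all
    have "hcomp_nt (fst X) (fst Z) (dt_src s) (dt_tgt t') (vcomp_nt (fst Y) (fst Z) (dt_comp s')
        (dt_comp s))
        (vcomp_nt (fst X) (fst Y) (dt_comp t') (dt_comp t))
      = vcomp_nt (fst X) (fst Z) (hcomp_nt (fst X) (fst Z) (dt_tgt s) (dt_tgt t') (dt_comp s')
          (dt_comp t'))
          (hcomp_nt (fst X) (fst Z) (dt_src s) (dt_tgt t) (dt_comp s) (dt_comp t))"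
      by (rule interchange[OF dmc_transformationD(3)[OF D(2)] dmc_transformationD(3)[OF D(4),
          unfolded eq]
            dmc_transformationD(3)[OF D(1)] dmc_transformationD(3)[OF D(3), unfolded eq]])
    moreover have "dt_src (dmc_hcomp X Z s' t') = dt_tgt (dmc_hcomp X Z s t)"
      by (simp add: dmc_hcomp_def eq)
    ultimately show "on_arr (HComp DMC X Y Z) (s' \<cdot>\<^bsub>HomCat DMC Y Z\<^esub> s, t' \<cdot>\<^bsub>HomCat DMC X Y\<^esub> t)
      = on_arr (HComp DMC X Y Z) (s', t') \<cdot>\<^bsub>HomCat DMC X Z\<^esub> on_arr (HComp DMC X Y Z) (s, t)"
      using D eq dmc_transformation_hcomp[OF D(2,1)] dmc_transformation_hcomp[OF D(4,3)]
      by (simp add: dmc_transformation_vcomp) (simp add: dmc_hcomp_def eq)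
  qed (simp_all add: dmc_hom_category dmc_map_comp, auto simp: DMC_def)
next
  fix W X Y Z :: "('o, 'a) dmcat" and r s t
  assume "r \<in> Arr (HomCat DMC W X)" "s \<in> Arr (HomCat DMC X Y)" "t \<in> Arr (HomCat DMC Y Z)"
  then have D: "dmc_transformation W X r" "dmc_transformation X Y s" "dmc_transformation Y Z t"
    by simp_all
  show "on_arr (HComp DMC W X Z) (on_arr (HComp DMC X Y Z) (t, s), r)
      = on_arr (HComp DMC W Y Z) (t, on_arr (HComp DMC W X Y) (s, r))"
    using D dmc_transformation_hcomp[OF D(1,2)] dmc_transformation_hcomp[OF D(2,3)]
    by simp (simp add: dmc_hcomp_def hcomp_assoc[OF dmc_transformationD(3)[OF D(1)]
        dmc_transformationD(3)[OF D(2)] dmc_transformationD(3)[OF D(3)]]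
      comp_fnctr_assoc[OF dmc_map_functor] dmc_transformationD)
next
  fix X Y :: "('o, 'a) dmcat" and t
  assume *: "X \<in> Ob DMC" "Y \<in> Ob DMC" "t \<in> Arr (HomCat DMC X Y)"
  then have D: "dmc_map X Y (dt_src t)" "dmc_map X Y (dt_tgt t)"
    "nat_trans (fst X) (fst Y) (dt_src t) (dt_tgt t) (dt_comp t)"
    by (simp_all add: dmc_transformationD)
  show "on_arr (HComp DMC X Y Y) (Ide (HomCat DMC Y Y) (Id1 DMC Y), t) = t
      \<and> on_arr (HComp DMC X X Y) (t, Ide (HomCat DMC X X) (Id1 DMC X)) = t"
    using * by (simp add: dmc_map_id dmc_transformation_id)
      (simp add: dmc_hcomp_def comp_fnctr_id[OF dmc_map_functor[OF D(1)]]
        comp_fnctr_id[OF dmc_map_functor[OF D(2)]] hcomp_unit[OF D(3)])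
qed (simp_all add: dmc_hom_category dmc_map_id dmc_map_comp comp_fnctr_id[OF dmc_map_functor]
    comp_fnctr_assoc[OF dmc_map_functor])


section \<open>Replete comprehension categories and display map categories\<close>

definition dmcat_of :: "('o, 'a) repl_compcat \<Rightarrow> ('o, 'a) dmcat" where
  "dmcat_of K = (Base K, Obj (Total K))"

lemma dmcat_of_simps [simp]: "fst (dmcat_of K) = Base K" "snd (dmcat_of K) = Obj (Total K)"
  by (simp_all add: dmcat_of_def)

text \<open>A locale for the predicate, so that the facts on comprehension categories and on display
  map categories both become available by interpretation.\<close>

locale repl_compcat =
  fixes K :: "('o, 'a) repl_compcat"
  assumes replete: "replete_compcat K"

sublocale repl_compcat \<subseteq> comprehension_category K
  using replete by (simp add: replete_compcat_def subcategorical_def)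

sublocale repl_compcat \<subseteq> display: display_map_category "Base K" "Obj (Total K)"
  by (rule replete_compcat_display(1)[OF replete])

context repl_compcat
begin

lemma dmc_compcat_dmcat_of: "dmc_compcat (dmcat_of K) = K"
  using replete_compcat_display(2)[OF replete] by (simp add: dmcat_of_def)

text \<open>As a rewrite rule this would loop, so it is applied once by substitution, or
  reversed.\<close>

lemma total_eq: "Total K = full_subcat (arrow_cat (Base K)) (Obj (Total K))"
  using arg_cong[OF dmc_compcat_dmcat_of, of Total] by simp

lemma arr_iff: "s \<in> Arr (Total K) \<longleftrightarrow> s \<in> squares (Base K) \<and> sq_src s \<in> Obj (Total K)
    \<and> sq_tgt s \<in> Obj (Total K)"
  by (subst total_eq) (rule square_full_subcat_iff)

lemma obj_arr: "A \<in> Obj (Total K) \<Longrightarrow> A \<in> Arr (Base K)"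
  using display.display_arr by blast

lemma compr_eq: "Compr K = incl_fnctr (Total K)"
  using replete by (simp add: replete_compcat_def subcategorical_def)

lemma repl_compr [simp]:
  "A \<in> Obj (Total K) \<Longrightarrow> on_obj (Compr K) A = A"
  "s \<in> Arr (Total K) \<Longrightarrow> on_arr (Compr K) s = s"
  by (simp_all add: compr_eq)

lemma repl_proj [simp]:
  "A \<in> Obj (Total K) \<Longrightarrow> on_obj (Proj K) A = Cod (Base K) A"
  "s \<in> Arr (Total K) \<Longrightarrow> on_arr (Proj K) s = sq_cod s"
  using compr_obj(2)[of A] compr_arr(4)[of s] by simp_all

lemma repl_dom [simp]:
  assumes "s \<in> Arr (Total K)"
  shows "Dom (Total K) s = sq_src s" "Cod (Total K) s = sq_tgt s"
  using compr_arr[OF assms] assms by simp_all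

text \<open>Functoriality of the inclusion carries the structure of the total category to that of
  the arrow category; composites are computed by the same argument.\<close>

lemma repl_ide [simp]: "A \<in> Obj (Total K)
    \<Longrightarrow> Ide (Total K) A = Square A A (Ide (Base K) (Dom (Base K) A)) (Ide (Base K) (Cod (Base K) A))"
  using compr.on_arr_ide[of A] by (simp add: obj_arr)

lemma repl_comp [simp]:
  assumes "s \<in> Arr (Total K)" "t \<in> Arr (Total K)" "sq_src t = sq_tgt s"
  shows "t \<cdot>\<^bsub>Total K\<^esub> s
    = Square (sq_src s) (sq_tgt t) (sq_dom t \<cdot>\<^bsub>Base K\<^esub> sq_dom s) (sq_cod t \<cdot>\<^bsub>Base K\<^esub> sq_cod s)"
proof -
  have "s \<in> squares (Base K)" "t \<in> squares (Base K)" using assms by (simp_all add: arr_iff)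
  then show ?thesis
    using compr.on_arr_comp_arr[of s t] proj.source.comp_arr(1)[of s t] assms by simp
qed

text \<open>The source of a pullback of a display map is again a display map, so a condition on the
  target is enough for \<open>g\<close> to be an arrow of the total category. This form matches the
  preservation clause in \<open>dmc_map\<close>.\<close>

lemma cartesian_iff:
  "cartesian (Total K) (Base K) (Proj K) g \<longleftrightarrow> pullback_square (Base K) g \<and> sq_tgt g \<in> Obj (Total K)"
proof
  assume g: "cartesian (Total K) (Base K) (Proj K) g"
  then have "g \<in> Arr (Total K)" by (simp add: cartesian_def)
  then show "pullback_square (Base K) g \<and> sq_tgt g \<in> Obj (Total K)"
    using compr_cartesian[OF g] by (simp add: arr_iff)
next
  assume "pullback_square (Base K) g \<and> sq_tgt g \<in> Obj (Total K)"
  then show "cartesian (Total K) (Base K) (Proj K) g"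
    using pullback_square_cartesian[of "dmcat_of K" g] display.display_pullback_src[of g] base_category
    by (simp add: dmc_compcat_dmcat_of flip: total_eq)
qed

end

locale repl_compcats = K: repl_compcat K + L: repl_compcat L
  for K L :: "('o, 'a) repl_compcat"

text \<open>Repleteness enters here: \<open>F A\<close> is isomorphic to the display map \<open>F' A\<close>, where \<open>F'\<close> is
  the total part of the pseudo map, hence is itself a display map.\<close>

lemma (in repl_compcats) pseudo_map_dmc_map:
  assumes "pseudo_map K L m"
  shows "dmc_map (dmcat_of K) (dmcat_of L) (pm_base m)"
proof -
  interpret m: pseudo_map K L m by fact
  show ?thesis
  proof (rule dmc_mapI)
    fix d assume "d \<in> snd (dmcat_of K)"
    then have d: "d \<in> Obj (Total K)" by simp
    have "pm_iso m d \<in> homset (arrow_cat (Base L)) (on_obj (pm_total m) d) (on_arr (pm_base m) d)"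
      using m.iso_square(1-3)[OF d] d by (simp add: homset_iff)
    then have "isomorphic (arrow_cat (Base L)) (on_obj (pm_total m) d) (on_arr (pm_base m) d)"
      using m.iso_iso[OF d] by (auto simp: isomorphic_def)
    then show "on_arr (pm_base m) d \<in> snd (dmcat_of L)"
      using L.display.display_replete m.total.on_obj_in[OF d] by simp
  next
    fix s assume s: "pullback_square (fst (dmcat_of K)) s" "sq_tgt s \<in> snd (dmcat_of K)"
    then have cart: "cartesian (Total K) (Base K) (Proj K) s" by (simp add: K.cartesian_iff)
    then have sT: "s \<in> Arr (Total K)" by (simp add: cartesian_def)
    then have sq: "s \<in> squares (Base K)" and src: "sq_src s \<in> Obj (Total K)" and tgt:
        "sq_tgt s \<in> Obj (Total K)"
      by (simp_all add: K.arr_iff)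
    let ?t = "on_arr (pm_total m) s"
    have t: "pullback_square (Base L) ?t"
      using m.pm_cartesian[OF cart] by (simp add: L.cartesian_iff)
    have tT: "?t \<in> Arr (Total L)" "sq_src ?t = on_obj (pm_total m) (sq_src s)"
      "sq_tgt ?t = on_obj (pm_total m) (sq_tgt s)" "sq_cod ?t = on_arr (pm_base m) (sq_cod s)"
      using sT m.total.on_arr_arr[OF sT] m.over_arr[OF sT] by simp_all
    obtain a' b' where a: "inverse_arrs (Base L) (sq_dom (pm_iso m (sq_src s))) a'"
      and b: "inverse_arrs (Base L) (sq_dom (pm_iso m (sq_tgt s))) b'"
      using m.iso_dom_iso[OF src] m.iso_dom_iso[OF tgt] unfolding iso_arr_def by blast
    \<comment> \<open>Commutation of the comparison square, whose codomain component is an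
      identity.\<close>
    have comm: "on_arr (pm_base m) A \<cdot>\<^bsub>Base L\<^esub> sq_dom (pm_iso m A) = on_obj (pm_total m) A"
      if A: "A \<in> Obj (Total K)" for A
      using square_commutes[OF m.iso_square(1)[OF A]] m.iso_square(2-4)[OF A] A m.over_obj[OF A]
        L.obj_arr[OF m.total.on_obj_in[OF A]] by simp
    \<comment> \<open>The total part sends \<open>s\<close> to a pullback square. The comparisons at
      the source and target of \<open>s\<close> form an isomorphism from that square to the image of
      \<open>s\<close> under the base functor.\<close>
    have "pullback_square (Base L) (map_square (on_arr (pm_base m)) s)"
    proof (rule pullback_square_transport[OF t L.base_category _ _ a _ _ b])
      show "map_square (on_arr (pm_base m)) s \<in> squares (Base L)"
        using sq by (rule m.base.map_square_squares)
      show "sq_dom (map_square (on_arr (pm_base m)) s) \<cdot>\<^bsub>Base L\<^esub> sq_dom (pm_iso m (sq_src s))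
          = sq_dom (pm_iso m (sq_tgt s)) \<cdot>\<^bsub>Base L\<^esub> sq_dom ?t"
        using m.iso_natural[OF sT] sT tT(1) by (simp add: square.map_sel)
    qed (use src tgt m.iso_dom[OF src] m.iso_dom[OF tgt]
        in \<open>simp_all add: tT square.map_sel comm K.obj_arr\<close>)
    then show "pullback_square (fst (dmcat_of L)) (map_square (on_arr (pm_base m)) s)" by simp
  qed (use K.display.display_map_category_axioms L.display.display_map_category_axioms m.pm_base_functor
      in simp_all)
qed

section \<open>Strict maps and strictification of pseudo maps\<close>

definition strict_pmap ::
    "('o, 'a) repl_compcat \<Rightarrow> ('o, 'a) repl_compcat \<Rightarrow> ('o, 'a, 'o, 'a) fnctr \<Rightarrow> ('o, 'a) repl_pmap" where
  "strict_pmap K L F =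
    \<lparr> pm_base = F,
      pm_total = \<lparr> on_obj = restrict (on_arr F) (Obj (Total K)),
                  on_arr = restrict (map_square (on_arr F)) (Arr (Total K)) \<rparr>,
      pm_iso = (\<lambda>A \<in> Obj (Total K). Ide (arrow_cat (Base L)) (on_arr F A)) \<rparr>"

text \<open>Strictness leaves no choice for the total part: as comprehension is an inclusion, it
  must be the arrow functor of \<open>F\<close>. That this restricts to the total categories and
  preserves cartesian arrows is what \<open>dmc_map\<close> provides.\<close>

lemma (in repl_compcats) strict_pmap:
  assumes "dmc_map (dmcat_of K) (dmcat_of L) F"
  shows "strict_map K L (strict_pmap K L F)"
proof -
  let ?n = "strict_pmap K L F"
  interpret F: dmc_map "dmcat_of K" "dmcat_of L" F by fact
  interpret F: cat_functor "Base K" "Base L" F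
    using F.cat_functor_axioms by simp
  have disp: "on_arr F A \<in> Obj (Total L)" if "A \<in> Obj (Total K)" for A
    using F.display_preserved[of A] that by simp
  have arr: "map_square (on_arr F) s \<in> Arr (Total L)" if "s \<in> Arr (Total K)" for s
    using that F.map_square_squares[of s] by (simp add: K.arr_iff L.arr_iff disp square.map_sel)
  have F: "pm_base ?n = F"
    "\<And>A. A \<in> Obj (Total K) \<Longrightarrow> on_obj (pm_total ?n) A = on_arr F A"
    "\<And>s. s \<in> Arr (Total K) \<Longrightarrow> on_arr (pm_total ?n) s = map_square (on_arr F) s"
    "\<And>A. A \<in> Obj (Total K) \<Longrightarrow> pm_iso ?n A
       = Square (on_arr F A) (on_arr F A) (Ide (Base L) (Dom (Base L) (on_arr F A))) (Ide (Base L)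
           (Cod (Base L) (on_arr F A)))"
    by (simp_all add: strict_pmap_def K.obj_arr)
  have sq: "s \<in> squares (Base K)" if "s \<in> Arr (Total K)" for s
    using that by (simp add: K.arr_iff)
  have total: "cat_functor (Total K) (Total L) (pm_total ?n)"
  proof (rule cat_functorI)
    fix s t assume *: "s \<in> Arr (Total K)" "t \<in> Arr (Total K)" "Dom (Total K) t = Cod (Total K) s"
    \<comment> \<open>The composite is kept folded, so that it is seen to be an arrow of
      \<open>Total K\<close>, where the restricted map is defined.\<close>
    then have "t \<cdot>\<^bsub>Total K\<^esub> s \<in> Arr (Total K)" by (simp del: K.repl_comp)
    then have "on_arr (pm_total ?n) (t \<cdot>\<^bsub>Total K\<^esub> s)
      = map_square (on_arr F) (t \<cdot>\<^bsub>Total K\<^esub> s)"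
      by (rule F(3))
    also have "\<dots> = map_square (on_arr F) t \<cdot>\<^bsub>Total L\<^esub> map_square (on_arr F) s"
      using * arr square_arrD[OF sq[OF *(1)]] square_arrD[OF sq[OF *(2)]]
      by (simp add: square.map_sel)
    finally show "on_arr (pm_total ?n) (t \<cdot>\<^bsub>Total K\<^esub> s)
      = on_arr (pm_total ?n) t \<cdot>\<^bsub>Total L\<^esub> on_arr (pm_total ?n) s"
      using * by (simp only: F(3))
  next
    fix A assume A: "A \<in> Obj (Total K)"
    then have "Ide (Total K) A \<in> Arr (Total K)" by (simp del: K.repl_ide)
    then show "on_arr (pm_total ?n) (Ide (Total K) A)
        = Ide (Total L) (on_obj (pm_total ?n) A)"
      using A by (simp add: F disp K.obj_arr)
  qed (use K.proj.source.category_axioms L.proj.source.category_axioms in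
      \<open>simp_all add: F disp arr square.map_sel K.arr_iff\<close>, simp_all add: strict_pmap_def)
  have "pseudo_map K L ?n"
  proof (rule pseudo_mapI)
    fix g assume g: "cartesian (Total K) (Base K) (Proj K) g"
    then have "g \<in> Arr (Total K)" by (simp add: cartesian_def)
    then show "cartesian (Total L) (Base L) (Proj L) (on_arr (pm_total ?n) g)"
      using g F.map_pullback[of g] by (simp add: F K.cartesian_iff L.cartesian_iff square.map_sel disp)
  next
    fix A assume A: "A \<in> Obj (Total K)"
    have "Ide (arrow_cat (Base L)) (on_arr F A) \<in> Arr (arrow_cat (Base L))"
      by (rule L.compr.target.ide_arr) (use A in \<open>simp add: K.obj_arr\<close>)
    then show "pm_iso ?n A \<in> squares (Base L)
      \<and> sq_src (pm_iso ?n A) = on_obj (Compr L) (on_obj (pm_total ?n) A)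
      \<and> sq_tgt (pm_iso ?n A) = on_arr (pm_base ?n) (on_obj (Compr K) A)
      \<and> sq_cod (pm_iso ?n A)
        = Ide (Base L) (on_obj (pm_base ?n) (on_obj (Proj K) A))
      \<and> iso_arr (Base L) (sq_dom (pm_iso ?n A))"
      using A by (simp add: F disp K.obj_arr L.base.iso_arr_ide)
  next
    fix s assume s: "s \<in> Arr (Total K)"
    then show "sq_dom (pm_iso ?n (Cod (Total K) s))
        \<cdot>\<^bsub>Base L\<^esub> sq_dom (on_arr (Compr L) (on_arr (pm_total ?n) s))
      = on_arr (pm_base ?n) (sq_dom (on_arr (Compr K) s))
        \<cdot>\<^bsub>Base L\<^esub> sq_dom (pm_iso ?n (Dom (Total K) s))"
      using square_arrD[OF sq[OF s]] by (simp add: F arr square.map_sel K.arr_iff)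
  qed (use total in \<open>simp_all add: F disp arr K.obj_arr square.map_sel K.comprehension_category_axioms
      L.comprehension_category_axioms F.cat_functor_axioms\<close>, simp add: strict_pmap_def)
  then show ?thesis
    by (simp add: strict_map_iff F disp)
qed

text \<open>The general conditions simplify because comprehension is the inclusion on both sides;
  the rule for arrows is read off from the equality of composite functors.\<close>

lemma (in repl_compcats) strict_mapD:
  assumes "strict_map K L m"
  shows "pseudo_map K L m"
    and "A \<in> Obj (Total K) \<Longrightarrow> on_obj (pm_total m) A = on_arr (pm_base m) A"
    and "s \<in> Arr (Total K) \<Longrightarrow> on_arr (pm_total m) s = map_square (on_arr (pm_base m)) s"
    and "A \<in> Obj (Total K) \<Longrightarrow> sq_dom (pm_iso m A) = Ide (Base L) (on_obj (pm_base m) (Dom (Base K) A))"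
proof -
  show m: "pseudo_map K L m" using assms by (simp add: strict_map_iff)
  interpret m: pseudo_map K L m by fact
  have strict: "on_obj (pm_total m) A = on_arr (pm_base m) A"
    "sq_dom (pm_iso m A) = Ide (Base L) (Dom (Base L) (on_obj (pm_total m) A))" if
        "A \<in> Obj (Total K)" for A
    using assms that by (simp_all add: strict_map_iff)
  then show "A \<in> Obj (Total K) \<Longrightarrow> on_obj (pm_total m) A = on_arr (pm_base m) A" by simp
  show "A \<in> Obj (Total K) \<Longrightarrow> sq_dom (pm_iso m A) = Ide (Base L) (on_obj (pm_base m) (Dom (Base K) A))"
    by (simp add: strict K.obj_arr)
  assume s: "s \<in> Arr (Total K)"
  have "comp_fnctr (Total K) (Compr L) (pm_total m)
      = comp_fnctr (Total K) (arrow_functor (Base K) (pm_base m)) (Compr K)"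
    using assms by (simp add: strict_map_def)
  from arg_cong[OF this, of "\<lambda>F. on_arr F s"] show
      "on_arr (pm_total m) s = map_square (on_arr (pm_base m)) s"
    using s by (simp add: K.arr_iff)
qed

lemma (in repl_compcats) strict_map_eqI:
  assumes "strict_map K L m" "strict_map K L n" "pm_base m = pm_base n"
  shows "m = n"
proof (rule pmap_eqI[of K L])
  show "pm_total m = pm_total n"
    by (rule fnctr_eqI[OF pseudo_map.pm_total_functor[OF strict_mapD(1)[OF assms(1)]]
          pseudo_map.pm_total_functor[OF strict_mapD(1)[OF assms(2)]]])
       (use assms in \<open>simp_all add: strict_mapD\<close>)
qed (use assms in \<open>simp_all add: strict_mapD\<close>)

lemma (in repl_compcats) strict_pmap_base:
  assumes "strict_map K L m"
  shows "strict_pmap K L (pm_base m) = m"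
  using strict_map_eqI[OF strict_pmap[OF pseudo_map_dmc_map[OF strict_mapD(1)[OF assms]]] assms]
  by (simp add: strict_pmap_def)

text \<open>Fullness of the total category turns each comparison square into one of its arrows,
  since both ends are display maps. Compatibility of the resulting 2-cell is then immediate, because
  the comparison on the strict side is an identity.\<close>

lemma (in repl_compcats) pseudo_map_strictify:
  assumes "pseudo_map K L m"
  shows "isomorphic (compcat_hom K L) (strict_pmap K L (pm_base m)) m"
proof -
  interpret m: pseudo_map K L m by fact
  let ?n = "strict_pmap K L (pm_base m)"
  have strict: "strict_map K L ?n"
    by (rule strict_pmap[OF pseudo_map_dmc_map[OF assms]])
  note n = strict_mapD[OF strict]
  interpret n: pseudo_map K L ?n by (rule n(1))
  have base: "pm_base ?n = pm_base m" by (simp add: strict_pmap_def)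
  have iso: "pm_iso m A \<in> Arr (Total L)" "sq_src (pm_iso m A) = on_obj (pm_total m) A"
    "sq_tgt (pm_iso m A) = on_obj (pm_total ?n) A" if A: "A \<in> Obj (Total K)" for A
    using m.iso_square[OF A] m.total.on_obj_in[OF A] n.total.on_obj_in[OF A] A
    by (simp_all add: L.arr_iff n base)
  have nt: "nat_trans (Total K) (Total L) (pm_total m) (pm_total ?n) (pm_iso m)"
  proof (rule nat_transI)
    fix s assume s: "s \<in> Arr (Total K)"
    have T: "sq_src s \<in> Obj (Total K)" "sq_tgt s \<in> Obj (Total K)" using s by (simp_all add: K.arr_iff)
    have ms: "sq_src (on_arr (pm_total m) s) = on_obj (pm_total m) (sq_src s)"
       "sq_tgt (on_arr (pm_total m) s) = on_obj (pm_total m) (sq_tgt s)"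
       "sq_src (on_arr (pm_total ?n) s) = on_obj (pm_total ?n) (sq_src s)"
       "sq_tgt (on_arr (pm_total ?n) s) = on_obj (pm_total ?n) (sq_tgt s)"
      using m.total.on_arr_arr[OF s] n.total.on_arr_arr[OF s] s by simp_all
    have "sq_cod (on_arr (pm_total m) s) = on_arr (pm_base m) (sq_cod s)"
      using m.over_arr[OF s] m.total.on_arr_arr(1)[OF s] s by simp
    moreover have "sq_dom (pm_iso m (sq_tgt s)) \<cdot>\<^bsub>Base L\<^esub> sq_dom (on_arr (pm_total m) s)
      = on_arr (pm_base m) (sq_dom s) \<cdot>\<^bsub>Base L\<^esub> sq_dom (pm_iso m (sq_src s))"
      using m.iso_natural[OF s] s m.total.on_arr_arr(1)[OF s] by simp
    moreover have "s \<in> squares (Base K)" using s by (simp add: K.arr_iff)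
    ultimately show "pm_iso m (Cod (Total K) s) \<cdot>\<^bsub>Total L\<^esub> on_arr (pm_total m) s
        = on_arr (pm_total ?n) s \<cdot>\<^bsub>Total L\<^esub> pm_iso m (Dom (Total K) s)"
      using s T m.total.on_arr_arr(1)[OF s] n.total.on_arr_arr(1)[OF s] square_arrD[of s "Base K"]
      by (simp add: iso ms n(2) base) (simp add: n(3) base square.map_sel)
  qed (simp_all add: iso n(2) base m.iso_ext m.pm_total_functor n.pm_total_functor)
  \<comment> \<open>The codomain component of the comparison is an identity, hence its own inverse,
    and is reused; the domain component gets a chosen inverse.\<close>
  define u where "u = (\<lambda>A\<in>Obj (Total K). Square (on_obj (pm_total ?n) A) (on_obj (pm_total m) A)
     (SOME v. inverse_arrs (Base L) (sq_dom (pm_iso m A)) v) (sq_cod (pm_iso m A)))"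
  have inv_dom: "inverse_arrs (Base L) (sq_dom (pm_iso m A)) (sq_dom (u A))" if A:
      "A \<in> Obj (Total K)" for A
    using someI_ex[OF m.iso_dom_iso[OF A, unfolded iso_arr_def]] A by (simp add: u_def)
  \<comment> \<open>Inverses are found in the arrow category and then recognized in its full
    subcategory \<open>Total L\<close>.\<close>
  have inv: "inverse_arrs (Total L) (pm_iso m A) (u A)" if A: "A \<in> Obj (Total K)" for A
  proof -
    have "inverse_arrs (arrow_cat (Base L)) (pm_iso m A)
        (Square (sq_tgt (pm_iso m A)) (sq_src (pm_iso m A)) (sq_dom (u A)) (sq_cod (pm_iso m A)))"
      using A inv_dom[OF A] L.base.inverse_arrs_ide[of "on_obj (pm_base m) (Cod (Base K) A)"]
      by (intro inverse_squaresI) (simp_all add: L.base_category K.obj_arr)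
    then have uu: "inverse_arrs (arrow_cat (Base L)) (pm_iso m A) (u A)"
      using A iso[OF A] by (simp add: u_def)
    then have usq: "u A \<in> squares (Base L)" by (simp add: inverse_arrs_iff)
    have uA: "sq_src (u A) = on_obj (pm_total ?n) A" "sq_tgt (u A) = on_obj (pm_total m) A"
      using A by (simp_all add: u_def)
    then have "u A \<in> Arr (Total L)"
      using A usq m.total.on_obj_in[OF A] n.total.on_obj_in[OF A] by (simp add: L.arr_iff)
    then show ?thesis
      using uu usq iso[OF A] uA A m.total.on_obj_in[OF A] n.total.on_obj_in[OF A] L.obj_arr[OF
          m.total.on_obj_in[OF A]] L.obj_arr[OF n.total.on_obj_in[OF A]]
      by (simp add: inverse_arrs_iff n(2) base)
  qed
  have ntu: "nat_trans (Total K) (Total L) (pm_total ?n) (pm_total m) u"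
    by (rule nat_trans_inverse[OF nt inv]) (simp_all only: u_def restrict_extensional)
  let ?id = "id_nt (Base K) (Base L) (pm_base m)"
  let ?t = "\<lparr> ct_src = m, ct_tgt = ?n, ct_base = ?id, ct_total = pm_iso m \<rparr>"
  let ?s = "\<lparr> ct_src = ?n, ct_tgt = m, ct_base = ?id, ct_total = u \<rparr>"
  have t: "cc_transformation K L ?t"
    by (rule cc_transformationI)
       (simp_all add: assms n(1) base nt nat_trans_id m.pm_base_functor iso n(4) K.obj_arr)
  have s: "cc_transformation K L ?s"
  proof (rule cc_transformationI)
    fix A assume A: "A \<in> Obj (Total K)"
    have "u A \<in> Arr (Total L)" "sq_cod (u A) = Ide (Base L) (on_obj (pm_base m) (Cod (Base K) A))"
      using inv[OF A] A by (simp_all add: inverse_arrs_iff u_def)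
    then show "on_arr (Proj L) (ct_total ?s A) = ct_base ?s (on_obj (Proj K) A)"
      and "sq_dom (pm_iso (ct_tgt ?s) A) \<cdot>\<^bsub>Base L\<^esub> sq_dom (on_arr (Compr L) (ct_total ?s A))
        = ct_base ?s (Dom (Base K) (on_obj (Compr K) A)) \<cdot>\<^bsub>Base L\<^esub> sq_dom (pm_iso (ct_src ?s) A)"
      using A inv_dom[OF A] by (simp_all add: inverse_arrs_iff n(4) K.obj_arr base)
  qed (simp_all add: assms n(1) base ntu nat_trans_id m.pm_base_functor)
  have "vcomp_nt (Base K) (Base L) ?id ?id = ?id"
    by (rule vcomp_id[OF nat_trans_id[OF m.pm_base_functor]])
  \<comment> \<open>The rules computing composites and identities of \<open>Total L\<close> are
    withheld, so that the inverse equations apply as they stand.\<close>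
  moreover have "vcomp_nt (Total K) (Total L) u (pm_iso m) = id_nt (Total K) (Total L) (pm_total m)"
    "vcomp_nt (Total K) (Total L) (pm_iso m) u = id_nt (Total K) (Total L) (pm_total ?n)"
    using inv iso by (auto simp: vcomp_nt_def inverse_arrs_iff simp del: L.repl_comp L.repl_ide)
  ultimately have "inverse_arrs (compcat_hom K L) ?s ?t"
    using s t assms n(1) by (simp add: inverse_arrs_iff base)
  then show ?thesis
    using s by (auto simp: isomorphic_def iso_arr_def homset_iff intro!: bexI[of _ ?s])
qed

section \<open>The 2-categories of replete comprehension categories and the inclusion of strict
  maps\<close>

lemma CompCat_repl_simps [simp]:
  "K \<in> Ob CompCat_repl \<longleftrightarrow> repl_compcat K" "HomCat CompCat_repl = compcat_hom"
  "Id1 CompCat_repl = pm_id" "HComp CompCat_repl = HComp CompCat"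
  by (auto simp: CompCat_repl_def full_sub_twocat_def repl_compcat_def replete_compcat_def
      subcategorical_def)

lemma CompCat_str2_repl_eq: "CompCat_str2_repl = locally_full_sub_twocat CompCat_repl strict_map"
  by (simp add: CompCat_str2_repl_def CompCat_str2_def CompCat_repl_def full_sub_locally_full_sub)

lemma two_category_CompCat_repl: "two_category CompCat_repl"
  unfolding CompCat_repl_def by (rule two_category_full_sub[OF two_category_CompCat])

lemma strict_map_repl_id: "K \<in> Ob CompCat_repl \<Longrightarrow> strict_map K K (Id1 CompCat_repl K)"
  using strict_map_id by (auto simp: repl_compcat_def replete_compcat_def subcategorical_def)

lemma strict_map_pseudo: "strict_map K L m \<Longrightarrow> pseudo_map K L m"
  by (simp add: strict_map_def)

lemma strict_map_repl_comp:
  "\<lbrakk>m \<in> Obj (HomCat CompCat_repl K L); n \<in> Obj (HomCat CompCat_repl L M);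
    strict_map K L m; strict_map L M n\<rbrakk>
   \<Longrightarrow> strict_map K M (on_obj (HComp CompCat_repl K L M) (n, m))"
  by (simp add: strict_map_comp)

text \<open>The premises of the results on locally full sub-2-categories, in the order in which
  those results take them.\<close>

lemmas str2_sub = two_category_CompCat_repl strict_map_repl_id strict_map_repl_comp

lemma two_category_CompCat_str2_repl: "two_category CompCat_str2_repl"
  unfolding CompCat_str2_repl_eq by (rule two_category_locally_full_sub[OF str2_sub])

abbreviation "strict_hom \<equiv> HomCat CompCat_str2_repl"

lemma CompCat_str2_repl_hom: "strict_hom K L = full_subcat (compcat_hom K L) {m. strict_map K L m}"
  by (simp add: CompCat_str2_repl_eq locally_full_sub_simps)

lemma CompCat_str2_repl_simps [simp]:
  "K \<in> Ob CompCat_str2_repl \<longleftrightarrow> repl_compcat K"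
  "m \<in> Obj (strict_hom K L) \<longleftrightarrow> strict_map K L m"
  "t \<in> Arr (strict_hom K L)
    \<longleftrightarrow> cc_transformation K L t \<and> strict_map K L (ct_src t) \<and> strict_map K L (ct_tgt t)"
  "Id1 CompCat_str2_repl = pm_id"
  by (auto simp: CompCat_str2_repl_eq locally_full_sub_simps strict_map_pseudo)

lemma CompCat_str2_repl_dom [simp]:
  assumes "t \<in> Arr (strict_hom K L)"
  shows "Dom (strict_hom K L) t = ct_src t" "Cod (strict_hom K L) t = ct_tgt t"
proof -
  have "cc_transformation K L t" "strict_map K L (ct_src t)" "strict_map K L (ct_tgt t)"
    using assms by simp_all
  then show "Dom (strict_hom K L) t = ct_src t" "Cod (strict_hom K L) t = ct_tgt t"
    by (simp_all add: CompCat_str2_repl_hom)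
qed

lemma CompCat_str2_repl_hcomp [simp]:
  "\<lbrakk>strict_map L M n; strict_map K L m\<rbrakk> \<Longrightarrow> on_obj (HComp CompCat_str2_repl K L M) (n, m)
      = pm_comp K L M n m"
  "\<lbrakk>t \<in> Arr (strict_hom L M); s \<in> Arr (strict_hom K L)\<rbrakk>
   \<Longrightarrow> on_arr (HComp CompCat_str2_repl K L M) (t, s) = cc_hcomp K L M t s"
proof -
  show "\<lbrakk>strict_map L M n; strict_map K L m\<rbrakk>
      \<Longrightarrow> on_obj (HComp CompCat_str2_repl K L M) (n, m) = pm_comp K L M n m"
    using locally_full_sub_simps(4)[of n CompCat_repl L M strict_map m K]
    by (simp add: CompCat_str2_repl_eq[symmetric] strict_map_pseudo)
  show "\<lbrakk>t \<in> Arr (strict_hom L M); s \<in> Arr (strict_hom K L)\<rbrakk>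
      \<Longrightarrow> on_arr (HComp CompCat_str2_repl K L M) (t, s) = cc_hcomp K L M t s"
    using locally_full_sub_simps(5)[of t CompCat_repl L M strict_map s K]
    by (simp add: CompCat_str2_repl_eq[symmetric])
qed

lemma str2_incl_two_functor:
  "two_functor CompCat_str2_repl CompCat_repl (incl_twofnctr CompCat_str2_repl)"
  unfolding CompCat_str2_repl_eq by (rule incl_locally_full_sub[OF str2_sub])

lemma str2_incl_simps [simp]:
  "repl_compcat K \<Longrightarrow> tf_ob (incl_twofnctr CompCat_str2_repl) K = K"
  "\<lbrakk>repl_compcat K; repl_compcat L; strict_map K L m\<rbrakk>
   \<Longrightarrow> on_obj (tf_hom (incl_twofnctr CompCat_str2_repl) K L) m = m"
  by (simp_all add: id_twofnctr_def)

lemma str2_incl_hom: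
  assumes "repl_compcat K" "repl_compcat L"
  shows "cat_functor (strict_hom K L) (compcat_hom K L) (tf_hom (incl_twofnctr CompCat_str2_repl) K L)"
    and "full_functor (strict_hom K L) (compcat_hom K L) (tf_hom (incl_twofnctr CompCat_str2_repl) K L)"
    and "faithful_functor (strict_hom K L) (tf_hom (incl_twofnctr CompCat_str2_repl) K L)"
  using two_functor.tf_hom_functor[OF str2_incl_two_functor, of K L]
    incl_locally_full_sub_hom[of K CompCat_repl L strict_map] assms
  by (simp_all add: CompCat_str2_repl_eq[symmetric])

text \<open>The inclusion fixes objects, so surjectivity on them is reflexivity of internal
  equivalence. On hom-categories it is full and faithful, and strictification gives essential
  surjectivity.\<close>

lemma str2_incl_equivalence:
  "two_equivalence (CompCat_str2_repl :: ('o, 'a) repl_twocat) CompCat_repl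
      (incl_twofnctr CompCat_str2_repl)"
  unfolding two_equivalence_def
proof (intro conjI ballI)
  show "two_functor (CompCat_str2_repl :: ('o, 'a) repl_twocat) CompCat_repl
      (incl_twofnctr CompCat_str2_repl)"
    by (rule str2_incl_two_functor)
  fix K :: "('o, 'a) repl_compcat" assume "K \<in> Ob CompCat_repl"
  then show "\<exists>X\<in>Ob CompCat_str2_repl. internally_equivalent CompCat_repl
      (tf_ob (incl_twofnctr CompCat_str2_repl) X) K"
    using two_category.internally_equivalent_refl[OF two_category_CompCat_repl, of K]
    by (intro bexI[of _ K]) simp_all
next
  fix K L :: "('o, 'a) repl_compcat"
  assume "K \<in> Ob CompCat_str2_repl" "L \<in> Ob CompCat_str2_repl"
  then have KL [simp]: "repl_compcat K" "repl_compcat L" by simp_all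
  then interpret repl_compcats K L by (rule repl_compcats.intro)
  have "equivalence_functor (strict_hom K L) (compcat_hom K L)
      (tf_hom (incl_twofnctr CompCat_str2_repl) K L)"
  proof (rule equivalence_functorI[OF str2_incl_hom[OF KL]])
    fix m assume "m \<in> Obj (compcat_hom K L)"
    then have m: "pseudo_map K L m" by simp
    show "\<exists>n\<in>Obj (strict_hom K L).
        isomorphic (compcat_hom K L) (on_obj (tf_hom (incl_twofnctr CompCat_str2_repl) K L) n) m"
      using pseudo_map_strictify[OF m] strict_pmap[OF pseudo_map_dmc_map[OF m]]
      by (intro bexI[of _ "strict_pmap K L (pm_base m)"]) simp_all
  qed
  then show "equivalence_functor (strict_hom K L)
      (HomCat CompCat_repl (tf_ob (incl_twofnctr CompCat_str2_repl) K) (tf_ob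
          (incl_twofnctr CompCat_str2_repl) L))
      (tf_hom (incl_twofnctr CompCat_str2_repl) K L)"
    by simp
qed

section \<open>The 2-functor forgetting total categories and its bijectivity\<close>

definition forget_twofnctr where
  "forget_twofnctr =
    \<lparr> tf_ob = restrict dmcat_of (Ob CompCat_str2_repl),
      tf_hom = (\<lambda>K L. if K \<in> Ob CompCat_str2_repl \<and> L \<in> Ob CompCat_str2_repl then
        \<lparr> on_obj = restrict pm_base (Obj (strict_hom K L)),
          on_arr = (\<lambda>t \<in> Arr (strict_hom K L).
            \<lparr> dt_src = pm_base (ct_src t), dt_tgt = pm_base (ct_tgt t), dt_comp = ct_base t \<rparr>) \<rparr>
        else undefined) \<rparr>"

abbreviation "forget_hom \<equiv> tf_hom forget_twofnctr"

lemma forget_simps [simp]: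
  "repl_compcat K \<Longrightarrow> tf_ob forget_twofnctr K = dmcat_of K"
  "\<lbrakk>repl_compcat K; repl_compcat L; strict_map K L m\<rbrakk> \<Longrightarrow> on_obj (forget_hom K L) m = pm_base m"
  "\<lbrakk>repl_compcat K; repl_compcat L; t \<in> Arr (strict_hom K L)\<rbrakk>
   \<Longrightarrow> on_arr (forget_hom K L) t
     = \<lparr> dt_src = pm_base (ct_src t), dt_tgt = pm_base (ct_tgt t), dt_comp = ct_base t \<rparr>"
  by (simp_all add: forget_twofnctr_def)

context repl_compcats
begin

lemma strict_map_base_dmc_map: "strict_map K L m \<Longrightarrow> dmc_map (dmcat_of K) (dmcat_of L) (pm_base m)"
  using pseudo_map_dmc_map strict_mapD(1) by blast

lemma forget_2cell:
  "t \<in> Arr (strict_hom K L) \<Longrightarrow> dmc_transformation (dmcat_of K) (dmcat_of L)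
     \<lparr> dt_src = pm_base (ct_src t), dt_tgt = pm_base (ct_tgt t), dt_comp = ct_base t \<rparr>"
  by (simp add: dmc_transformation_def strict_map_base_dmc_map cc_transformation.ct_base_nt)

lemma forget_hom_functor:
  "cat_functor (strict_hom K L) (dmc_hom (dmcat_of K) (dmcat_of L)) (forget_hom K L)"
proof -
  interpret S: two_category CompCat_str2_repl by (rule two_category_CompCat_str2_repl)
  have ax [simp]: "repl_compcat K" "repl_compcat L"
      by (fact K.repl_compcat_axioms L.repl_compcat_axioms)+
  interpret H: category "strict_hom K L" using S.hom_category[of K L] by simp
  show ?thesis
  proof (rule cat_functorI)
    fix t assume t: "t \<in> Arr (strict_hom K L)"
    then show "on_arr (forget_hom K L) t \<in> Arr (dmc_hom (dmcat_of K) (dmcat_of L))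
      \<and> Dom (dmc_hom (dmcat_of K) (dmcat_of L)) (on_arr (forget_hom K L) t)
        = on_obj (forget_hom K L) (Dom (strict_hom K L) t)
      \<and> Cod (dmc_hom (dmcat_of K) (dmcat_of L)) (on_arr (forget_hom K L) t)
        = on_obj (forget_hom K L) (Cod (strict_hom K L) t)"
      using t forget_2cell[OF t] by simp
  next
    fix m assume m: "m \<in> Obj (strict_hom K L)"
    \<comment> \<open>Identities and composites of the full subcategory agree with those of
      \<open>compcat_hom\<close>, where they have an explicit form.\<close>
    then have "Ide (strict_hom K L) m = Ide (compcat_hom K L) m"
      by (simp add: CompCat_str2_repl_hom strict_mapD)
    then show "on_arr (forget_hom K L) (Ide (strict_hom K L) m)
        = Ide (dmc_hom (dmcat_of K) (dmcat_of L)) (on_obj (forget_hom K L) m)"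
      using m H.ide_arr(1)[OF m] by (simp add: strict_mapD strict_map_base_dmc_map)
  next
    fix s t assume *: "s \<in> Arr (strict_hom K L)" "t \<in> Arr (strict_hom K L)"
      "Dom (strict_hom K L) t = Cod (strict_hom K L) s"
    then have eq: "ct_src t = ct_tgt s" by simp
    have "cc_transformation K L s" "strict_map K L (ct_src s)" "strict_map K L (ct_tgt s)"
      "cc_transformation K L t" "strict_map K L (ct_src t)" "strict_map K L (ct_tgt t)"
      using *(1,2) by simp_all
    then have "t \<cdot>\<^bsub>strict_hom K L\<^esub> s = t \<cdot>\<^bsub>compcat_hom K L\<^esub> s"
      using eq by (simp add: CompCat_str2_repl_hom)
    then show "on_arr (forget_hom K L) (t \<cdot>\<^bsub>strict_hom K L\<^esub> s)
      = on_arr (forget_hom K L) t \<cdot>\<^bsub>dmc_hom (dmcat_of K) (dmcat_of L)\<^esub> on_arr (forget_hom K L) s"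
      using * eq H.comp_arr(1)[OF *] forget_2cell[OF *(1)] forget_2cell[OF *(2)] by simp
  qed (auto simp: H.category_axioms dmc_hom_category strict_map_base_dmc_map, auto simp:
      forget_twofnctr_def)
qed

lemma forget_bij_1:
  "bij_betw (on_obj (forget_hom K L)) (Obj (strict_hom K L))
    (Obj (dmc_hom (dmcat_of K) (dmcat_of L)))"
proof (rule bij_betw_byWitness[where f' = "strict_pmap K L"])
  have ax [simp]: "repl_compcat K" "repl_compcat L"
      by (fact K.repl_compcat_axioms L.repl_compcat_axioms)+
  have base: "pm_base (strict_pmap K L F) = F" for F by (simp add: strict_pmap_def)
  show "\<forall>m\<in>Obj (strict_hom K L). strict_pmap K L (on_obj (forget_hom K L) m) = m"
    by (simp add: strict_pmap_base)
  show "\<forall>F\<in>Obj (dmc_hom (dmcat_of K) (dmcat_of L)). on_obj (forget_hom K L) (strict_pmap K L F) = F"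
    by (simp add: strict_pmap base)
qed (auto simp: strict_map_base_dmc_map strict_pmap K.repl_compcat_axioms L.repl_compcat_axioms)

text \<open>Source and target come from strictness, the codomain component from lying over
  \<open>ct_base t\<close>, and the domain component from compatibility, in which the comparison
  arrows of strict maps are identities.\<close>

lemma strict_transformation_total:
  assumes "t \<in> Arr (strict_hom K L)" "A \<in> Obj (Total K)"
  shows "ct_total t A = Square (on_arr (pm_base (ct_src t)) A) (on_arr (pm_base (ct_tgt t)) A)
    (ct_base t (Dom (Base K) A)) (ct_base t (Cod (Base K) A))"
proof -
  interpret t: cc_transformation K L t using assms by simp
  note A = assms(2)
  have src: "strict_map K L (ct_src t)" and tgt: "strict_map K L (ct_tgt t)"
    using assms by simp_all
  have T: "ct_total t A \<in> Arr (Total L)" "sq_src (ct_total t A) = on_arr (pm_base (ct_src t)) A"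
    "sq_tgt (ct_total t A) = on_arr (pm_base (ct_tgt t)) A"
    using t.total.component_arr[OF A] A by (simp_all add: strict_mapD(2)[OF src] strict_mapD(2)[OF tgt])
  then have sq: "ct_total t A \<in> squares (Base L)" by (simp add: L.arr_iff)
  have "sq_cod (ct_total t A) = ct_base t (Cod (Base K) A)"
    using t.ct_over[OF A] T A by simp
  moreover have "sq_dom (ct_total t A) = ct_base t (Dom (Base K) A)"
    using t.compat[OF A] T A square_arrD[OF sq] K.obj_arr[OF A]
    by (simp add: strict_mapD(4)[OF src] strict_mapD(4)[OF tgt])
  ultimately show ?thesis by (simp add: square.expand T)
qed

lemma forget_bij_2:
  "bij_betw (on_arr (forget_hom K L)) (Arr (strict_hom K L))
    (Arr (dmc_hom (dmcat_of K) (dmcat_of L)))"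
proof -
  have ax [simp]: "repl_compcat K" "repl_compcat L"
      by (fact K.repl_compcat_axioms L.repl_compcat_axioms)+
  \<comment> \<open>The total component is the one forced by
    \<open>strict_transformation_total\<close>, between the strict maps on the two given
    functors.\<close>
  define lift :: "('o, 'a) dmctrans \<Rightarrow> ('o, 'a) repl_cctrans" where
      "lift r = \<lparr> ct_src = strict_pmap K L (dt_src r), ct_tgt = strict_pmap K L (dt_tgt r),
    ct_base = dt_comp r, ct_total
        = (\<lambda>A \<in> Obj (Total K). Square (on_arr (dt_src r) A) (on_arr (dt_tgt r) A)
      (dt_comp r (Dom (Base K) A)) (dt_comp r (Cod (Base K) A))) \<rparr>" for r
  have base: "pm_base (strict_pmap K L F) = F" for F by (simp add: strict_pmap_def)
  have lift: "lift r \<in> Arr (strict_hom K L)"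
    if r: "dmc_transformation (dmcat_of K) (dmcat_of L) r" for r
  proof -
    note r = dmc_transformationD[OF r]
    note src = strict_pmap[OF r(1)] and tgt = strict_pmap[OF r(2)]
    note S = strict_mapD[OF src] and T = strict_mapD[OF tgt]
    interpret S: pseudo_map K L "strict_pmap K L (dt_src r)" by (rule S(1))
    interpret T: pseudo_map K L "strict_pmap K L (dt_tgt r)" by (rule T(1))
    interpret nt: nat_trans "Base K" "Base L" "dt_src r" "dt_tgt r" "dt_comp r"
      using r(3) by simp
    have dS: "on_arr (dt_src r) A \<in> Obj (Total L)" and dT: "on_arr (dt_tgt r) A \<in> Obj (Total L)"
      if "A \<in> Obj (Total K)" for A
      using S.total.on_obj_in[OF that] T.total.on_obj_in[OF that] that by (simp_all add: S T base)
    \<comment> \<open>The square commutes by naturality of \<open>dt_comp r\<close> at the display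
      map \<open>A\<close>.\<close>
    have tot: "Square (on_arr (dt_src r) A) (on_arr (dt_tgt r) A)
      (dt_comp r (Dom (Base K) A)) (dt_comp r (Cod (Base K) A)) \<in> Arr (Total L)"
      if "A \<in> Obj (Total K)" for A
      using that nt.natural[of A] by (simp add: L.arr_iff dS dT squares_iff K.obj_arr)
    have "cc_transformation K L (lift r)"
    proof (rule cc_transformationI)
      show "nat_trans (Total K) (Total L) (pm_total (ct_src (lift r))) (pm_total (ct_tgt
          (lift r))) (ct_total (lift r))"
      proof (rule nat_transI)
        fix s assume s: "s \<in> Arr (Total K)"
        then have sq: "s \<in> squares (Base K)" "sq_src s \<in> Obj (Total K)" "sq_tgt s \<in> Obj (Total K)"
          by (simp_all add: K.arr_iff)
        have "map_square (on_arr (dt_src r)) s \<in> Arr (Total L)"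
            "map_square (on_arr (dt_tgt r)) s \<in> Arr (Total L)"
          using S.total.on_arr_arr(1)[OF s] T.total.on_arr_arr(1)[OF s] s by (simp_all add: S T base)
        \<comment> \<open>Naturality at the square \<open>s\<close> splits into naturality of
          \<open>dt_comp r\<close> at its components \<open>sq_dom s\<close> and
          \<open>sq_cod s\<close>.\<close>
        then show "ct_total (lift r) (Cod (Total K) s) \<cdot>\<^bsub>Total L\<^esub> on_arr (pm_total (ct_src (lift r))) s
          = on_arr (pm_total (ct_tgt (lift r))) s \<cdot>\<^bsub>Total L\<^esub> ct_total (lift r) (Dom (Total K) s)"
          using s sq tot square_arrD[OF sq(1)] nt.natural[of "sq_dom s"] nt.natural[of "sq_cod s"]
          by (simp add: lift_def S T base square.map_sel)
      qed (simp_all add: lift_def S.pm_total_functor T.pm_total_functor tot S T base)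
    qed (simp_all add: lift_def S T base nt.nat_trans_axioms tot K.obj_arr)
    then show ?thesis using src tgt by (simp add: lift_def)
  qed
  show ?thesis
  proof (rule bij_betw_byWitness[where f' = lift])
    show "\<forall>t\<in>Arr (strict_hom K L). lift (on_arr (forget_hom K L) t) = t"
    proof
      fix t assume t: "t \<in> Arr (strict_hom K L)"
      then interpret t: cc_transformation K L t by simp
      have "strict_pmap K L (pm_base (ct_src t)) = ct_src t"
          "strict_pmap K L (pm_base (ct_tgt t)) = ct_tgt t"
        using t by (simp_all add: strict_pmap_base)
      moreover have "(\<lambda>A \<in> Obj (Total K). Square (on_arr (pm_base (ct_src t)) A) (on_arr (pm_base
          (ct_tgt t)) A)
          (ct_base t (Dom (Base K) A)) (ct_base t (Cod (Base K) A))) = ct_total t"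
        by (rule extensionalityI[OF _ t.total.component_ext]) (simp_all
            add: strict_transformation_total[OF t])
      ultimately show "lift (on_arr (forget_hom K L) t) = t"
        using t by (simp add: lift_def)
    qed
    show "\<forall>r\<in>Arr (dmc_hom (dmcat_of K) (dmcat_of L)). on_arr (forget_hom K L) (lift r) = r"
      using lift by (simp add: lift_def base)
    show "on_arr (forget_hom K L) ` Arr (strict_hom K L)
        \<subseteq> Arr (dmc_hom (dmcat_of K) (dmcat_of L))"
      using forget_2cell by auto
    show "lift ` Arr (dmc_hom (dmcat_of K) (dmcat_of L)) \<subseteq> Arr (strict_hom K L)"
      using lift by auto
  qed
qed

end

lemma repl_compcat_dmc_compcat:
  assumes "display_map_category (fst X) (snd X)"
  shows "repl_compcat (dmc_compcat X)" "dmcat_of (dmc_compcat X) = X"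
proof -
  interpret display_map_category "fst X" "snd X" by fact
  show "repl_compcat (dmc_compcat X)"
    using dmc_compcat_replete by (simp add: repl_compcat_def)
  show "dmcat_of (dmc_compcat X) = X"
    using display_arr by (auto simp: prod_eq_iff)
qed

lemma forget_bij_ob: "bij_betw (tf_ob forget_twofnctr) (Ob CompCat_str2_repl) (Ob DMC)"
proof (rule bij_betw_byWitness[where f' = dmc_compcat])
  show "tf_ob forget_twofnctr ` Ob CompCat_str2_repl \<subseteq> Ob DMC"
    by (auto simp: repl_compcat.replete replete_compcat_display(1))
qed (auto simp: repl_compcat_dmc_compcat repl_compcat.dmc_compcat_dmcat_of)

text \<open>Composition of strict maps and horizontal composition of transformations act on base
  parts exactly as in \<open>DMC\<close>, so the laws are obtained by evaluating both sides.\<close>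

lemma forget_two_functor:
  "two_functor (CompCat_str2_repl :: ('o, 'a) repl_twocat) DMC forget_twofnctr"
proof (rule two_functor.intro[OF two_category_CompCat_str2_repl two_category_DMC
    two_functor_axioms.intro])
  fix K L M :: "('o, 'a) repl_compcat"
  show "tf_ob forget_twofnctr K \<in> Ob DMC" if "K \<in> Ob CompCat_str2_repl"
    using that by (simp add: repl_compcat.replete replete_compcat_display(1))
  show "cat_functor (strict_hom K L) (HomCat DMC (tf_ob forget_twofnctr K) (tf_ob forget_twofnctr L))
      (forget_hom K L)" if "K \<in> Ob CompCat_str2_repl" "L \<in> Ob CompCat_str2_repl"
    using that repl_compcats.forget_hom_functor[of K L] by (simp add: repl_compcats_def)
  show "on_obj (forget_hom K K) (Id1 CompCat_str2_repl K) = Id1 DMC (tf_ob forget_twofnctr K)"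
    if "K \<in> Ob CompCat_str2_repl"
    using that strict_map_repl_id[of K] by simp
  show "on_obj (forget_hom K M) (on_obj (HComp CompCat_str2_repl K L M) (n, m))
      = on_obj (HComp DMC (tf_ob forget_twofnctr K) (tf_ob forget_twofnctr L) (tf_ob forget_twofnctr M))
          (on_obj (forget_hom L M) n, on_obj (forget_hom K L) m)"
    if *: "K \<in> Ob CompCat_str2_repl" "L \<in> Ob CompCat_str2_repl" "M \<in> Ob CompCat_str2_repl"
      "m \<in> Obj (strict_hom K L)" "n \<in> Obj (strict_hom L M)" for m n
    using * repl_compcats.strict_map_base_dmc_map[of K L m]
        repl_compcats.strict_map_base_dmc_map[of L M n]
    by (simp add: repl_compcats_def strict_map_comp)
  show "on_arr (forget_hom K M) (on_arr (HComp CompCat_str2_repl K L M) (t, s))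
      = on_arr (HComp DMC (tf_ob forget_twofnctr K) (tf_ob forget_twofnctr L) (tf_ob forget_twofnctr M))
          (on_arr (forget_hom L M) t, on_arr (forget_hom K L) s)"
    if *: "K \<in> Ob CompCat_str2_repl" "L \<in> Ob CompCat_str2_repl" "M \<in> Ob CompCat_str2_repl"
      "s \<in> Arr (strict_hom K L)" "t \<in> Arr (strict_hom L M)" for s t
  proof -
    interpret S: two_category CompCat_str2_repl by (rule two_category_CompCat_str2_repl)
    \<comment> \<open>The horizontal composite is again a 2-cell between strict maps, so
      \<open>forget_hom\<close> can be evaluated at it.\<close>
    have "cc_hcomp K L M t s \<in> Arr (strict_hom K M)"
      using S.hcomp_simps(2)[OF *(1-3,5,4)] * by simp
    then show ?thesis
      using * repl_compcats.forget_2cell[OF repl_compcats.intro *(4)]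
        repl_compcats.forget_2cell[OF repl_compcats.intro *(5)]
      by (simp add: dmc_hcomp_def) (simp add: cc_hcomp_def)
  qed
qed (auto simp: forget_twofnctr_def)

section \<open>The isomorphism of 2-categories and the composite equivalence\<close>

theorem theorem16:
  shows "two_category (DMC :: ('o, 'a) dmc_twocat)
    \<and> two_category (CompCat_str2_repl :: ('o, 'a) repl_twocat)
    \<and> two_category (CompCat_repl :: ('o, 'a) repl_twocat)
    \<and> two_equivalence (CompCat_str2_repl :: ('o, 'a) repl_twocat) CompCat_repl
        (incl_twofnctr CompCat_str2_repl)
    \<and> (\<exists>\<Phi>. (\<forall>X \<in> Ob (DMC :: ('o, 'a) dmc_twocat). tf_ob \<Phi> X = dmc_compcat X)
         \<and> two_isomorphism DMC CompCat_str2_repl \<Phi>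
         \<and> two_equivalence DMC CompCat_repl
             (comp_twofnctr DMC (incl_twofnctr CompCat_str2_repl) \<Phi>))"
proof -
  let ?I = "incl_twofnctr CompCat_str2_repl :: (_, _, _, ('o, 'a) repl_compcat, _, _) twofnctr"
  obtain \<Phi> where \<Phi>: "two_isomorphism (DMC :: ('o, 'a) dmc_twocat) CompCat_str2_repl \<Phi>"
    and ob': "\<And>K. K \<in> Ob CompCat_str2_repl \<Longrightarrow> tf_ob \<Phi> (tf_ob forget_twofnctr K) = K"
    and hom: "\<And>X Y. \<lbrakk>X \<in> Ob DMC; Y \<in> Ob DMC\<rbrakk> \<Longrightarrow>
      full_functor (HomCat DMC X Y) (HomCat CompCat_str2_repl (tf_ob \<Phi> X) (tf_ob \<Phi> Y)) (tf_hom \<Phi> X Y)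
      \<and> faithful_functor (HomCat DMC X Y) (tf_hom \<Phi> X Y)
      \<and> on_obj (tf_hom \<Phi> X Y) ` Obj (HomCat DMC X Y)
          = Obj (HomCat CompCat_str2_repl (tf_ob \<Phi> X) (tf_ob \<Phi> Y))"
  proof (rule two_isomorphismI[OF forget_two_functor forget_bij_ob])
    show "bij_betw (on_obj (forget_hom K L)) (Obj (strict_hom K L))
        (Obj (HomCat DMC (tf_ob forget_twofnctr K) (tf_ob forget_twofnctr L)))"
      "bij_betw (on_arr (forget_hom K L)) (Arr (strict_hom K L))
        (Arr (HomCat DMC (tf_ob forget_twofnctr K) (tf_ob forget_twofnctr L)))"
      if "K \<in> Ob CompCat_str2_repl" "L \<in> Ob CompCat_str2_repl" for K L
      using that repl_compcats.forget_bij_1[of K L] repl_compcats.forget_bij_2[of K L]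
      by (simp_all only: CompCat_str2_repl_simps forget_simps DMC_simps repl_compcats_def)
  qed blast
  \<comment> \<open>Every display map category is what remains of its comprehension category after
    forgetting, so the inverse \<open>\<Phi>\<close> sends it back there. This gives the abstractly
    obtained \<open>\<Phi>\<close> its prescribed values on objects.\<close>
  have ob: "tf_ob \<Phi> X = dmc_compcat X" if "X \<in> Ob DMC" for X
    using ob'[of "dmc_compcat X"] that by (simp add: repl_compcat_dmc_compcat)
  interpret \<Phi>: two_functor "DMC :: ('o, 'a) dmc_twocat" CompCat_str2_repl \<Phi>
    using \<Phi> by (simp add: two_isomorphism_def)
  interpret R: two_category "CompCat_repl :: ('o, 'a) repl_twocat" by (rule two_category_CompCat_repl)
  have I: "two_functor CompCat_str2_repl CompCat_repl ?I"
    by (rule str2_incl_two_functor)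
  \<comment> \<open>The hom-functors of the composite are treated directly as full, faithful and
    essentially surjective, by way of the properties of \<open>\<Phi>\<close> and of the
    inclusion.\<close>
  have "equivalence_functor (dmc_hom X Y) (compcat_hom (dmc_compcat X) (dmc_compcat Y))
      (tf_hom (comp_twofnctr DMC ?I \<Phi>) X Y)" if XY: "X \<in> Ob DMC" "Y \<in> Ob DMC" for X Y
  proof (rule equivalence_functorI)
    let ?K = "dmc_compcat X" and ?L = "dmc_compcat Y"
    have KL: "repl_compcat ?K" "repl_compcat ?L" using XY by (simp_all add: repl_compcat_dmc_compcat)
    interpret repl_compcats ?K ?L using KL by (rule repl_compcats.intro)
    have F: "cat_functor (dmc_hom X Y) (strict_hom ?K ?L) (tf_hom \<Phi> X Y)"
      using \<Phi>.tf_hom_functor[OF XY] XY by (simp add: ob)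
    have eq: "tf_hom (comp_twofnctr DMC ?I \<Phi>) X Y
        = comp_fnctr (dmc_hom X Y) (tf_hom ?I ?K ?L) (tf_hom \<Phi> X Y)"
      using XY ob by (simp del: DMC_simps(1) add: comp_twofnctr_simps)
    note Iff = str2_incl_hom[OF KL]
    have hom': "full_functor (dmc_hom X Y) (strict_hom ?K ?L) (tf_hom \<Phi> X Y)"
      "faithful_functor (dmc_hom X Y) (tf_hom \<Phi> X Y)"
      "on_obj (tf_hom \<Phi> X Y) ` Obj (dmc_hom X Y) = Obj (strict_hom ?K ?L)"
      using hom[OF XY] ob XY by simp_all
    show "cat_functor (dmc_hom X Y) (compcat_hom ?K ?L) (tf_hom (comp_twofnctr DMC ?I \<Phi>) X Y)"
      unfolding eq by (rule cat_functor_comp[OF F Iff(1)])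
    show "full_functor (dmc_hom X Y) (compcat_hom ?K ?L) (tf_hom (comp_twofnctr DMC ?I \<Phi>) X Y)"
      unfolding eq by (rule full_functor_comp[OF F hom'(1) Iff(2)])
    show "faithful_functor (dmc_hom X Y) (tf_hom (comp_twofnctr DMC ?I \<Phi>) X Y)"
      unfolding eq by (rule faithful_functor_comp[OF F hom'(2) Iff(3)])
    fix m assume "m \<in> Obj (compcat_hom ?K ?L)"
    then have m: "pseudo_map ?K ?L m" by simp
    \<comment> \<open>The strict replacement of \<open>m\<close> lies in the image of
      \<open>\<Phi>\<close> on 1-cells, which yields the required \<open>G\<close>.\<close>
    have "strict_pmap ?K ?L (pm_base m) \<in> Obj (strict_hom ?K ?L)"
      using strict_pmap[OF pseudo_map_dmc_map[OF m]] by simp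
    then obtain G where G: "G \<in> Obj (dmc_hom X Y)"
        "on_obj (tf_hom \<Phi> X Y) G = strict_pmap ?K ?L (pm_base m)"
      unfolding hom'(3)[symmetric] by auto
    have "on_obj (tf_hom ?I ?K ?L) (strict_pmap ?K ?L (pm_base m)) = strict_pmap ?K ?L (pm_base m)"
      using KL strict_pmap[OF pseudo_map_dmc_map[OF m]] by simp
    then show "\<exists>G\<in>Obj (dmc_hom X Y). isomorphic (compcat_hom ?K ?L)
        (on_obj (tf_hom (comp_twofnctr DMC ?I \<Phi>) X Y) G) m"
      using G pseudo_map_strictify[OF m] unfolding eq by (intro bexI[of _ G]) simp_all
  qed
  moreover have obI: "tf_ob (comp_twofnctr DMC ?I \<Phi>) X = dmc_compcat X" if "X \<in> Ob DMC" for X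
    using that ob[OF that] by (simp add: repl_compcat_dmc_compcat)
  \<comment> \<open>Each replete comprehension category is hit exactly, by its own display map
    category, so reflexivity of internal equivalence suffices.\<close>
  moreover have "\<exists>X\<in>Ob DMC. internally_equivalent CompCat_repl (dmc_compcat X) K"
    if "K \<in> Ob CompCat_repl" for K :: "('o, 'a) repl_compcat"
  proof (rule bexI[of _ "dmcat_of K"])
    show "internally_equivalent CompCat_repl (dmc_compcat (dmcat_of K)) K"
      using R.internally_equivalent_refl[OF that] that by (simp add: repl_compcat.dmc_compcat_dmcat_of)
    show "dmcat_of K \<in> Ob DMC"
      using that by (simp add: repl_compcat.replete replete_compcat_display(1))
  qed
  ultimately have "two_equivalence DMC CompCat_repl (comp_twofnctr DMC ?I \<Phi>)"
    using two_functor_comp[OF \<Phi>.two_functor_axioms I] unfolding two_equivalence_def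
    by (metis DMC_simps(2) CompCat_repl_simps(2))
  then show ?thesis
    using two_category_DMC two_category_CompCat_str2_repl two_category_CompCat_repl
        str2_incl_equivalence \<Phi> ob
    by blast
qed

end
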